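(* Let $G$ be a countable discrete ICC group and let $A$ be a finite alphabet with $|A|\ge 2$. Then there is a dense $G_\delta$ subset $\mathcal{D}$ of $\mathcal{S}$ such that for every shift $S\in\mathcal{D}$ the action $G\curvearrowright S$ is faithful, minimal, and proximal.
   Context: A group is ICC if each of its non-identity elements has an infinite conjugacy class. The full shift $A^G$ has the product topology, and $G$ acts on it by left translations, $(gs)(h)=s(g^{-1}h)$. A shift is a closed, $G$-invariant, non-empty subset of $A^G$. Two shifts $S,T\subseteq A^G$ agree on a finite set $X\subseteq G$ if $\{s|_X : s\in S\}=\{t|_X : t\in T\}$. The space of shifts carries the topology (the subspace topology of the Hausdorff/Fell topology) for which the sets $\{T : T \text{ agrees with } S \text{ on } X\}$, $X\subseteq G$ finite, form a basis of neighborhoods of $S$. A shift $S\subseteq A^G$ is strongly irreducible if there exists a finite $X\subseteq G$ including the identity such that for any two subsets $E_1,E_2\subseteq G$ with $E_1X\cap E_2X=\emptyset$ and any $s_1,s_2\in S$ there is $s\in S$ with $s|_{E_1}=s_1|_{E_1}$ and $s|_{E_2}=s_2|_{E_2}$. The space $\mathcal{S}$ is the closure, in the space of shifts, of the set of strongly irreducible shifts, with the $|A|$-many trivial (i.e. singleton) shifts removed, with the subspace topology. An action of $G$ on a compact Hausdorff space $Y$ is proximal if for all $x,y\in Y$ there exists a net $\{g_i\}$ in $G$ with $\lim_i g_ix=\lim_i g_iy$; minimal if every orbit is dense; faithful if no non-identity element of $G$ acts as the identity.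
   Formalization: The group G is additionally assumed to be nontrivial: the trivial group is vacuously ICC under the stated definition, and the claim fails for it because the full shift is then an isolated point of the space and the action on it is not minimal. *)

theory Defs
  imports "HOL-Analysis.Analysis" "HOL-Algebra.Group_Action"
begin

definition ICC :: "('g, 'm) monoid_scheme \<Rightarrow> bool"
  where "ICC G \<longleftrightarrow>
    (\<forall>g\<in>carrier G - {\<one>\<^bsub>G\<^esub>}. infinite {h \<otimes>\<^bsub>G\<^esub> g \<otimes>\<^bsub>G\<^esub> inv\<^bsub>G\<^esub> h |h. h \<in> carrier G})"


section \<open>Shifts\<close>

text \<open>Configurations are the extensional functions \<^term>\<open>carrier G \<rightarrow>\<^sub>E A\<close>.\<close>

definition full_shift :: "('g, 'm) monoid_scheme \<Rightarrow> 'a set \<Rightarrow> ('g \<Rightarrow> 'a) topology"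
  where "full_shift G A = product_topology (\<lambda>_. discrete_topology A) (carrier G)"

definition translate :: "('g, 'm) monoid_scheme \<Rightarrow> 'g \<Rightarrow> ('g \<Rightarrow> 'a) \<Rightarrow> 'g \<Rightarrow> 'a"
  where "translate G g s = (\<lambda>h\<in>carrier G. s (inv\<^bsub>G\<^esub> g \<otimes>\<^bsub>G\<^esub> h))"

definition shifts :: "('g, 'm) monoid_scheme \<Rightarrow> 'a set \<Rightarrow> ('g \<Rightarrow> 'a) set set"
  where "shifts G A =
    {S. closedin (full_shift G A) S \<and> (\<forall>g\<in>carrier G. \<forall>s\<in>S. translate G g s \<in> S) \<and> S \<noteq> {}}"

text \<open>The action on a single shift, restricted to that shift as the library's
  \<^locale>\<open>group_action\<close> requires.\<close>

definition shift_action ::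
    "('g, 'm) monoid_scheme \<Rightarrow> ('g \<Rightarrow> 'a) set \<Rightarrow> 'g \<Rightarrow> ('g \<Rightarrow> 'a) \<Rightarrow> 'g \<Rightarrow> 'a"
  where "shift_action G S g = (\<lambda>s\<in>S. translate G g s)"

definition agree_on :: "'g set \<Rightarrow> ('g \<Rightarrow> 'a) set \<Rightarrow> ('g \<Rightarrow> 'a) set \<Rightarrow> bool"
  where "agree_on X S T \<longleftrightarrow> (\<lambda>s. restrict s X) ` S = (\<lambda>t. restrict t X) ` T"

definition shift_space :: "('g, 'm) monoid_scheme \<Rightarrow> 'a set \<Rightarrow> ('g \<Rightarrow> 'a) set topology"
  where "shift_space G A = topology_generated_by
    {{T \<in> shifts G A. agree_on X S T} |S X. S \<in> shifts G A \<and> finite X \<and> X \<subseteq> carrier G}"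

definition strongly_irreducible :: "('g, 'm) monoid_scheme \<Rightarrow> 'a set \<Rightarrow> ('g \<Rightarrow> 'a) set \<Rightarrow> bool"
  where "strongly_irreducible G A S \<longleftrightarrow> S \<in> shifts G A \<and>
    (\<exists>X. finite X \<and> X \<subseteq> carrier G \<and> \<one>\<^bsub>G\<^esub> \<in> X \<and>
      (\<forall>E1 E2. E1 \<subseteq> carrier G \<longrightarrow> E2 \<subseteq> carrier G \<longrightarrow> (E1 <#>\<^bsub>G\<^esub> X) \<inter> (E2 <#>\<^bsub>G\<^esub> X) = {} \<longrightarrow>
        (\<forall>s1\<in>S. \<forall>s2\<in>S. \<exists>s\<in>S. restrict s E1 = restrict s1 E1 \<and> restrict s E2 = restrict s2 E2)))"

text \<open>The closure of the strongly irreducible shifts, without the trivial (singleton) shifts.\<close>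

definition si_closure_space :: "('g, 'm) monoid_scheme \<Rightarrow> 'a set \<Rightarrow> ('g \<Rightarrow> 'a) set topology"
  where "si_closure_space G A = subtopology (shift_space G A)
    (shift_space G A closure_of {S. strongly_irreducible G A S} - {{s} |s. True})"


section \<open>Dynamics of an action on a topological space\<close>

definition minimal_action :: "('g, 'm) monoid_scheme \<Rightarrow> 'y topology \<Rightarrow> ('g \<Rightarrow> 'y \<Rightarrow> 'y) \<Rightarrow> bool"
  where "minimal_action G Y \<phi> \<longleftrightarrow>
    (\<forall>y\<in>topspace Y. Y closure_of orbit G \<phi> y = topspace Y)"

text \<open>A net in the group is represented by its eventuality filter: a proper filter that
  contains the carrier. Conversely, every such filter is the eventuality filter of a net.\<close>

definition proximal_action :: "('g, 'm) monoid_scheme \<Rightarrow> 'y topology \<Rightarrow> ('g \<Rightarrow> 'y \<Rightarrow> 'y) \<Rightarrow> bool"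
  where "proximal_action G Y \<phi> \<longleftrightarrow>
    (\<forall>x\<in>topspace Y. \<forall>y\<in>topspace Y. \<exists>F z. F \<noteq> bot \<and> (\<forall>\<^sub>F g in F. g \<in> carrier G) \<and>
      limitin Y (\<lambda>g. \<phi> g x) z F \<and> limitin Y (\<lambda>g. \<phi> g y) z F)"


section \<open>Adequacy of the encodings\<close>

lemma agree_on_mono:
  assumes "agree_on Y S T" and "X \<subseteq> Y"
  shows "agree_on X S T"
proof -
  have *: "(\<lambda>s. restrict s X) ` U = (\<lambda>s. restrict s X) ` (\<lambda>s. restrict s Y) ` U"
    for U :: "('a \<Rightarrow> 'b) set"
    using assms(2) by (simp add: image_image Int_absorb1)
  show ?thesis
    using assms(1) unfolding agree_on_def by (subst (1 2) *) simp
qed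

lemma topspace_shift_space: "topspace (shift_space G A) = shifts G A"
  unfolding shift_space_def topology_generated_by_topspace
  by (auto simp: agree_on_def)

lemma openin_shift_space_iff:
  "openin (shift_space G A) U \<longleftrightarrow>
    U \<subseteq> shifts G A \<and>
    (\<forall>S\<in>U. \<exists>X. finite X \<and> X \<subseteq> carrier G \<and> {T \<in> shifts G A. agree_on X S T} \<subseteq> U)"
    (is "_ \<longleftrightarrow> ?R U")
proof
  let ?B = "{{T \<in> shifts G A. agree_on X S T} |S X.
    S \<in> shifts G A \<and> finite X \<and> X \<subseteq> carrier G}"
  assume "openin (shift_space G A) U"
  then have "generate_topology_on ?B U"
    by (simp add: shift_space_def openin_topology_generated_by_iff)
  then show "?R U"
  proof induction
    case (Int a b)
    show ?case
    proof (intro conjI ballI)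
      show "a \<inter> b \<subseteq> shifts G A" using Int by blast
    next
      fix S assume S: "S \<in> a \<inter> b"
      obtain X where X: "finite X" "X \<subseteq> carrier G" "{T \<in> shifts G A. agree_on X S T} \<subseteq> a"
        using Int S by blast
      obtain Y where Y: "finite Y" "Y \<subseteq> carrier G" "{T \<in> shifts G A. agree_on Y S T} \<subseteq> b"
        using Int S by blast
      have "{T \<in> shifts G A. agree_on (X \<union> Y) S T} \<subseteq> a \<inter> b"
        using X(3) Y(3) agree_on_mono[of "X \<union> Y" S _ X] agree_on_mono[of "X \<union> Y" S _ Y] by blast
      then show "\<exists>X. finite X \<and> X \<subseteq> carrier G \<and> {T \<in> shifts G A. agree_on X S T} \<subseteq> a \<inter> b"
        using X Y by (intro exI[of _ "X \<union> Y"]) simp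
    qed
  next
    case (UN K)
    show ?case
    proof (intro conjI ballI)
      show "\<Union>K \<subseteq> shifts G A" using UN.IH by blast
    next
      fix S assume "S \<in> \<Union>K"
      then obtain k where k: "k \<in> K" "S \<in> k" by blast
      then obtain X where "finite X" "X \<subseteq> carrier G" "{T \<in> shifts G A. agree_on X S T} \<subseteq> k"
        using UN.IH[OF k(1)] by blast
      then show "\<exists>X. finite X \<and> X \<subseteq> carrier G \<and> {T \<in> shifts G A. agree_on X S T} \<subseteq> \<Union>K"
        using k(1) by (meson Sup_upper subset_trans)
    qed
  next
    case (Basis s)
    obtain S X where s: "s = {T \<in> shifts G A. agree_on X S T}" "finite X" "X \<subseteq> carrier G"
      using Basis.hyps by blast
    show ?case
    proof (intro conjI ballI)
      show "s \<subseteq> shifts G A" using s by blast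
    next
      fix S' assume "S' \<in> s"
      then have "{T \<in> shifts G A. agree_on X S' T} \<subseteq> s"
        unfolding s agree_on_def by auto
      then show "\<exists>X. finite X \<and> X \<subseteq> carrier G \<and> {T \<in> shifts G A. agree_on X S' T} \<subseteq> s"
        using s by blast
    qed
  qed auto
next
  assume R: "?R U"
  show "openin (shift_space G A) U"
  proof (subst openin_subopen, intro ballI)
    fix S assume S: "S \<in> U"
    then obtain X where X: "finite X" "X \<subseteq> carrier G" "{T \<in> shifts G A. agree_on X S T} \<subseteq> U"
      using R by blast
    have "S \<in> shifts G A" using R S by blast
    then have "openin (shift_space G A) {T \<in> shifts G A. agree_on X S T}"
      unfolding shift_space_def using X by (intro topology_generated_by_Basis) blast
    moreover have "S \<in> {T \<in> shifts G A. agree_on X S T}"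
      using \<open>S \<in> shifts G A\<close> by (simp add: agree_on_def)
    ultimately show "\<exists>T. openin (shift_space G A) T \<and> S \<in> T \<and> T \<subseteq> U"
      using X(3) by blast
  qed
qed

lemma group_action_shift_action:
  assumes "group G" and S: "S \<in> shifts G A"
  shows "group_action G S (shift_action G S)"
proof -
  interpret group G by fact
  have ext: "s \<in> carrier G \<rightarrow>\<^sub>E A" if "s \<in> S" for s
    using S that closedin_subset[of "full_shift G A" S]
    by (auto simp: shifts_def full_shift_def)
  have inS: "translate G g s \<in> S" if "s \<in> S" "g \<in> carrier G" for s g
    using S that by (auto simp: shifts_def)
  have mult: "translate G (g \<otimes>\<^bsub>G\<^esub> h) s = translate G g (translate G h s)"
    if "g \<in> carrier G" "h \<in> carrier G" for g h and s :: "'a \<Rightarrow> 'c"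
    using that by (auto simp: translate_def fun_eq_iff restrict_def inv_mult_group m_assoc)
  have one: "translate G \<one>\<^bsub>G\<^esub> s = s" if "s \<in> S" for s
  proof
    fix h show "translate G \<one>\<^bsub>G\<^esub> s h = s h"
      using PiE_arb[OF ext[OF that], of h] by (auto simp: translate_def)
  qed
  have bij: "shift_action G S g \<in> Bij S" if g: "g \<in> carrier G" for g
  proof -
    have "bij_betw (translate G g) S S"
    proof (rule bij_betwI[where g = "translate G (inv\<^bsub>G\<^esub> g)"])
      show "translate G (inv\<^bsub>G\<^esub> g) (translate G g s) = s" if "s \<in> S" for s
        using mult[of "inv\<^bsub>G\<^esub> g" g s] one[OF that] g by simp
      show "translate G g (translate G (inv\<^bsub>G\<^esub> g) s) = s" if "s \<in> S" for s
        using mult[of g "inv\<^bsub>G\<^esub> g" s] one[OF that] g by simp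
    qed (use inS g in auto)
    then have "bij_betw (shift_action G S g) S S"
      by (rule bij_betw_cong[THEN iffD1, rotated]) (simp add: shift_action_def)
    then show ?thesis by (simp add: Bij_def shift_action_def)
  qed
  have "shift_action G S \<in> hom G (BijGroup S)"
  proof (rule homI)
    fix g h assume g: "g \<in> carrier G" and h: "h \<in> carrier G"
    have "shift_action G S (g \<otimes>\<^bsub>G\<^esub> h) = compose S (shift_action G S g) (shift_action G S h)"
      using g h mult inS by (auto simp: shift_action_def compose_def fun_eq_iff)
    then show "shift_action G S (g \<otimes>\<^bsub>G\<^esub> h) =
        shift_action G S g \<otimes>\<^bsub>BijGroup S\<^esub> shift_action G S h"
      using bij g h by (simp add: BijGroup_def)
  qed (use bij in \<open>simp add: BijGroup_def\<close>)
  then show ?thesis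
    by (simp add: group_action_def group_hom_def group_hom_axioms_def group_BijGroup is_group)
qed

text \<open>The library's faithfulness is injectivity of the action homomorphism.\<close>

lemma faithful_shift_action_iff:
  assumes "group G" and S: "S \<in> shifts G A"
  shows "faithful_action G S (shift_action G S) \<longleftrightarrow>
    (\<forall>g\<in>carrier G - {\<one>\<^bsub>G\<^esub>}. \<exists>s\<in>S. translate G g s \<noteq> s)"
proof -
  interpret group_action G S "shift_action G S"
    using assms by (rule group_action_shift_action)
  interpret group_hom G "BijGroup S" "shift_action G S" by (rule group_hom)
  have one: "\<one>\<^bsub>BijGroup S\<^esub> = (\<lambda>s\<in>S. s)" by (simp add: BijGroup_def)
  have eq: "shift_action G S g = \<one>\<^bsub>BijGroup S\<^esub> \<longleftrightarrow> (\<forall>s\<in>S. translate G g s = s)" for g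
    unfolding one shift_action_def by (auto simp: restrict_def fun_eq_iff)
  have "faithful_action G S (shift_action G S) \<longleftrightarrow> inj_on (shift_action G S) (carrier G)"
    using group_action_axioms by (simp add: faithful_action_def faithful_action_axioms_def)
  also have "\<dots> \<longleftrightarrow> (\<forall>g\<in>carrier G. shift_action G S g = \<one>\<^bsub>BijGroup S\<^esub> \<longrightarrow> g = \<one>\<^bsub>G\<^esub>)"
    by (simp add: inj_on_one_iff Ball_def)
  finally show ?thesis unfolding eq by blast
qed

end

theory Submission
  imports Defs
begin

text \<open>Call a shift jointly recurrent on a finite set \<open>W\<close> if there is a finite set of places such that,
  for all \<open>s\<close>, \<open>t\<close>, \<open>z\<close> in the shift, the pattern \<open>z\<close> on \<open>W\<close> appears in \<open>s\<close> and \<open>t\<close> at a common one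
  of these places. Joint recurrence on \<open>W\<close> is an open condition inherited by subshifts, and joint
  recurrence on all finite sets yields minimality and proximality. Density follows by intersecting
  a decreasing sequence of strongly irreducible shifts, once each strongly irreducible shift \<open>S\<close>
  is shown to contain a strongly irreducible jointly recurrent one with the same patterns on \<open>W\<close>.

  For the latter take a pattern \<open>p\<close> of \<open>S\<close> containing all patterns of \<open>S\<close> on \<open>W\<close>, and a finite set \<open>K\<close>
  such that \<open>p\<close> can be placed freely on any \<open>K\<close>-separated set. We want a finite \<open>K\<close>-separated set \<open>F\<close>
  and a subshift in which \<open>p\<close> is found somewhere on each translate of \<open>F\<close>, although it can also occur
  on all of a translate of \<open>F\<close>. Let \<open>B\<close> be a finite set of generic elements, put \<open>Q = B K B\<inverse>\<close>, and
  place \<open>p\<close> on \<open>M B\<close>, where \<open>M\<close> is a maximal \<open>Q\<close>-separated set. Each \<open>g\<close> has the form \<open>m q\<close> with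
  \<open>m \<in> M\<close>, \<open>q \<in> Q\<close>, so if \<open>F\<close> contains \<open>q\<inverse> b\<close> for many \<open>b \<in> B\<close>, then \<open>g F\<close> meets \<open>m B\<close> in many points.
  Genericity makes this \<open>F\<close> separated and ensures that placing \<open>p\<close> on all of \<open>F\<close> disturbs each \<open>m B\<close>
  in a few points only. The ICC condition provides generic elements, via B. H. Neumann's lemma.\<close>

section \<open>Generic elements of ICC groups\<close>

text \<open>The two demands on \<open>F\<close> pull against each other. Every configuration must
  show \<open>p\<close> somewhere on every translate of \<open>F\<close>, so \<open>F\<close> has to
  answer each displacement \<open>q\<close> in \<open>Q\<close> between a place \<open>g\<close> and
  the point \<open>m\<close> covering it. Yet some configuration shows \<open>p\<close> on all of
  \<open>F\<close>, and there the windows around \<open>F\<close> displace some of those demanded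
  around each \<open>m\<close>. Demanding \<open>p\<close> on all of \<open>m B\<close> would leave
  no room for this, and demanding it at a single place would not guarantee a hit; hence a fixed
  quota, 7 of 11 places. Nor can \<open>Q\<close> be settled before \<open>B\<close>: it must
  contain the products \<open>b k inv c\<close> to keep windows around different points of
  \<open>M\<close> apart. So every collision of \<open>F\<close> with itself or with
  \<open>m B\<close> is an equation between words of bounded length in \<open>B\<close> and
  \<open>K\<close>, and the quota works because the number of first letters solving it is bounded
  independently of \<open>K\<close>. For a new letter x, the basic obstruction is the conjugation
  equation x a x^-1 = b, which a central \<open>a\<close> = \<open>b\<close> satisfies for every x.
  ICC removes this obstruction, and the other equations are reduced to it.\<close>

context group
begin

lemma inv_mult_cancel: "x \<in> carrier G \<Longrightarrow> y \<in> carrier G \<Longrightarrow> inv x \<otimes> (x \<otimes> y) = y"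
  by (simp flip: m_assoc)

lemma mult_inv_cancel: "x \<in> carrier G \<Longrightarrow> y \<in> carrier G \<Longrightarrow> x \<otimes> (inv x \<otimes> y) = y"
  by (simp flip: m_assoc)

text \<open>A normal form for group words: products nested to the right, inverses pushed to the
  letters, adjacent inverse pairs cancelled. Most word identities below are checked by comparing
  normal forms.\<close>

lemmas word_simps = m_assoc inv_mult_group inv_mult_cancel mult_inv_cancel

text \<open>The solutions of \<open>x \<otimes> a \<otimes> inv x = b\<close> form a coset of the centralizer of \<open>a\<close>, so this is
  the case of centralizers in B. H. Neumann's lemma that a group is not a finite union of
  cosets of subgroups of infinite index. As there, some coset of the centralizer of a fixed \<open>a\<close>
  is not listed, hence covered by the cosets belonging to the other elements; translating this
  covering eliminates \<open>a\<close>.\<close>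

lemma avoid_conjugations:
  assumes icc: "ICC G" and "finite P" and "P \<subseteq> (carrier G - {\<one>}) \<times> carrier G"
  shows "\<exists>x\<in>carrier G. \<forall>(a, b)\<in>P. x \<otimes> a \<otimes> inv x \<noteq> b"
proof -
  \<comment> \<open>The induction runs over the set \<open>X\<close> of allowed left entries, for
    all \<open>P\<close> at once: eliminating one left entry multiplies the number of equations but
    introduces no new left entry.\<close>
  have "finite X \<Longrightarrow> X \<subseteq> carrier G - {\<one>} \<Longrightarrow> finite P \<Longrightarrow> P \<subseteq> X \<times> carrier G \<Longrightarrow>
    \<exists>x\<in>carrier G. \<forall>(a, b)\<in>P. x \<otimes> a \<otimes> inv x \<noteq> b" for X P
  proof (induction X arbitrary: P rule: finite_induct)
    case empty
    then show ?case by auto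
  next
    case (insert a X)
    have a: "a \<in> carrier G" "a \<noteq> \<one>" using insert.prems by auto
    have PC: "a' \<in> carrier G" "b \<in> carrier G" if "(a', b) \<in> P" for a' b
      using that insert.prems by auto
    define C where "C = {h \<otimes> a \<otimes> inv h |h. h \<in> carrier G}"
    have "infinite C"
      using icc a by (auto simp: ICC_def C_def)
    then have "infinite (C - snd ` P)" using insert.prems by simp
    then have "C - snd ` P \<noteq> {}" by (rule infinite_imp_nonempty)
    then obtain y0 where "y0 \<in> C" "y0 \<notin> snd ` P" by blast
    then obtain h where h: "h \<in> carrier G" "y0 = h \<otimes> a \<otimes> inv h" and y0: "(a, y0) \<notin> P"
      unfolding C_def by force
    \<comment> \<open>If \<open>y\<close> is a conjugate of \<open>a\<close>, then
      \<open>w y\<close> conjugates \<open>a\<close> to \<open>y\<close>; otherwise it is arbitrary,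
      whence the carrier condition in \<open>P'\<close>. So \<open>z y\<close> conjugates
      \<open>y\<close> to \<open>y0\<close>: if \<open>x\<close> solves \<open>(a, y)\<close>, then
      \<open>z y \<otimes> x\<close> carries \<open>a\<close> to the unlisted \<open>y0\<close> and
      must solve an equation from \<open>P1\<close>. \<open>P'\<close> contains that equation
      rewritten for \<open>x\<close>.\<close>
    define w where "w y = (SOME w. w \<in> carrier G \<and> y = w \<otimes> a \<otimes> inv w)" for y
    define z where "z y = h \<otimes> inv (w y)" for y
    define P1 where "P1 = {p \<in> P. fst p \<in> X}"
    define P' where "P' = P1 \<union> (\<lambda>(y, a', y'). (a', inv (z y) \<otimes> y' \<otimes> z y)) `
      {(y, a', y'). y \<in> snd ` P \<and> w y \<in> carrier G \<and> (a', y') \<in> P1}"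
    have fin: "finite P1" using insert.prems by (simp add: P1_def)
    have "finite {(y, a', y'). y \<in> snd ` P \<and> w y \<in> carrier G \<and> (a', y') \<in> P1}"
      by (rule finite_subset[of _ "snd ` P \<times> P1"]) (use insert.prems fin in auto)
    then have 1: "finite P'" using fin by (simp add: P'_def)
    have P1C: "a' \<in> X" "a' \<in> carrier G" "y' \<in> carrier G" if "(a', y') \<in> P1" for a' y'
      using that PC by (auto simp: P1_def)
    have 2: "P' \<subseteq> X \<times> carrier G"
      using P1C h unfolding P'_def z_def by auto
    obtain x where x: "x \<in> carrier G" "\<forall>(a, b)\<in>P'. x \<otimes> a \<otimes> inv x \<noteq> b"
      using insert.IH[OF _ 1 2] insert.prems by auto
    show ?case
    proof (rule ccontr)
      assume "\<not> ?thesis"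
      then have cov: "\<exists>(a, b)\<in>P. u \<otimes> a \<otimes> inv u = b" if "u \<in> carrier G" for u
        using that by blast
      obtain a1 b1 where ab: "(a1, b1) \<in> P" "x \<otimes> a1 \<otimes> inv x = b1" using cov[OF x(1)] by blast
      have "a1 = a"
      proof (rule ccontr)
        assume "a1 \<noteq> a"
        then have "(a1, b1) \<in> P'" using ab insert.prems by (auto simp: P'_def P1_def)
        then show False using x ab by auto
      qed
      have "\<exists>w. w \<in> carrier G \<and> b1 = w \<otimes> a \<otimes> inv w" using ab x \<open>a1 = a\<close> by auto
      then have w: "w b1 \<in> carrier G" "b1 = w b1 \<otimes> a \<otimes> inv (w b1)"
        unfolding w_def by (metis (mono_tags, lifting) someI_ex)+
      have zc: "z b1 \<in> carrier G" using w h by (simp add: z_def)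
      obtain a2 b2 where ab2: "(a2, b2) \<in> P"
        "(z b1 \<otimes> x) \<otimes> a2 \<otimes> inv (z b1 \<otimes> x) = b2" using cov[of "z b1 \<otimes> x"] x zc by blast
      have "a2 \<noteq> a"
      proof
        assume "a2 = a"
        then have "b2 = z b1 \<otimes> b1 \<otimes> inv (z b1)"
          using ab2 ab \<open>a1 = a\<close> x zc a by (auto simp: word_simps)
        also have "\<dots> = y0"
          using w(1) h a by (subst w(2)) (simp add: z_def word_simps)
        finally show False using y0 ab2 \<open>a2 = a\<close> by simp
      qed
      then have "(a2, b2) \<in> P1" using ab2 insert.prems by (auto simp: P1_def)
      moreover have "b1 \<in> snd ` P" using ab by force
      ultimately have "(a2, inv (z b1) \<otimes> b2 \<otimes> z b1) \<in> P'"
        using w(1) unfolding P'_def by force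
      moreover have "x \<otimes> a2 \<otimes> inv x = inv (z b1) \<otimes> b2 \<otimes> z b1"
        using ab2 zc x PC(1)[OF ab2(1)] by (auto simp: word_simps)
      ultimately show False using x by auto
    qed
  qed
  from this[of "fst ` P" P] show ?thesis using assms
    by (force simp: subset_iff image_iff)
qed

section \<open>Word equations in one unknown, and elements avoiding them\<close>

lemma ICC_infinite:
  assumes "ICC G" and "carrier G \<noteq> {\<one>}"
  shows "infinite (carrier G)"
proof
  assume fin: "finite (carrier G)"
  obtain g where g: "g \<in> carrier G - {\<one>}" using assms(2) one_closed by blast
  have "{h \<otimes> g \<otimes> inv h |h. h \<in> carrier G} \<subseteq> carrier G" using g by auto
  then have "finite {h \<otimes> g \<otimes> inv h |h. h \<in> carrier G}" by (rule finite_subset) (rule fin)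
  then show False using assms(1) g by (simp add: ICC_def)
qed

text \<open>The first equation gives \<open>u = inv x \<otimes> v \<otimes> inv x\<close>.
  Substituted into the second, it leaves
  \<open>t \<otimes> v \<otimes> inv x \<otimes> t \<otimes> x = v\<close>, in which
  \<open>x\<close> occurs only as a conjugator of \<open>t\<close>.\<close>

lemma square_variants:
  assumes C: "x \<in> carrier G" "t \<in> carrier G" "u \<in> carrier G" "v \<in> carrier G"
    and 1: "x \<otimes> u \<otimes> x = v" and 2: "(t \<otimes> x) \<otimes> u \<otimes> (t \<otimes> x) = v"
  shows "x \<otimes> (inv v \<otimes> inv t \<otimes> v) \<otimes> inv x = t"
proof -
  have u: "u = inv x \<otimes> v \<otimes> inv x" using C by (auto simp: word_simps simp flip: 1)
  have v: "v = t \<otimes> (v \<otimes> (inv x \<otimes> (t \<otimes> x)))"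
    using 2 C unfolding u by (simp add: word_simps)
  have "inv v \<otimes> inv t \<otimes> v = inv v \<otimes> inv t \<otimes> (t \<otimes> (v \<otimes> (inv x \<otimes> (t \<otimes> x))))"
    using v by simp
  then show ?thesis using C by (simp add: word_simps)
qed

text \<open>Conjugating the first equation by \<open>t\<close> makes its left side equal to that of
  the second. Comparing right sides eliminates \<open>k\<close>, and \<open>x\<close> survives only
  as a conjugator.\<close>

lemma triple_variants:
  assumes C: "x \<in> carrier G" "t \<in> carrier G" "k \<in> carrier G" "g \<in> carrier G" "e \<in> carrier G"
    and 1: "x \<otimes> k \<otimes> inv x = g \<otimes> x \<otimes> e"
    and 2: "(t \<otimes> x) \<otimes> k \<otimes> inv (t \<otimes> x) = g \<otimes> (t \<otimes> x) \<otimes> e"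
  shows "x \<otimes> (e \<otimes> inv t \<otimes> inv e) \<otimes> inv x = inv g \<otimes> inv t \<otimes> g \<otimes> t"
proof -
  have "g \<otimes> t \<otimes> x \<otimes> e = t \<otimes> (x \<otimes> k \<otimes> inv x) \<otimes> inv t"
    using 2 C by (simp add: word_simps)
  also have "\<dots> = t \<otimes> (g \<otimes> x \<otimes> e) \<otimes> inv t" unfolding 1 ..
  finally have *: "g \<otimes> (t \<otimes> (x \<otimes> e)) = t \<otimes> (g \<otimes> (x \<otimes> (e \<otimes> inv t)))" using C by (simp add: word_simps)
  have "inv g \<otimes> inv t \<otimes> (t \<otimes> (g \<otimes> (x \<otimes> (e \<otimes> inv t)))) \<otimes> inv e \<otimes> inv x
    = inv g \<otimes> inv t \<otimes> (g \<otimes> (t \<otimes> (x \<otimes> e))) \<otimes> inv e \<otimes> inv x"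
    unfolding * ..
  then show ?thesis using C by (simp add: word_simps)
qed

text \<open>The equations given by \<open>Q\<close> and \<open>R\<close> are not conjugation equations, but if \<open>x\<close> and
  \<open>t \<otimes> x\<close> with \<open>t \<noteq> \<one>\<close> solve the same one of them, then \<open>x\<close> solves a conjugation
  equation. Among enough translates of an \<open>x\<close> avoiding these conjugation equations
  there is a good one by the pigeonhole principle.\<close>

lemma avoid_equations:
  assumes icc: "ICC G" and nt: "carrier G \<noteq> {\<one>}"
    and P: "finite P" "P \<subseteq> (carrier G - {\<one>}) \<times> carrier G"
    and Q: "finite Q" "Q \<subseteq> carrier G \<times> carrier G"
    and R: "finite R" "R \<subseteq> carrier G \<times> carrier G \<times> carrier G"
  shows "\<exists>x\<in>carrier G. (\<forall>(a, b)\<in>P. x \<otimes> a \<otimes> inv x \<noteq> b) \<and>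
    (\<forall>(u, v)\<in>Q. x \<otimes> u \<otimes> x \<noteq> v) \<and> (\<forall>(k, g, e)\<in>R. x \<otimes> k \<otimes> inv x \<noteq> g \<otimes> x \<otimes> e)"
proof -
  define I where "I = Inl ` Q \<union> Inr ` R"
  define sat where "sat i x = (case i of Inl (u, v) \<Rightarrow> x \<otimes> u \<otimes> x = v
      | Inr (k, g, e) \<Rightarrow> x \<otimes> k \<otimes> inv x = g \<otimes> x \<otimes> e)" for i x
  have "finite I" using Q R by (simp add: I_def)
  \<comment> \<open>One more translate than equations: if every translate solved one of them, two
    translates would solve the same one.\<close>
  obtain H where H: "H \<subseteq> carrier G" "finite H" "card H = Suc (card I)"
    using infinite_arbitrarily_large[OF ICC_infinite[OF icc nt]] by blast
  \<comment> \<open>The quotient \<open>t = h' \<otimes> inv h\<close> satisfies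
    \<open>t \<otimes> (h \<otimes> x) = h' \<otimes> x\<close>, so two translates solving the same
    equation are in the situation of \<open>square_variants\<close> or
    \<open>triple_variants\<close>, with \<open>h \<otimes> x\<close> for \<open>x\<close>. The
    conjugations by \<open>inv h\<close> in \<open>C\<close> turn the resulting equations for
    \<open>h \<otimes> x\<close> into equations for \<open>x\<close>.\<close>
  define T where "T = {(h, t). h \<in> H \<and> t \<in> (\<lambda>(h, h'). h' \<otimes> inv h) ` (H \<times> H) - {\<one>}}"
  have T: "finite T" "T \<subseteq> H \<times> (carrier G - {\<one>})"
  proof -
    have "T \<subseteq> H \<times> (\<lambda>(h, h'). h' \<otimes> inv h) ` (H \<times> H)" by (auto simp: T_def)
    then show "finite T" by (rule finite_subset) (use H in auto)
    show "T \<subseteq> H \<times> (carrier G - {\<one>})" using H by (auto simp: T_def)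
  qed
  define C where "C = (\<lambda>(h, a, b). (a, inv h \<otimes> b \<otimes> h)) ` (H \<times> P) \<union>
    (\<lambda>((h, t), (u, v)). (inv v \<otimes> inv t \<otimes> v, inv h \<otimes> t \<otimes> h)) ` (T \<times> Q) \<union>
    (\<lambda>((h, t), (k, g, e)). (e \<otimes> inv t \<otimes> inv e, inv h \<otimes> (inv g \<otimes> inv t \<otimes> g \<otimes> t) \<otimes> h)) ` (T \<times> R)"
  have fin: "finite C" using H P Q R T by (simp add: C_def)
  have conj1: "y \<otimes> inv t \<otimes> inv y = \<one> \<longleftrightarrow> t = \<one>" if C: "t \<in> carrier G" "y \<in> carrier G" for y t
  proof
    assume "y \<otimes> inv t \<otimes> inv y = \<one>"
    moreover have "inv (inv y \<otimes> (y \<otimes> inv t \<otimes> inv y) \<otimes> y) = t" using C by (simp add: word_simps)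
    ultimately show "t = \<one>" using C by simp
  qed (use C in simp)
  have conj2: "inv y \<otimes> inv t \<otimes> y = \<one> \<longleftrightarrow> t = \<one>" if "t \<in> carrier G" "y \<in> carrier G" for y t
    using conj1[of t "inv y"] that by simp
  have sub: "C \<subseteq> (carrier G - {\<one>}) \<times> carrier G"
    using H(1) P(2) Q(2) R(2) T(2) by (force simp: C_def subset_iff conj1 conj2)
  obtain x where x: "x \<in> carrier G" "\<And>a b. (a, b) \<in> C \<Longrightarrow> x \<otimes> a \<otimes> inv x \<noteq> b"
    using avoid_conjugations[OF icc fin sub] by blast
  have tr: "x \<otimes> a \<otimes> inv x = inv h \<otimes> b \<otimes> h" if "(h \<otimes> x) \<otimes> a \<otimes> inv (h \<otimes> x) = b"
    "h \<in> H" "a \<in> carrier G" for h a b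
    using that H(1) x(1) by (auto simp: word_simps subset_iff)
  have "\<exists>h\<in>H. \<forall>i\<in>I. \<not> sat i (h \<otimes> x)"
  proof (rule ccontr)
    assume "\<not> ?thesis"
    then obtain f where f: "\<And>h. h \<in> H \<Longrightarrow> f h \<in> I \<and> sat (f h) (h \<otimes> x)" by metis
    have "\<not> inj_on f H"
      using card_inj_on_le[of f H I] f H \<open>finite I\<close> by auto
    then obtain h h' where h: "h \<in> H" "h' \<in> H" "h \<noteq> h'" "f h = f h'"
      by (auto simp: inj_on_def)
    define t where "t = h' \<otimes> inv h"
    have hC: "h \<in> carrier G" "h' \<in> carrier G" using h H by auto
    have tC: "t \<in> carrier G" and t: "t \<otimes> (h \<otimes> x) = h' \<otimes> x"
      using hC x(1) by (auto simp: t_def word_simps)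
    have "t \<noteq> \<one>" using h hC unfolding t_def by (metis inv_equality inv_inv inv_closed)
    then have ht: "(h, t) \<in> T" using h by (auto simp: T_def t_def)
    have hx: "h \<otimes> x \<in> carrier G" using hC x by auto
    show False
    proof (cases "f h")
      case (Inl p)
      then obtain u v where uv: "f h = Inl (u, v)" "(u, v) \<in> Q" using f[OF h(1)] by (cases p) (auto simp: I_def)
      have uvC: "u \<in> carrier G" "v \<in> carrier G" using uv Q by auto
      have "(h \<otimes> x) \<otimes> u \<otimes> (h \<otimes> x) = v" "(t \<otimes> (h \<otimes> x)) \<otimes> u \<otimes> (t \<otimes> (h \<otimes> x)) = v"
        using f[OF h(1)] f[OF h(2)] uv(1) uv(1)[unfolded h(4)] by (simp_all add: sat_def t)
      from square_variants[OF hx tC uvC this]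
      have "x \<otimes> (inv v \<otimes> inv t \<otimes> v) \<otimes> inv x = inv h \<otimes> t \<otimes> h"
        by (rule tr) (use h uvC tC in auto)
      moreover have "(inv v \<otimes> inv t \<otimes> v, inv h \<otimes> t \<otimes> h) \<in> C"
        using ht uv unfolding C_def by force
      ultimately show False using x(2) by blast
    next
      case (Inr p)
      then obtain k g e where uv: "f h = Inr (k, g, e)" "(k, g, e) \<in> R" using f[OF h(1)] by (cases p) (auto simp: I_def)
      have uvC: "k \<in> carrier G" "g \<in> carrier G" "e \<in> carrier G" using uv R by auto
      have "(h \<otimes> x) \<otimes> k \<otimes> inv (h \<otimes> x) = g \<otimes> (h \<otimes> x) \<otimes> e"
        "(t \<otimes> (h \<otimes> x)) \<otimes> k \<otimes> inv (t \<otimes> (h \<otimes> x)) = g \<otimes> (t \<otimes> (h \<otimes> x)) \<otimes> e"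
        using f[OF h(1)] f[OF h(2)] uv(1) uv(1)[unfolded h(4)] by (simp_all add: sat_def t)
      from triple_variants[OF hx tC uvC this]
      have "x \<otimes> (e \<otimes> inv t \<otimes> inv e) \<otimes> inv x = inv h \<otimes> (inv g \<otimes> inv t \<otimes> g \<otimes> t) \<otimes> h"
        by (rule tr) (use h uvC tC in auto)
      moreover have "(e \<otimes> inv t \<otimes> inv e, inv h \<otimes> (inv g \<otimes> inv t \<otimes> g \<otimes> t) \<otimes> h) \<in> C"
        using ht uv unfolding C_def by force
      ultimately show False using x(2) by blast
    qed
  qed
  then obtain h where h: "h \<in> H" "\<And>i. i \<in> I \<Longrightarrow> \<not> sat i (h \<otimes> x)" by blast
  have "h \<otimes> x \<in> carrier G" using h H x by auto
  moreover have "(h \<otimes> x) \<otimes> a \<otimes> inv (h \<otimes> x) \<noteq> b" if "(a, b) \<in> P" for a b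
  proof
    assume *: "(h \<otimes> x) \<otimes> a \<otimes> inv (h \<otimes> x) = b"
    have "(a, inv h \<otimes> b \<otimes> h) \<in> C" using that h unfolding C_def by force
    moreover have "a \<in> carrier G" using that P by auto
    ultimately show False using tr[OF * h(1)] x(2) by blast
  qed
  moreover have "(h \<otimes> x) \<otimes> u \<otimes> (h \<otimes> x) \<noteq> v" if "(u, v) \<in> Q" for u v
    using h(2)[of "Inl (u, v)"] that by (auto simp: I_def sat_def)
  moreover have "(h \<otimes> x) \<otimes> k \<otimes> inv (h \<otimes> x) \<noteq> g \<otimes> (h \<otimes> x) \<otimes> e" if "(k, g, e) \<in> R" for k g e
    using h(2)[of "Inr (k, g, e)"] that by (auto simp: I_def sat_def)
  ultimately show ?thesis by (intro bexI[of _ "h \<otimes> x"]) auto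
qed

text \<open>Dividing by coefficients turns each forbidden coincidence into one of the equations of
  \<open>avoid_equations\<close>, with quotients of elements of \<open>U\<close> as coefficients.
  Where both sides contain the letter with the same exponent once, a coincidence is tolerated only
  if the coefficients on one side of it agree.\<close>

lemma generic_element:
  assumes icc: "ICC G" and nt: "carrier G \<noteq> {\<one>}" and fin: "finite U" and sub: "U \<subseteq> carrier G"
  obtains X where "X \<in> carrier G"
    and "\<And>a b. a \<in> U \<Longrightarrow> b \<in> U \<Longrightarrow> a \<otimes> X \<noteq> b"
    and "\<And>a b. a \<in> U \<Longrightarrow> b \<in> U \<Longrightarrow> a \<otimes> inv X \<noteq> b"
    and "\<And>a b a' b'. a \<in> U \<Longrightarrow> b \<in> U \<Longrightarrow> a' \<in> U \<Longrightarrow> b' \<in> U \<Longrightarrow>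
      a \<otimes> X \<otimes> b = a' \<otimes> X \<otimes> b' \<Longrightarrow> b = b'"
    and "\<And>a b a' b'. a \<in> U \<Longrightarrow> b \<in> U \<Longrightarrow> a' \<in> U \<Longrightarrow> b' \<in> U \<Longrightarrow>
      a \<otimes> inv X \<otimes> b = a' \<otimes> inv X \<otimes> b' \<Longrightarrow> a = a'"
    and "\<And>a b a' b'. a \<in> U \<Longrightarrow> b \<in> U \<Longrightarrow> a' \<in> U \<Longrightarrow> b' \<in> U \<Longrightarrow>
      a \<otimes> X \<otimes> b \<noteq> a' \<otimes> inv X \<otimes> b'"
    and "\<And>a k a' b. a \<in> U \<Longrightarrow> k \<in> U \<Longrightarrow> a' \<in> U \<Longrightarrow> b \<in> U \<Longrightarrow>
      a \<otimes> X \<otimes> k \<otimes> inv X \<noteq> a' \<otimes> X \<otimes> b"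
    and "\<And>a k a' b. a \<in> U \<Longrightarrow> k \<in> U \<Longrightarrow> a' \<in> U \<Longrightarrow> b \<in> U \<Longrightarrow>
      a \<otimes> X \<otimes> k \<otimes> inv X \<noteq> a' \<otimes> inv X \<otimes> b"
proof -
  obtain a0 where a0: "a0 \<in> carrier G" "a0 \<noteq> \<one>" using nt one_closed by blast
  define E where "E = (\<lambda>(a, b). inv a \<otimes> b) ` (U \<times> U) \<union> (\<lambda>(a, b). a \<otimes> inv b) ` (U \<times> U)"
  have E: "finite E" "E \<subseteq> carrier G" using fin sub by (auto simp: E_def)
  have UC: "a \<in> carrier G" if "a \<in> U" for a using that sub by auto
  have El: "inv a \<otimes> b \<in> E" and Er: "a \<otimes> inv b \<in> E" if "a \<in> U" "b \<in> U" for a b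
    using that by (auto simp: E_def)
  \<comment> \<open>The second set excludes \<open>X = c\<close> for \<open>c\<close> in
    \<open>E\<close>, since such an \<open>X\<close> would conjugate \<open>a0\<close> to
    \<open>c \<otimes> a0 \<otimes> inv c\<close>; a plain inequality is thus obtained from a
    conjugation equation. In \<open>R\<close>, the second set serves the last coincidence, which has
    the required shape only after taking inverses.\<close>
  define P where "P = {p \<in> E \<times> E. fst p \<noteq> \<one>} \<union> (\<lambda>c. (a0, c \<otimes> a0 \<otimes> inv c)) ` E"
  define R where "R = U \<times> E \<times> U \<union> (\<lambda>(k, g, b). (inv k, inv b, inv g)) ` (U \<times> E \<times> U)"
  have "finite P" using E by (simp add: P_def)
  moreover have "P \<subseteq> (carrier G - {\<one>}) \<times> carrier G" using E a0 by (auto simp: P_def)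
  moreover have "finite R" using E fin by (simp add: R_def)
  moreover have "R \<subseteq> carrier G \<times> carrier G \<times> carrier G" using E sub by (auto simp: R_def)
  moreover have "finite (E \<times> E)" "E \<times> E \<subseteq> carrier G \<times> carrier G" using E by auto
  ultimately have ex: "\<exists>X\<in>carrier G. (\<forall>(a, b)\<in>P. X \<otimes> a \<otimes> inv X \<noteq> b) \<and>
    (\<forall>(u, v)\<in>E \<times> E. X \<otimes> u \<otimes> X \<noteq> v) \<and> (\<forall>(k, g, e)\<in>R. X \<otimes> k \<otimes> inv X \<noteq> g \<otimes> X \<otimes> e)"
    by (intro avoid_equations icc nt)
  obtain X where X: "X \<in> carrier G" "\<And>a b. (a, b) \<in> P \<Longrightarrow> X \<otimes> a \<otimes> inv X \<noteq> b"
    "\<And>u v. u \<in> E \<Longrightarrow> v \<in> E \<Longrightarrow> X \<otimes> u \<otimes> X \<noteq> v"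
    "\<And>k g e. (k, g, e) \<in> R \<Longrightarrow> X \<otimes> k \<otimes> inv X \<noteq> g \<otimes> X \<otimes> e"
    using ex by fast
  have XE: "X \<notin> E"
  proof
    assume "X \<in> E"
    then have "(a0, X \<otimes> a0 \<otimes> inv X) \<in> P" by (auto simp: P_def)
    then show False using X(2) by auto
  qed
  have conjE: "a = \<one>" if "X \<otimes> a \<otimes> inv X = b" "a \<in> E" "b \<in> E" for a b
  proof (rule ccontr)
    assume "a \<noteq> \<one>"
    then have "(a, b) \<in> P" using that by (simp add: P_def)
    then show False using X(2) that by auto
  qed
  show thesis
  proof (rule that[OF X(1)], goal_cases)
    case (1 a b)
    have "X = inv a \<otimes> (a \<otimes> X)" using 1 UC X(1) by (simp add: word_simps)
    then show ?case using XE El[OF 1] by auto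
  next
    case (2 a b)
    have "X = inv (a \<otimes> inv X) \<otimes> a" using 2 UC X(1) by (simp add: word_simps)
    then show ?case using XE El[OF 2(2,1)] by auto
  next
    case (3 a b a' b')
    have "X \<otimes> (b \<otimes> inv b') \<otimes> inv X = inv a \<otimes> (a \<otimes> X \<otimes> b) \<otimes> inv b' \<otimes> inv X"
      using 3(1-4) UC X(1) by (simp add: word_simps)
    also have "\<dots> = inv a \<otimes> a'" unfolding 3(5) using 3(1-4) UC X(1) by (simp add: word_simps)
    finally have "b \<otimes> inv b' = \<one>" by (rule conjE) (use 3(1-4) El Er in auto)
    moreover have "b = (b \<otimes> inv b') \<otimes> b'" using 3(1-4) UC by (simp add: word_simps)
    ultimately show ?case using 3(1-4) UC by simp
  next
    case (4 a b a' b')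
    have "X \<otimes> (inv a' \<otimes> a) \<otimes> inv X = X \<otimes> inv a' \<otimes> (a \<otimes> inv X \<otimes> b) \<otimes> inv b"
      using 4(1-4) UC X(1) by (simp add: word_simps)
    also have "\<dots> = b' \<otimes> inv b" unfolding 4(5) using 4(1-4) UC X(1) by (simp add: word_simps)
    finally have "inv a' \<otimes> a = \<one>" by (rule conjE) (use 4(1-4) El Er in auto)
    moreover have "a = a' \<otimes> (inv a' \<otimes> a)" using 4(1-4) UC by (simp add: word_simps)
    ultimately show ?case using 4(1-4) UC by simp
  next
    case (5 a b a' b')
    show ?case
    proof
      assume *: "a \<otimes> X \<otimes> b = a' \<otimes> inv X \<otimes> b'"
      have "X \<otimes> (b \<otimes> inv b') \<otimes> X = inv a \<otimes> (a \<otimes> X \<otimes> b) \<otimes> inv b' \<otimes> X"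
        using 5 UC X(1) by (simp add: word_simps)
      also have "\<dots> = inv a \<otimes> a'" unfolding * using 5 UC X(1) by (simp add: word_simps)
      finally show False using X(3)[OF Er[OF 5(2,4)] El[OF 5(1,3)]] by simp
    qed
  next
    case (6 a k a' b)
    show ?case
    proof
      assume *: "a \<otimes> X \<otimes> k \<otimes> inv X = a' \<otimes> X \<otimes> b"
      have "X \<otimes> k \<otimes> inv X = inv a \<otimes> (a \<otimes> X \<otimes> k \<otimes> inv X)"
        using 6 UC X(1) by (simp add: word_simps)
      also have "\<dots> = (inv a \<otimes> a') \<otimes> X \<otimes> b" unfolding * using 6 UC X(1) by (simp add: word_simps)
      finally have "X \<otimes> k \<otimes> inv X = (inv a \<otimes> a') \<otimes> X \<otimes> b" .
      moreover have "(k, inv a \<otimes> a', b) \<in> R" using 6 El by (simp add: R_def)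
      ultimately show False using X(4) by simp
    qed
  next
    case (7 a k a' b)
    show ?case
    proof
      assume *: "a \<otimes> X \<otimes> k \<otimes> inv X = a' \<otimes> inv X \<otimes> b"
      have "X \<otimes> inv k \<otimes> inv X = inv (a \<otimes> X \<otimes> k \<otimes> inv X) \<otimes> a"
        using 7 UC X(1) by (simp add: word_simps)
      also have "\<dots> = inv b \<otimes> X \<otimes> inv (inv a \<otimes> a')" unfolding * using 7 UC X(1) by (simp add: word_simps)
      finally have "X \<otimes> inv k \<otimes> inv X = inv b \<otimes> X \<otimes> inv (inv a \<otimes> a')" .
      moreover have "(inv k, inv b, inv (inv a \<otimes> a')) \<in> R"
        using 7 El unfolding R_def by (intro UnI2 image_eqI[of _ _ "(k, inv a \<otimes> a', b)"]) auto
      ultimately show False using X(4) by simp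
    qed
  qed
qed

text \<open>These shapes arise when a new letter is inserted into words \<open>b \<otimes> l
  \<otimes> inv d \<otimes> e \<otimes> k \<otimes> inv c\<close> and their initial segments, or
  when two such words are compared. Outer coefficients are divided out to reach
  \<open>generic_element\<close>, so its set \<open>U\<close> consists of quotients.\<close>

lemma generic_for_words:
  assumes icc: "ICC G" and nt: "carrier G \<noteq> {\<one>}" and fin: "finite V" and sub: "V \<subseteq> carrier G"
    and one: "\<one> \<in> V"
  obtains X where "X \<in> carrier G"
    and "\<And>a b c. \<lbrakk>a \<in> V; b \<in> V; c \<in> V\<rbrakk> \<Longrightarrow> a \<otimes> X \<otimes> b \<noteq> c"
    and "\<And>a b c. \<lbrakk>a \<in> V; b \<in> V; c \<in> V\<rbrakk> \<Longrightarrow> a \<otimes> inv X \<otimes> b \<noteq> c"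
    and "\<And>a b c d. \<lbrakk>a \<in> V; b \<in> V; c \<in> V; d \<in> V; a \<otimes> X \<otimes> b \<otimes> inv X \<otimes> c = d\<rbrakk> \<Longrightarrow> b = \<one>"
    and "\<And>a b c d. \<lbrakk>a \<in> V; b \<in> V; c \<in> V; d \<in> V\<rbrakk> \<Longrightarrow> a \<otimes> X \<otimes> b \<otimes> X \<otimes> c \<noteq> d"
    and "\<And>a b c d. \<lbrakk>a \<in> V; b \<in> V; c \<in> V; d \<in> V\<rbrakk> \<Longrightarrow> a \<otimes> X \<otimes> b \<otimes> X \<otimes> c \<otimes> inv X \<noteq> d"
    and "\<And>a b a' b'. \<lbrakk>a \<in> V; b \<in> V; a' \<in> V; b' \<in> V; a \<otimes> X \<otimes> b = a' \<otimes> X \<otimes> b'\<rbrakk> \<Longrightarrow> b = b'"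
    and "\<And>a b a' b'. \<lbrakk>a \<in> V; b \<in> V; a' \<in> V; b' \<in> V; a \<otimes> inv X \<otimes> b = a' \<otimes> inv X \<otimes> b'\<rbrakk> \<Longrightarrow> a = a'"
    and "\<And>a b a' b'. \<lbrakk>a \<in> V; b \<in> V; a' \<in> V; b' \<in> V\<rbrakk> \<Longrightarrow> a \<otimes> X \<otimes> b \<noteq> a' \<otimes> inv X \<otimes> b'"
    and "\<And>a k a' b. \<lbrakk>a \<in> V; k \<in> V; a' \<in> V; b \<in> V\<rbrakk> \<Longrightarrow> a \<otimes> X \<otimes> k \<otimes> inv X \<noteq> a' \<otimes> X \<otimes> b"
    and "\<And>a k a' b. \<lbrakk>a \<in> V; k \<in> V; a' \<in> V; b \<in> V\<rbrakk> \<Longrightarrow> a \<otimes> X \<otimes> k \<otimes> inv X \<noteq> a' \<otimes> inv X \<otimes> b"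
proof -
  define U where "U = (\<lambda>(a, b). a \<otimes> inv b) ` (V \<times> V) \<union> (\<lambda>(a, b). inv a \<otimes> b) ` (V \<times> V)"
  have U: "finite U" "U \<subseteq> carrier G" using fin sub by (auto simp: U_def)
  have VC: "a \<in> carrier G" if "a \<in> V" for a using that sub by auto
  have Ur: "a \<otimes> inv b \<in> U" and Ul: "inv a \<otimes> b \<in> U" if "a \<in> V" "b \<in> V" for a b
    using that by (auto simp: U_def)
  have VU: "a \<in> U" if "a \<in> V" for a using Ur[OF that one] VC[OF that] by simp
  have VUi: "inv a \<in> U" if "a \<in> V" for a using Ul[OF that one] VC[OF that] by simp
  have oneU: "\<one> \<in> U" using VU[OF one] .
  show thesis
  proof (rule generic_element[OF icc nt U], goal_cases)
    case (1 X)
    note X = 1(1) and G1 = 1(2) and G1' = 1(3) and G2 = 1(4) and G2' = 1(5) and G3 = 1(6)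
      and G4 = 1(7) and G4' = 1(8)
  show thesis
  proof (rule that[OF X], goal_cases)
    case (1 a b c)
    have "a \<otimes> X = (a \<otimes> X \<otimes> b) \<otimes> inv b" using 1 VC X by (simp add: word_simps)
    then show ?case using G1[OF VU[OF 1(1)] Ur[OF 1(3,2)]] by auto
  next
    case (2 a b c)
    have "a \<otimes> inv X = (a \<otimes> inv X \<otimes> b) \<otimes> inv b" using 2 VC X by (simp add: word_simps)
    then show ?case using G1'[OF VU[OF 2(1)] Ur[OF 2(3,2)]] by auto
  next
    case (3 a b c d)
    have "a \<otimes> X \<otimes> b = (a \<otimes> X \<otimes> b \<otimes> inv X \<otimes> c) \<otimes> inv c \<otimes> X" using 3(1-4) VC X by (simp add: word_simps)
    then have "a \<otimes> X \<otimes> b = (d \<otimes> inv c) \<otimes> X \<otimes> \<one>" unfolding 3(5) using 3(1-4) VC X by simp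
    then show ?case by (rule G2[rotated 4]) (use 3(1-4) VU Ur oneU in auto)
  next
    case (4 a b c d)
    have "a \<otimes> X \<otimes> b = (a \<otimes> X \<otimes> b \<otimes> X \<otimes> c) \<otimes> inv c \<otimes> inv X" using 4 VC X by (simp add: word_simps)
    moreover have "a \<otimes> X \<otimes> b \<noteq> (d \<otimes> inv c) \<otimes> inv X \<otimes> \<one>"
      by (rule G3) (use 4 VU Ur oneU in auto)
    ultimately show ?case using 4 VC X by auto
  next
    case (5 a b c d)
    have "\<one> \<otimes> X \<otimes> c \<otimes> inv X = inv b \<otimes> inv X \<otimes> (inv a \<otimes> (a \<otimes> X \<otimes> b \<otimes> X \<otimes> c \<otimes> inv X))"
      using 5 VC X by (simp add: word_simps)
    moreover have "\<one> \<otimes> X \<otimes> c \<otimes> inv X \<noteq> inv b \<otimes> inv X \<otimes> (inv a \<otimes> d)"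
      by (rule G4') (use 5 VU Ul VUi oneU in auto)
    ultimately show ?case by auto
  next
    case (6 a b a' b')
    show ?case by (rule G2[OF _ _ _ _ 6(5)]) (use 6(1-4) VU in auto)
  next
    case (7 a b a' b')
    show ?case by (rule G2'[OF _ _ _ _ 7(5)]) (use 7(1-4) VU in auto)
  next
    case (8 a b a' b')
    show ?case by (rule G3) (use 8 VU in auto)
  next
    case (9 a k a' b)
    show ?case by (rule G4) (use 9 VU in auto)
  next
    case (10 a k a' b)
    show ?case by (rule G4') (use 10 VU in auto)
  qed
  qed
qed

text \<open>\<open>words1\<close>, \<open>words2\<close> and \<open>words3\<close> collect the first letters of the representations of \<open>v\<close>
  as a word of the given shape; \<open>words2\<close> occurs when the last letter of a \<open>words3\<close> word is
  cancelled.\<close>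

definition words1 :: "'a set \<Rightarrow> 'a set \<Rightarrow> 'a \<Rightarrow> 'a set"
  where "words1 K B v = {b \<in> B. \<exists>l\<in>K - {\<one>}. \<exists>d\<in>B. b \<otimes> l \<otimes> inv d = v}"

definition words2 :: "'a set \<Rightarrow> 'a set \<Rightarrow> 'a \<Rightarrow> 'a set"
  where "words2 K B v = {b \<in> B. \<exists>l\<in>K - {\<one>}. \<exists>d\<in>B. \<exists>e\<in>B. \<exists>k\<in>K. d \<noteq> e \<and>
    b \<otimes> l \<otimes> inv d \<otimes> e \<otimes> k = v}"

definition words3 :: "'a set \<Rightarrow> 'a set \<Rightarrow> 'a \<Rightarrow> 'a set"
  where "words3 K B v = {b \<in> B. \<exists>l\<in>K - {\<one>}. \<exists>d\<in>B. \<exists>e\<in>B. \<exists>k\<in>K. \<exists>c\<in>B.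
    d \<noteq> e \<and> d \<noteq> c \<and> (e \<noteq> c \<or> k \<noteq> \<one>) \<and> b \<otimes> l \<otimes> inv d \<otimes> e \<otimes> k \<otimes> inv c = v}"

lemma words3I:
  "\<lbrakk>b \<in> B; l \<in> K - {\<one>}; d \<in> B; e \<in> B; k \<in> K; c \<in> B; d \<noteq> e; d \<noteq> c; e \<noteq> c \<or> k \<noteq> \<one>;
    b \<otimes> l \<otimes> inv d \<otimes> e \<otimes> k \<otimes> inv c = v\<rbrakk> \<Longrightarrow> b \<in> words3 K B v"
  unfolding words3_def mem_Collect_eq by (intro conjI bexI) assumption+

lemma words3E:
  assumes "b \<in> words3 K B v"
  obtains l d e k c where "b \<in> B" "l \<in> K - {\<one>}" "d \<in> B" "e \<in> B" "k \<in> K" "c \<in> B" "d \<noteq> e" "d \<noteq> c"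
    "e \<noteq> c \<or> k \<noteq> \<one>" "b \<otimes> l \<otimes> inv d \<otimes> e \<otimes> k \<otimes> inv c = v"
  using assms unfolding words3_def mem_Collect_eq by (elim conjE bexE) (rule that)

text \<open>The first clause says that the sets \<open>b K\<close> are disjoint. The bounds 2 and 3
  are those that survive adding a generic letter \<open>X\<close>. An element whose words involve
  \<open>X\<close> has at most one first letter besides \<open>X\<close>, except for
  \<open>words3\<close> words ending in \<open>inv X\<close>: there up to two come from
  \<open>words2\<close>. This gives \<open>1 + 1\<close> and \<open>1 + 2\<close>.\<close>

definition spread :: "'a set \<Rightarrow> 'a set \<Rightarrow> bool"
  where "spread K B \<longleftrightarrow> B \<subseteq> carrier G \<and>
    (\<forall>b\<in>B. \<forall>b'\<in>B. \<forall>k\<in>K. \<forall>k'\<in>K. b \<otimes> k = b' \<otimes> k' \<longrightarrow> b = b') \<and>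
    (\<forall>v. \<forall>b\<in>words1 K B v. \<forall>b'\<in>words1 K B v. b = b') \<and>
    (\<forall>v. card (words2 K B v) \<le> 2) \<and> (\<forall>v. card (words3 K B v) \<le> 3)"

text \<open>A word containing the new letter \<open>X\<close> is not equal to a word without it, and two equal words
  that both contain \<open>X\<close>, but not as first letter, give an equation excluded for \<open>X\<close>, unless
  the letter \<open>X\<close> can be cancelled. Words with \<open>X\<close> as first letter contribute at most one
  more element to each set.\<close>

lemma spread_extend:
  assumes icc: "ICC G" and nt: "carrier G \<noteq> {\<one>}" and K: "finite K" "K \<subseteq> carrier G" "\<one> \<in> K"
    and K_inv: "\<And>k. k \<in> K \<Longrightarrow> inv k \<in> K"
    and B: "finite B" "spread K B"
  shows "\<exists>X. X \<notin> B \<and> spread K (insert X B)"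
proof -
  define W where "W = K \<union> B \<union> m_inv G ` B"
  \<comment> \<open>Six is the length of a \<open>words3\<close> word; since \<open>\<one>\<close>
    is in \<open>W\<close>, shorter words are included.\<close>
  define V where "V = (\<lambda>(x1, x2, x3, x4, x5, x6). x1 \<otimes> x2 \<otimes> x3 \<otimes> x4 \<otimes> x5 \<otimes> x6) `
    (W \<times> W \<times> W \<times> W \<times> W \<times> W)"
  have BC: "B \<subseteq> carrier G" using B by (simp add: spread_def)
  have W: "finite W" "W \<subseteq> carrier G" "\<one> \<in> W" using K B BC by (auto simp: W_def)
  have V: "finite V" "V \<subseteq> carrier G" using W by (auto simp: V_def subset_iff)
  have V6: "x1 \<otimes> x2 \<otimes> x3 \<otimes> x4 \<otimes> x5 \<otimes> x6 \<in> V"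
    if "x1 \<in> W" "x2 \<in> W" "x3 \<in> W" "x4 \<in> W" "x5 \<in> W" "x6 \<in> W" for x1 x2 x3 x4 x5 x6
    unfolding V_def by (rule image_eqI[of _ _ "(x1, x2, x3, x4, x5, x6)"]) (use that in auto)
  have WC: "x \<in> carrier G" if "x \<in> W" for x using that W by auto
  have V5: "x1 \<otimes> x2 \<otimes> x3 \<otimes> x4 \<otimes> x5 \<in> V"
    if "x1 \<in> W" "x2 \<in> W" "x3 \<in> W" "x4 \<in> W" "x5 \<in> W" for x1 x2 x3 x4 x5
    using V6[OF that W(3)] that by (simp add: WC)
  have V4: "x1 \<otimes> x2 \<otimes> x3 \<otimes> x4 \<in> V"
    if "x1 \<in> W" "x2 \<in> W" "x3 \<in> W" "x4 \<in> W" for x1 x2 x3 x4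
    using V5[OF that W(3)] that by (simp add: WC)
  have V3: "x1 \<otimes> x2 \<otimes> x3 \<in> V" if "x1 \<in> W" "x2 \<in> W" "x3 \<in> W" for x1 x2 x3
    using V4[OF that W(3)] that by (simp add: WC)
  have V2: "x1 \<otimes> x2 \<in> V" if "x1 \<in> W" "x2 \<in> W" for x1 x2
    using V3[OF that W(3)] that by (simp add: WC)
  have V1: "x1 \<in> V" if "x1 \<in> W" for x1
    using V2[OF that W(3)] that by (simp add: WC)
  have VC: "x \<in> carrier G" if "x \<in> V" for x using that V by auto
  have KW: "k \<in> W" if "k \<in> K" for k using that by (simp add: W_def)
  have BW: "b \<in> W" "inv b \<in> W" if "b \<in> B" for b using that by (auto simp: W_def)
  have KC: "k \<in> carrier G" if "k \<in> K" for k using that K by auto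
  have BC': "b \<in> carrier G" if "b \<in> B" for b using that BC by auto
  note VV = V1 V2 V3 V4 V5 V6 KW BW W(3)
  have J0: "b = b'" if "b \<otimes> k = b' \<otimes> k'" "b \<in> B" "b' \<in> B" "k \<in> K" "k' \<in> K" for b b' k k'
    using B(2) that unfolding spread_def by blast
  have J1: "b = b'" if "b \<otimes> l \<otimes> inv d = b' \<otimes> l' \<otimes> inv d'" "b \<in> B" "b' \<in> B" "l \<in> K - {\<one>}" "l' \<in> K - {\<one>}"
    "d \<in> B" "d' \<in> B" for b b' l l' d d'
  proof -
    have "b \<in> words1 K B (b \<otimes> l \<otimes> inv d)" using that(2-) unfolding words1_def by blast
    moreover have "b' \<in> words1 K B (b \<otimes> l \<otimes> inv d)" unfolding that(1) using that(2-) unfolding words1_def by blast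
    ultimately show ?thesis using B(2) unfolding spread_def by blast
  qed
  have J2: "card (words2 K B v) \<le> 2" and J3: "card (words3 K B v) \<le> 3" for v
    using B by (auto simp: spread_def)
  show ?thesis
  proof (rule generic_for_words[OF icc nt V V1[OF W(3)]], goal_cases)
    case (1 X)
    note X = 1(1) and G1 = 1(2) and G1i = 1(3) and Gc = 1(4) and Gs = 1(5) and Gt = 1(6)
      and G2 = 1(7) and G2i = 1(8) and G3 = 1(9) and G4 = 1(10) and G4i = 1(11)
    let ?B = "insert X B"
    have one: "\<one> \<in> V" using W(3) by (rule V1)
    have XB: "X \<notin> B" using G1[OF one one, of X] X VV by auto
    have G1l: "X \<otimes> b \<noteq> c" if "b \<in> V" "c \<in> V" for b c
      using G1[OF one that] X by simp
    have Gc': "a \<otimes> X \<otimes> b \<otimes> inv X \<otimes> c \<noteq> d" if "a \<in> V" "b \<in> V" "c \<in> V" "d \<in> V" "b \<noteq> \<one>" for a b c d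
      using Gc[OF that(1-4)] that(5) by blast
    have n0: "b \<otimes> k \<noteq> X \<otimes> k'" if "b \<in> B" "k \<in> K" "k' \<in> K" for b k k'
      using G1l[of k' "b \<otimes> k", THEN not_sym] that by (auto simp: VV)
    have N0: "b = b'" if "b \<otimes> k = b' \<otimes> k'" "b \<in> ?B" "b' \<in> ?B" "k \<in> K" "k' \<in> K" for b b' k k'
      using that J0[OF that(1)] n0[of b k k'] n0[of b' k' k] by auto
    \<comment> \<open>Only \<open>b\<close> has to be an old letter: the case of two first letters
      \<open>X\<close> is trivial and the remaining one follows by symmetry.\<close>
    have N1: "b = b'" if H: "b \<otimes> l \<otimes> inv d = b' \<otimes> l' \<otimes> inv d'" and in_B: "b \<in> B" "b' \<in> ?B" "l \<in> K - {\<one>}" "l' \<in> K - {\<one>}"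
      "d \<in> ?B" "d' \<in> ?B" for b b' l l' d d'
    proof (cases "d = X \<and> d' = X")
      case True
      have "b \<otimes> l = (b \<otimes> l \<otimes> inv X) \<otimes> X" using X in_B BC' KC by (auto simp: word_simps)
      also have "\<dots> = b' \<otimes> l'" using H True X in_B BC' KC by (auto simp: word_simps)
      finally show ?thesis using N0 in_B by auto
    next
      case False
      consider "d = X" "d' \<in> B" "b' \<in> B" | "d = X" "d' \<in> B" "b' = X" | "d \<in> B" "b' = X" "d' = X"
        | "d \<in> B" "b' = X" "d' \<in> B" | "d \<in> B" "b' \<in> B" "d' = X" | "d \<in> B" "b' \<in> B" "d' \<in> B"
        using False in_B by auto
      then show ?thesis
      proof cases
        case 1
        have "b \<otimes> l \<otimes> inv X \<otimes> \<one> \<noteq> b' \<otimes> l' \<otimes> inv d'" by (rule G1i) (use 1 in_B in \<open>auto simp: VV\<close>)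
        then show ?thesis using H 1 in_B X BC' KC by simp
      next
        case 2
        have "\<one> \<otimes> X \<otimes> (l' \<otimes> inv d') \<noteq> b \<otimes> l \<otimes> inv X \<otimes> \<one>" by (rule G3) (use 2 in_B in \<open>auto simp: VV\<close>)
        then show ?thesis using H 2 in_B X BC' KC by (simp add: m_assoc)
      next
        case 3
        have "\<one> \<otimes> X \<otimes> l' \<otimes> inv X \<otimes> \<one> \<noteq> b \<otimes> l \<otimes> inv d" by (rule Gc') (use 3 in_B in \<open>auto simp: VV\<close>)
        then show ?thesis using H 3 in_B X BC' KC by simp
      next
        case 4
        have "X \<otimes> (l' \<otimes> inv d') \<noteq> b \<otimes> l \<otimes> inv d" by (rule G1l) (use 4 in_B in \<open>auto simp: VV\<close>)
        then show ?thesis using H 4 in_B X BC' KC by (simp add: m_assoc)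
      next
        case 5
        have "b' \<otimes> l' \<otimes> inv X \<otimes> \<one> \<noteq> b \<otimes> l \<otimes> inv d" by (rule G1i) (use 5 in_B in \<open>auto simp: VV\<close>)
        then show ?thesis using H 5 in_B X BC' KC by simp
      next
        case 6
        then show ?thesis using H J1 in_B by auto
      qed
    qed
    have W1: "b = b'" if mem: "b \<in> words1 K ?B v" "b' \<in> words1 K ?B v" for b b' v
    proof -
      obtain l d where w: "b \<in> ?B" "l \<in> K - {\<one>}" "d \<in> ?B" "b \<otimes> l \<otimes> inv d = v"
        using mem(1) unfolding words1_def by blast
      obtain l' d' where w': "b' \<in> ?B" "l' \<in> K - {\<one>}" "d' \<in> ?B" "b' \<otimes> l' \<otimes> inv d' = v"
        using mem(2) unfolding words1_def by blast
      have eq: "b \<otimes> l \<otimes> inv d = b' \<otimes> l' \<otimes> inv d'" using w w' by simp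
      consider "b \<in> B" | "b' \<in> B" | "b = X" "b' = X" using w(1) w'(1) by blast
      then show ?thesis
      proof cases
        case 1
        then show ?thesis using N1[OF eq] w w' by blast
      next
        case 2
        then show ?thesis using N1[OF eq[symmetric]] w w' by blast
      qed simp
    qed

    have U1: "b = b'" if "b \<in> words1 K B a" "b' \<in> words1 K B a" for b b' a
      using B(2) that unfolding spread_def by blast
    \<comment> \<open>The two possibilities for a \<open>words2\<close> word with old first letter
      that involves \<open>X\<close>: \<open>inv X\<close> in the third position, or
      \<open>X\<close> in the fourth. In the second case the part before \<open>X\<close> is a
      \<open>words1\<close> word and determines the first letter.\<close>
    define H0 where "H0 b v \<longleftrightarrow> (\<exists>l\<in>K. \<exists>r\<in>V. v = b \<otimes> l \<otimes> inv X \<otimes> r)" for b v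
    define H1 where "H1 b v \<longleftrightarrow> (\<exists>a\<in>V. \<exists>r\<in>V. b \<in> words1 K B a \<and> v = a \<otimes> X \<otimes> r)" for b v
    have H00: "b = b'" if b: "b \<in> B" "b' \<in> B" and H: "H0 b v" "H0 b' v" for b b' v
    proof -
      obtain l r where w: "l \<in> K" "r \<in> V" "v = b \<otimes> l \<otimes> inv X \<otimes> r" using H(1) unfolding H0_def by blast
      obtain l' r' where w': "l' \<in> K" "r' \<in> V" "v = b' \<otimes> l' \<otimes> inv X \<otimes> r'" using H(2) unfolding H0_def by blast
      have "b \<otimes> l = b' \<otimes> l'" by (rule G2i[of _ r _ r']) (use w w' b in \<open>simp_all add: VV\<close>)
      then show ?thesis using J0 b w w' by blast
    qed
    have H11: "b = b'" if H: "H1 b v" "H1 b' v" for b b' v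
    proof -
      obtain a r where w: "a \<in> V" "r \<in> V" "b \<in> words1 K B a" "v = a \<otimes> X \<otimes> r" using H(1) unfolding H1_def by blast
      obtain a' r' where w': "a' \<in> V" "r' \<in> V" "b' \<in> words1 K B a'" "v = a' \<otimes> X \<otimes> r'" using H(2) unfolding H1_def by blast
      have "r = r'" by (rule G2[of a r a' r']) (use w w' in simp_all)
      then have "a = a'" using w w' VC X by simp
      then show ?thesis using U1 w w' by blast
    qed
    have H01: False if b: "b \<in> B" and H: "H0 b v" "H1 b' v" for b b' v
    proof -
      obtain l r where w: "l \<in> K" "r \<in> V" "v = b \<otimes> l \<otimes> inv X \<otimes> r" using H(1) unfolding H0_def by blast
      obtain a r' where w': "a \<in> V" "r' \<in> V" "v = a \<otimes> X \<otimes> r'" using H(2) unfolding H1_def by blast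
      show False using G3[OF w'(1,2) V2[OF BW(1)[OF b] KW[OF w(1)]] w(2)] w(3) w'(3) by simp
    qed
    have new2_notin: "v \<notin> V" if w: "b \<in> ?B" "l \<in> K - {\<one>}" "d \<in> ?B" "e \<in> ?B" "k \<in> K" "d \<noteq> e"
      "b = X \<or> d = X \<or> e = X" and v: "v = b \<otimes> l \<otimes> inv d \<otimes> e \<otimes> k" for b l d e k v
    proof
      assume vV: "v \<in> V"
      consider "b = X" "d = X" "e \<in> B" | "b = X" "d \<in> B" "e = X" | "b = X" "d \<in> B" "e \<in> B"
        | "b \<in> B" "d = X" "e \<in> B" | "b \<in> B" "d \<in> B" "e = X" using w by blast
      then show False
      proof cases
        case 1
        have "\<one> \<otimes> X \<otimes> l \<otimes> inv X \<otimes> (e \<otimes> k) \<noteq> v" by (rule Gc') (use 1 w vV in \<open>auto simp: VV\<close>)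
        then show False using 1 w X BC' KC v by (auto simp: m_assoc)
      next
        case 2
        have "\<one> \<otimes> X \<otimes> (l \<otimes> inv d) \<otimes> X \<otimes> k \<noteq> v" by (rule Gs) (use 2 w vV in \<open>auto simp: VV\<close>)
        then show False using 2 w X BC' KC v by (auto simp: m_assoc)
      next
        case 3
        have "X \<otimes> (l \<otimes> inv d \<otimes> e \<otimes> k) \<noteq> v" by (rule G1l) (use 3 w vV in \<open>auto simp: VV\<close>)
        then show False using 3 w X BC' KC v by (auto simp: m_assoc)
      next
        case 4
        have "b \<otimes> l \<otimes> inv X \<otimes> (e \<otimes> k) \<noteq> v" by (rule G1i) (use 4 w vV in \<open>auto simp: VV\<close>)
        then show False using 4 w X BC' KC v by (auto simp: m_assoc)
      next
        case 5
        have "b \<otimes> l \<otimes> inv d \<otimes> X \<otimes> k \<noteq> v" by (rule G1) (use 5 w vV in \<open>auto simp: VV\<close>)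
        then show False using 5 w X BC' KC v by (auto simp: m_assoc)
      qed
    qed
    have W2: "card (words2 K ?B v) \<le> 2" for v
    proof (cases "words2 K ?B v \<subseteq> words2 K B v")
      case True
      then show ?thesis using card_mono[OF _ True] J2[of v] B(1) by (auto simp: words2_def intro: order_trans)
    next
      case False
      then obtain b0 where b0: "b0 \<in> words2 K ?B v" "b0 \<notin> words2 K B v" by blast
      then obtain l0 d0 e0 k0 where w0: "b0 \<in> ?B" "l0 \<in> K - {\<one>}" "d0 \<in> ?B" "e0 \<in> ?B" "k0 \<in> K" "d0 \<noteq> e0"
        "b0 \<otimes> l0 \<otimes> inv d0 \<otimes> e0 \<otimes> k0 = v" unfolding words2_def by blast
      have "b0 = X \<or> d0 = X \<or> e0 = X" using b0(2) w0 unfolding words2_def by blast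
      then have vV: "v \<notin> V" using new2_notin[OF w0(1-6) _ w0(7)[symmetric]] by blast
      have new: "H0 b v \<or> H1 b v" if b: "b \<in> words2 K ?B v" "b \<in> B" for b
      proof -
        obtain l d e k where w: "l \<in> K - {\<one>}" "d \<in> ?B" "e \<in> ?B" "k \<in> K" "d \<noteq> e"
          "b \<otimes> l \<otimes> inv d \<otimes> e \<otimes> k = v" using b unfolding words2_def by blast
        have "v \<in> V" if "d \<in> B" "e \<in> B" unfolding w(6)[symmetric]
          by (rule V5) (use that w b in \<open>auto simp: VV\<close>)
        then consider "d = X" "e \<in> B" | "e = X" "d \<in> B" using vV w by blast
        then show ?thesis
        proof cases
          case 1
          have "v = b \<otimes> l \<otimes> inv X \<otimes> (e \<otimes> k)" using 1 w b X BC' KC by (auto simp: m_assoc)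
          moreover have "e \<otimes> k \<in> V" using 1 w by (simp add: VV)
          ultimately show ?thesis using w unfolding H0_def by blast
        next
          case 2
          have "b \<otimes> l \<otimes> inv d \<in> V" "k \<in> V" using 2 w b by (simp_all add: VV)
          moreover have "b \<in> words1 K B (b \<otimes> l \<otimes> inv d)" using 2 w b unfolding words1_def by blast
          moreover have "v = b \<otimes> l \<otimes> inv d \<otimes> X \<otimes> k" using 2 w by simp
          ultimately show ?thesis unfolding H1_def by blast
        qed
      qed
      obtain b1 where "words2 K ?B v \<subseteq> {X, b1}"
      proof (cases "words2 K ?B v \<subseteq> {X}")
        case False
        then obtain b1 where b1: "b1 \<in> words2 K ?B v" "b1 \<in> B" unfolding words2_def by blast
        have "words2 K ?B v \<subseteq> {X, b1}"
        proof
          fix b assume b: "b \<in> words2 K ?B v"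
          show "b \<in> {X, b1}"
          proof (cases "b = X")
            case False
            then have "b \<in> B" using b unfolding words2_def by blast
            then have "b = b1"
              using new[OF b] new[OF b1] b1(2) H00[of b b1 v] H11[of b v b1] H01[of b v b1] H01[of b1 v b] by argo
            then show ?thesis by simp
          qed simp
        qed
        then show ?thesis by (rule that)
      qed (use that in blast)
      then have "card (words2 K ?B v) \<le> card {X, b1}" by (intro card_mono) auto
      also have "\<dots> \<le> 2" by (simp add: card_insert_if)
      finally show ?thesis .
    qed

    \<comment> \<open>For the words with first letter in \<open>B\<close>, the predicates \<open>F0\<close>, \<open>H1\<close>, \<open>F2\<close> and \<open>F3\<close>
      describe the possible sets of positions of \<open>X\<close>.\<close>
    define F0 where "F0 b v \<longleftrightarrow> (\<exists>l\<in>K. \<exists>r\<in>V. r \<noteq> \<one> \<and> v = b \<otimes> l \<otimes> inv X \<otimes> r)" for b v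
    define F2 where "F2 b v \<longleftrightarrow> (\<exists>a\<in>V. b \<in> words2 K B a \<and> v = a \<otimes> inv X \<otimes> \<one>)" for b v
    define F3 where "F3 b v \<longleftrightarrow> (\<exists>a\<in>V. \<exists>k\<in>V. b \<in> words1 K B a \<and> v = a \<otimes> X \<otimes> k \<otimes> inv X)" for b v
    have F0_H0: "H0 b v" if "F0 b v" for b v using that unfolding F0_def H0_def by blast
    have F33: "b = b'" if F: "F3 b v" "F3 b' v" for b b' v
    proof -
      obtain a k where w: "a \<in> V" "k \<in> V" "b \<in> words1 K B a" "v = a \<otimes> X \<otimes> k \<otimes> inv X"
        using F(1) unfolding F3_def by blast
      obtain a' k' where w': "a' \<in> V" "k' \<in> V" "b' \<in> words1 K B a'" "v = a' \<otimes> X \<otimes> k' \<otimes> inv X"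
        using F(2) unfolding F3_def by blast
      have eq: "a \<otimes> X \<otimes> k = a' \<otimes> X \<otimes> k'" using w w' VC X by simp
      then have "k = k'" by (rule G2[rotated 4]) (use w w' in simp_all)
      then have "a = a'" using eq w w' VC X by simp
      then show ?thesis using U1 w w' by blast
    qed
    \<comment> \<open>Here the condition \<open>r \<noteq> \<one>\<close>, by which
      \<open>F0\<close> differs from \<open>H0\<close>, matters: with \<open>r = \<one>\<close> both
      words would end in the same \<open>inv X\<close>.\<close>
    have F02: False if b: "b \<in> B" and F: "F0 b v" "F2 b' v" for b b' v
    proof -
      obtain l r where w: "l \<in> K" "r \<in> V" "r \<noteq> \<one>" "v = b \<otimes> l \<otimes> inv X \<otimes> r" using F(1) unfolding F0_def by blast
      obtain a where w': "a \<in> V" "v = a \<otimes> inv X \<otimes> \<one>" using F(2) unfolding F2_def by blast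
      have "b \<otimes> l = a" by (rule G2i[of _ r _ \<one>]) (use w w' b in \<open>simp_all add: VV\<close>)
      then have "a \<otimes> inv X \<otimes> r = a \<otimes> inv X" using w w' VC X by simp
      then show False using w w' VC X by simp
    qed
    have F03: False if b: "b \<in> B" and F: "F0 b v" "F3 b' v" for b b' v
    proof -
      obtain l r where w: "l \<in> K" "r \<in> V" "v = b \<otimes> l \<otimes> inv X \<otimes> r" using F(1) unfolding F0_def by blast
      obtain a k where w': "a \<in> V" "k \<in> V" "v = a \<otimes> X \<otimes> k \<otimes> inv X" using F(2) unfolding F3_def by blast
      show False using G4i[OF w'(1,2) V2[OF BW(1)[OF b] KW[OF w(1)]] w(2)] w(3) w'(3) by simp
    qed
    have F12: False if F: "H1 b v" "F2 b' v" for b b' v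
      using F G3[OF _ _ _ one] unfolding H1_def F2_def by (elim bexE conjE) simp
    have F13: False if F: "H1 b v" "F3 b' v" for b b' v
    proof -
      obtain a r where w: "a \<in> V" "r \<in> V" "v = a \<otimes> X \<otimes> r" using F(1) unfolding H1_def by blast
      obtain a' k where w': "a' \<in> V" "k \<in> V" "v = a' \<otimes> X \<otimes> k \<otimes> inv X" using F(2) unfolding F3_def by blast
      show False using G4[OF w'(1,2) w(1,2)] w(3) w'(3) by simp
    qed
    have F23: False if F: "F2 b v" "F3 b' v" for b b' v
    proof -
      obtain a where w: "a \<in> V" "v = a \<otimes> inv X \<otimes> \<one>" using F(1) unfolding F2_def by blast
      obtain a' k where w': "a' \<in> V" "k \<in> V" "v = a' \<otimes> X \<otimes> k \<otimes> inv X" using F(2) unfolding F3_def by blast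
      have "a' \<otimes> X \<otimes> k = a" using w w' VC X by simp
      then show False using G1[OF w'(1,2) w(1)] by simp
    qed
    have new3_notin: "v \<notin> V" if w: "b \<in> ?B" "l \<in> K - {\<one>}" "d \<in> ?B" "e \<in> ?B" "k \<in> K" "c \<in> ?B"
      "d \<noteq> e" "d \<noteq> c" "e \<noteq> c \<or> k \<noteq> \<one>"
      "b = X \<or> d = X \<or> e = X \<or> c = X" and v: "v = b \<otimes> l \<otimes> inv d \<otimes> e \<otimes> k \<otimes> inv c" for b l d e k c v
    proof
      assume vV: "v \<in> V"
      consider "b = X" "d = X" "e \<in> B" "c \<in> B" | "b = X" "d \<in> B" "e = X" "c \<in> B"
        | "b = X" "d \<in> B" "e = X" "c = X" | "b = X" "d \<in> B" "e \<in> B" "c = X" | "b = X" "d \<in> B" "e \<in> B" "c \<in> B"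
        | "b \<in> B" "d = X" "e \<in> B" "c \<in> B" | "b \<in> B" "d \<in> B" "e = X" "c \<in> B"
        | "b \<in> B" "d \<in> B" "e \<in> B" "c = X" | "b \<in> B" "d \<in> B" "e = X" "c = X"
        using w by (cases "b = X"; cases "d = X"; cases "e = X"; cases "c = X") auto
      then show False
      proof cases
        case 1
        have "\<one> \<otimes> X \<otimes> l \<otimes> inv X \<otimes> (e \<otimes> k \<otimes> inv c) \<noteq> v" by (rule Gc') (use 1 w vV in \<open>auto simp: VV\<close>)
        then show False using 1 w X BC' KC v by (auto simp: m_assoc)
      next
        case 2
        have "\<one> \<otimes> X \<otimes> (l \<otimes> inv d) \<otimes> X \<otimes> (k \<otimes> inv c) \<noteq> v" by (rule Gs) (use 2 w vV in \<open>auto simp: VV\<close>)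
        then show False using 2 w X BC' KC v by (auto simp: m_assoc)
      next
        case 3
        have "\<one> \<otimes> X \<otimes> (l \<otimes> inv d) \<otimes> X \<otimes> k \<otimes> inv X \<noteq> v" by (rule Gt) (use 3 w vV in \<open>auto simp: VV\<close>)
        then show False using 3 w X BC' KC v by (auto simp: m_assoc)
      next
        case 4
        have C: "d \<in> carrier G" "e \<in> carrier G" "k \<in> carrier G" "l \<in> carrier G" using 4 w BC' KC by auto
        \<comment> \<open>Otherwise \<open>X\<close> and \<open>inv X\<close> would cancel. Since
          \<open>K\<close> is closed under inverses, a trivial product would say that
          \<open>d K\<close> meets \<open>e K\<close>.\<close>
        have "l \<otimes> inv d \<otimes> e \<otimes> k \<noteq> \<one>"
        proof
          assume *: "l \<otimes> inv d \<otimes> e \<otimes> k = \<one>"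
          have "d \<otimes> inv l = d \<otimes> inv l \<otimes> (l \<otimes> inv d \<otimes> e \<otimes> k)" unfolding * using C by simp
          also have "\<dots> = e \<otimes> k" using C by (simp add: word_simps)
          finally show False using J0 4 w K_inv by blast
        qed
        then have "\<one> \<otimes> X \<otimes> (l \<otimes> inv d \<otimes> e \<otimes> k) \<otimes> inv X \<otimes> \<one> \<noteq> v"
          by (intro Gc') (use 4 w vV in \<open>auto simp: VV\<close>)
        then show False using 4 w X BC' KC v by (auto simp: m_assoc)
      next
        case 5
        have "X \<otimes> (l \<otimes> inv d \<otimes> e \<otimes> k \<otimes> inv c) \<noteq> v" by (rule G1l) (use 5 w vV in \<open>auto simp: VV\<close>)
        then show False using 5 w X BC' KC v by (auto simp: m_assoc)
      next
        case 6
        have "b \<otimes> l \<otimes> inv X \<otimes> (e \<otimes> k \<otimes> inv c) \<noteq> v" by (rule G1i) (use 6 w vV in \<open>auto simp: VV\<close>)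
        then show False using 6 w X BC' KC v by (auto simp: m_assoc)
      next
        case 7
        have "b \<otimes> l \<otimes> inv d \<otimes> X \<otimes> (k \<otimes> inv c) \<noteq> v" by (rule G1) (use 7 w vV in \<open>auto simp: VV\<close>)
        then show False using 7 w X BC' KC v by (auto simp: m_assoc)
      next
        case 8
        have "b \<otimes> l \<otimes> inv d \<otimes> e \<otimes> k \<otimes> inv X \<otimes> \<one> \<noteq> v" by (rule G1i) (use 8 w vV in \<open>auto simp: VV\<close>)
        then show False using 8 w X BC' KC v by (auto simp: m_assoc)
      next
        case 9
        have "b \<otimes> l \<otimes> inv d \<otimes> X \<otimes> k \<otimes> inv X \<otimes> \<one> \<noteq> v" by (rule Gc') (use 9 w vV in \<open>auto simp: VV\<close>)
        then show False using 9 w X BC' KC v by (auto simp: m_assoc)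
      qed
    qed
    have W3: "card (words3 K ?B v) \<le> 3" for v
    proof (cases "words3 K ?B v \<subseteq> words3 K B v")
      case True
      then show ?thesis using card_mono[OF _ True] J3[of v] B(1) by (auto simp: words3_def intro: order_trans)
    next
      case False
      then obtain b0 where b0: "b0 \<in> words3 K ?B v" "b0 \<notin> words3 K B v" by blast
      from b0(1) obtain l0 d0 e0 k0 c0 where w0: "b0 \<in> ?B" "l0 \<in> K - {\<one>}" "d0 \<in> ?B" "e0 \<in> ?B" "k0 \<in> K" "c0 \<in> ?B"
        "d0 \<noteq> e0" "d0 \<noteq> c0" "e0 \<noteq> c0 \<or> k0 \<noteq> \<one>"
        "b0 \<otimes> l0 \<otimes> inv d0 \<otimes> e0 \<otimes> k0 \<otimes> inv c0 = v" by (rule words3E)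
      have "b0 \<in> words3 K B v" if "b0 \<in> B" "d0 \<in> B" "e0 \<in> B" "c0 \<in> B"
        by (rule words3I[OF that(1) w0(2) that(2,3) w0(5) that(4) w0(7-10)])
      then have "b0 = X \<or> d0 = X \<or> e0 = X \<or> c0 = X" using b0(2) w0(1,3,4,6) by blast
      then have vV: "v \<notin> V" using new3_notin[OF w0(1-9) _ w0(10)[symmetric]] by blast
      have new: "F0 b v \<or> H1 b v \<or> F2 b v \<or> F3 b v" if b: "b \<in> words3 K ?B v" "b \<in> B" for b
      proof -
        from b(1) obtain l d e k c where "b \<in> ?B" and w: "l \<in> K - {\<one>}" "d \<in> ?B" "e \<in> ?B" "k \<in> K" "c \<in> ?B"
          "d \<noteq> e" "d \<noteq> c" "e \<noteq> c \<or> k \<noteq> \<one>" "b \<otimes> l \<otimes> inv d \<otimes> e \<otimes> k \<otimes> inv c = v" by (rule words3E)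
        have "v \<in> V" if "d \<in> B" "e \<in> B" "c \<in> B" unfolding w(9)[symmetric]
          by (rule V6) (use that w b in \<open>auto simp: VV\<close>)
        then consider "d = X" "e \<in> B" "c \<in> B" | "e = X" "d \<in> B" "c \<in> B"
          | "c = X" "d \<in> B" "e \<in> B" | "c = X" "d \<in> B" "e = X"
          using vV w by (cases "d = X"; cases "e = X"; cases "c = X") auto
        then show ?thesis
        proof cases
          case 1
          have C: "e \<in> carrier G" "c \<in> carrier G" "k \<in> carrier G" using 1 w BC' KC by auto
          have "e \<otimes> k \<otimes> inv c \<noteq> \<one>"
          proof
            assume *: "e \<otimes> k \<otimes> inv c = \<one>"
            have "e \<otimes> k = (e \<otimes> k \<otimes> inv c) \<otimes> c" using C by (simp add: word_simps)
            then have ek: "e \<otimes> k = c \<otimes> \<one>" unfolding * using C by simp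
            then have "e = c" using J0 1 w K by blast
            then show False using ek w(8) C by simp
          qed
          moreover have "v = b \<otimes> l \<otimes> inv X \<otimes> (e \<otimes> k \<otimes> inv c)" using 1 w b X BC' KC by (auto simp: m_assoc)
          moreover have "e \<otimes> k \<otimes> inv c \<in> V" using 1 w by (simp add: VV)
          ultimately show ?thesis using w unfolding F0_def by blast
        next
          case 2
          have "b \<otimes> l \<otimes> inv d \<in> V" "k \<otimes> inv c \<in> V" using 2 w b by (simp_all add: VV)
          moreover have "b \<in> words1 K B (b \<otimes> l \<otimes> inv d)" using 2 w b unfolding words1_def by blast
          moreover have "v = b \<otimes> l \<otimes> inv d \<otimes> X \<otimes> (k \<otimes> inv c)" using 2 w b X BC' KC by (auto simp: m_assoc)
          ultimately show ?thesis unfolding H1_def by blast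
        next
          case 3
          have "b \<otimes> l \<otimes> inv d \<otimes> e \<otimes> k \<in> V" by (rule V5) (use 3 w b in \<open>auto simp: VV\<close>)
          moreover have "b \<in> words2 K B (b \<otimes> l \<otimes> inv d \<otimes> e \<otimes> k)" using 3 w b unfolding words2_def by blast
          moreover have "v = b \<otimes> l \<otimes> inv d \<otimes> e \<otimes> k \<otimes> inv X \<otimes> \<one>" using 3 w b X BC' KC by auto
          ultimately show ?thesis unfolding F2_def by blast
        next
          case 4
          have "b \<otimes> l \<otimes> inv d \<in> V" "k \<in> V" using 4 w b by (simp_all add: VV)
          moreover have "b \<in> words1 K B (b \<otimes> l \<otimes> inv d)" using 4 w b unfolding words1_def by blast
          moreover have "v = b \<otimes> l \<otimes> inv d \<otimes> X \<otimes> k \<otimes> inv X" using 4 w by simp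
          ultimately show ?thesis unfolding F3_def by blast
        qed
      qed
      have fin: "finite (words2 K B u)" for u using B(1) by (auto simp: words2_def)
      \<comment> \<open>Cancelling the final \<open>inv X\<close> puts all first letters of type
        \<open>F2\<close> into the single set \<open>words2 K B (v \<otimes> X)\<close>, which has
        at most two elements; with \<open>X\<close> there are three. If there is an old first letter
        not of this type, it is the only old one.\<close>
      have F2u: "b \<in> words2 K B (v \<otimes> X)" if "F2 b v" for b
        using that VC X unfolding F2_def by (auto simp: word_simps)
      show ?thesis
      proof (cases "\<forall>b\<in>words3 K ?B v \<inter> B. F2 b v")
        case True
        then have "words3 K ?B v \<subseteq> insert X (words2 K B (v \<otimes> X))"
          using F2u unfolding words3_def by blast
        then have "card (words3 K ?B v) \<le> card (insert X (words2 K B (v \<otimes> X)))"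
          using fin by (intro card_mono) auto
        also have "\<dots> \<le> 3" using J2[of "v \<otimes> X"] by (simp add: card_insert_if fin)
        finally show ?thesis .
      next
        case False
        then obtain b1 where b1: "b1 \<in> words3 K ?B v" "b1 \<in> B" "\<not> F2 b1 v" by blast
        have "words3 K ?B v \<subseteq> {X, b1}"
        proof
          fix b assume b: "b \<in> words3 K ?B v"
          show "b \<in> {X, b1}"
          proof (cases "b = X")
            case False
            then have bB: "b \<in> B" using b unfolding words3_def by blast
            have "b = b1"
              using new[OF b bB] new[OF b1(1,2)] b1(3) F0_H0[of b v] F0_H0[of b1 v] H00[OF bB b1(2), of v]
                H11[of b v b1] F33[of b v b1] H01[OF bB, of v b1] H01[OF b1(2), of v b] F02[OF b1(2), of v b]
                F03[OF bB, of v b1] F03[OF b1(2), of v b] F12[of b1 v b] F13[of b v b1] F13[of b1 v b] F23[of b v b1]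
              by argo
            then show ?thesis by simp
          qed simp
        qed
        then have "card (words3 K ?B v) \<le> card {X, b1}" by (intro card_mono) auto
        also have "\<dots> \<le> 3" by (simp add: card_insert_if)
        finally show ?thesis .
      qed
    qed
    have "spread K ?B"
      unfolding spread_def using BC X N0 W1 W2 W3 by blast
    then show ?thesis using XB by blast
  qed
qed

lemma spread_exists:
  assumes "ICC G" and "carrier G \<noteq> {\<one>}" and "finite K" "K \<subseteq> carrier G" "\<one> \<in> K"
    and "\<And>k. k \<in> K \<Longrightarrow> inv k \<in> K"
  shows "\<exists>B. finite B \<and> card B = n \<and> spread K B"
proof (induction n)
  case 0
  have "spread K {}" by (simp add: spread_def words1_def words2_def words3_def)
  then show ?case by (intro exI[of _ "{}"]) simp
next
  case (Suc n)
  then obtain B where B: "finite B" "card B = n" "spread K B" by blast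
  obtain X where "X \<notin> B" "spread K (insert X B)" using spread_extend[OF assms B(1,3)] by blast
  then show ?case using B by (intro exI[of _ "insert X B"]) simp
qed

text \<open>\<open>F\<close> consists of the elements \<open>inv q \<otimes> b\<close> with \<open>q = e \<otimes> k \<otimes> inv c\<close>, where \<open>b\<close> differs from
  \<open>e\<close>, \<open>c\<close> and the few letters \<open>lost q\<close>. A failure of separatedness of \<open>F\<close> would be an equation
  \<open>q = b \<otimes> l \<otimes> inv d \<otimes> q'\<close>, which puts \<open>b\<close> into \<open>lost q\<close>. The numbers fit because at most
  \<open>2 + 4\<close> letters are forbidden for \<open>q\<close> and \<open>11 < 7 + (11 - 6)\<close>.\<close>

lemma hitting_family_exists:
  assumes icc: "ICC G" and nt: "carrier G \<noteq> {\<one>}" and K: "finite K" "K \<subseteq> carrier G" "\<one> \<in> K"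
    and K_inv: "\<And>k. k \<in> K \<Longrightarrow> inv k \<in> K"
  obtains B F where "finite B" "B \<subseteq> carrier G" "card B = 11" "finite F" "F \<subseteq> carrier G"
    and "\<And>b b'. \<lbrakk>b \<in> B; b' \<in> B; inv b \<otimes> b' \<in> K\<rbrakk> \<Longrightarrow> b = b'"
    and "\<And>f f'. \<lbrakk>f \<in> F; f' \<in> F; inv f \<otimes> f' \<in> K\<rbrakk> \<Longrightarrow> f = f'"
    and "\<And>e k c B'. \<lbrakk>e \<in> B; k \<in> K; c \<in> B; B' \<subseteq> B; 7 \<le> card B'\<rbrakk> \<Longrightarrow> \<exists>b\<in>B'. inv (e \<otimes> k \<otimes> inv c) \<otimes> b \<in> F"
    and "\<And>u. u \<in> carrier G \<Longrightarrow> card {b \<in> B. u \<otimes> b \<notin> F \<and> (\<exists>f\<in>F. \<exists>k\<in>K. u \<otimes> b = f \<otimes> k)} \<le> 4"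
proof -
  obtain B where B: "finite B" "card B = 11" "spread K B"
    using spread_exists[OF icc nt K K_inv] by blast
  have BC: "b \<in> carrier G" if "b \<in> B" for b using B(3) that unfolding spread_def by blast
  have KC: "k \<in> carrier G" if "k \<in> K" for k using K(2) that by blast
  \<comment> \<open>\<open>words1\<close> covers the degenerate case \<open>e = c\<close>,
    \<open>k = \<one>\<close> of a \<open>words3\<close> word, in which the second half cancels. The
    bounds 1 and 3 add up to 4.\<close>
  define lost where "lost v = words1 K B v \<union> words3 K B v" for v
  have lost_B: "lost v \<subseteq> B" for v by (auto simp: lost_def words1_def words3_def)
  have card_lost: "card (lost v) \<le> 4" for v
  proof -
    have "finite (words1 K B v)" using B(1) by (simp add: words1_def)
    moreover have "\<And>b b'. b \<in> words1 K B v \<Longrightarrow> b' \<in> words1 K B v \<Longrightarrow> b = b'"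
      using B(3) unfolding spread_def by blast
    ultimately have "card (words1 K B v) \<le> 1"
      by (metis One_nat_def card_le_Suc0_iff_eq)
    moreover have "card (words3 K B v) \<le> 3" using B(3) unfolding spread_def by blast
    ultimately show ?thesis using card_Un_le[of "words1 K B v" "words3 K B v"] by (simp add: lost_def)
  qed
  have lostI: "b \<in> lost v" if "b \<in> B" "l \<in> K" "l \<noteq> \<one>" "d \<in> B" "e \<in> B" "k \<in> K" "c \<in> B" "d \<noteq> e" "d \<noteq> c"
    "v = b \<otimes> l \<otimes> inv d \<otimes> (e \<otimes> k \<otimes> inv c)" for b l d e k c v
  proof (cases "e = c \<and> k = \<one>")
    case True
    then have "b \<otimes> l \<otimes> inv d = v" using that BC KC by simp
    then have "b \<in> words1 K B v" using that(1-4) unfolding words1_def by blast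
    then show ?thesis by (simp add: lost_def)
  next
    case False
    have "b \<in> words3 K B v"
      by (rule words3I[of b B l K d e k c]) (use that BC KC False in \<open>auto simp: m_assoc\<close>)
    then show ?thesis by (simp add: lost_def)
  qed
  define F where "F = {inv (e \<otimes> k \<otimes> inv c) \<otimes> b |e k c b. e \<in> B \<and> k \<in> K \<and> c \<in> B \<and>
    b \<in> B - {e, c} - lost (e \<otimes> k \<otimes> inv c)}"
  have "F \<subseteq> (\<lambda>(e, k, c, b). inv (e \<otimes> k \<otimes> inv c) \<otimes> b) ` (B \<times> K \<times> B \<times> B)" unfolding F_def by force
  then have "finite F" by (rule finite_subset) (use B K in auto)
  have "F \<subseteq> carrier G" using BC KC by (auto simp: F_def)
  show thesis
  proof (rule that[OF B(1) _ B(2) \<open>finite F\<close> \<open>F \<subseteq> carrier G\<close>], goal_cases)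
    case 1
    show ?case using BC by blast
  next
    case (2 b b')
    have "b \<otimes> (inv b \<otimes> b') = b' \<otimes> \<one>" using 2 BC by (simp add: word_simps)
    then show ?case using 2 K(3) B(3) unfolding spread_def by blast
  next
    case (3 f f')
    obtain e k c b where f: "f = inv (e \<otimes> k \<otimes> inv c) \<otimes> b" "e \<in> B" "k \<in> K" "c \<in> B"
      "b \<in> B" "b \<notin> lost (e \<otimes> k \<otimes> inv c)" using 3(1) unfolding F_def by blast
    obtain e' k' c' d where f': "f' = inv (e' \<otimes> k' \<otimes> inv c') \<otimes> d" "e' \<in> B" "k' \<in> K" "c' \<in> B"
      "d \<in> B" "d \<noteq> e'" "d \<noteq> c'" using 3(2) unfolding F_def by blast
    define q where "q = e \<otimes> k \<otimes> inv c"
    define q' where "q' = e' \<otimes> k' \<otimes> inv c'"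
    have C: "q \<in> carrier G" "q' \<in> carrier G" "b \<in> carrier G" "d \<in> carrier G" "f \<in> carrier G" "f' \<in> carrier G"
      using f f' BC KC by (auto simp: q_def q'_def)
    show ?case
    proof (rule ccontr)
      assume "f \<noteq> f'"
      have "f' = f \<otimes> (inv f \<otimes> f')" using C by (simp add: word_simps)
      then have "inv f \<otimes> f' \<noteq> \<one>" using \<open>f \<noteq> f'\<close> C by auto
      moreover have "q = b \<otimes> (inv f \<otimes> f') \<otimes> inv d \<otimes> q'"
        using C by (simp add: f(1) f'(1) word_simps flip: q_def q'_def)
      ultimately have "b \<in> lost q"
        by (intro lostI[of b "inv f \<otimes> f'" d e' k' c' q]) (use f f' 3 in \<open>simp_all add: q'_def\<close>)
      then show False using f by (simp add: q_def)
    qed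
  next
    case (4 e k c B')
    let ?q = "e \<otimes> k \<otimes> inv c"
    have "finite B'" using 4 B(1) finite_subset by blast
    have "\<not> B' \<subseteq> {e, c} \<union> lost ?q"
    proof
      assume "B' \<subseteq> {e, c} \<union> lost ?q"
      then have "card B' \<le> card ({e, c} \<union> lost ?q)"
        using B(1) lost_B finite_subset by (intro card_mono) blast+
      also have "\<dots> \<le> card {e, c} + card (lost ?q)" by (rule card_Un_le)
      also have "\<dots> \<le> 2 + 4" using card_lost by (intro add_mono) (auto simp: card_insert_if)
      finally show False using 4 by simp
    qed
    then obtain b where b: "b \<in> B'" "b \<notin> {e, c}" "b \<notin> lost ?q" by blast
    then have "inv ?q \<otimes> b \<in> F" using 4 unfolding F_def by blast
    then show ?case using b by blast
  next
    case (5 u)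
    \<comment> \<open>The same word equation as for separatedness, now for \<open>inv u\<close>: if
      \<open>u \<otimes> b = f \<otimes> l\<close> with \<open>f = inv q \<otimes> d\<close>, then
      \<open>inv u = b \<otimes> inv l \<otimes> inv d \<otimes> q\<close>.\<close>
    have "{b \<in> B. u \<otimes> b \<notin> F \<and> (\<exists>f\<in>F. \<exists>k\<in>K. u \<otimes> b = f \<otimes> k)} \<subseteq> lost (inv u)"
    proof (clarify)
      fix b f l assume b: "b \<in> B" "u \<otimes> b \<notin> F" "f \<in> F" "l \<in> K" "u \<otimes> b = f \<otimes> l"
      obtain e k c d where f: "f = inv (e \<otimes> k \<otimes> inv c) \<otimes> d" "e \<in> B" "k \<in> K" "c \<in> B"
        "d \<in> B" "d \<noteq> e" "d \<noteq> c" using b(3) unfolding F_def by blast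
      define q where "q = e \<otimes> k \<otimes> inv c"
      have C: "q \<in> carrier G" "d \<in> carrier G" "f \<in> carrier G" "b \<in> carrier G" "l \<in> carrier G"
        using f b BC KC by (auto simp: q_def)
      have "u = (u \<otimes> b) \<otimes> inv b" using C 5 by (simp add: word_simps)
      also have "\<dots> = inv q \<otimes> d \<otimes> l \<otimes> inv b" unfolding b(5) f(1) q_def ..
      finally have "inv u = b \<otimes> inv l \<otimes> inv d \<otimes> q" using C by (simp add: word_simps)
      moreover have "l \<noteq> \<one>" using b C by auto
      then have "inv l \<noteq> \<one>" using C by simp
      ultimately show "b \<in> lost (inv u)"
        by (intro lostI[of b "inv l" d e k c]) (use b f K_inv in \<open>simp_all add: q_def\<close>)
    qed
    then have "card {b \<in> B. u \<otimes> b \<notin> F \<and> (\<exists>f\<in>F. \<exists>k\<in>K. u \<otimes> b = f \<otimes> k)} \<le> card (lost (inv u))"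
      by (rule card_mono[OF finite_subset[OF lost_B B(1)]])
    then show ?case using card_lost[of "inv u"] by simp
  qed
qed

end

section \<open>Compactness and gluing\<close>

lemma topspace_full_shift: "topspace (full_shift G A) = carrier G \<rightarrow>\<^sub>E A"
  by (simp add: full_shift_def)

lemma openin_full_shift_cylinder:
  assumes "openin (full_shift G A) U" "t \<in> U"
  obtains Z where "finite Z" "Z \<subseteq> carrier G" "\<And>s. s \<in> carrier G \<rightarrow>\<^sub>E A \<Longrightarrow> \<forall>z\<in>Z. s z = t z \<Longrightarrow> s \<in> U"
proof -
  obtain V where V: "finite {i \<in> carrier G. V i \<noteq> A}" "t \<in> Pi\<^sub>E (carrier G) V" "Pi\<^sub>E (carrier G) V \<subseteq> U"
    using assms unfolding full_shift_def openin_product_topology_alt by force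
  show thesis
  proof (rule that[OF V(1)])
    fix s assume s: "s \<in> carrier G \<rightarrow>\<^sub>E A" "\<forall>z\<in>{i \<in> carrier G. V i \<noteq> A}. s z = t z"
    have "s \<in> Pi\<^sub>E (carrier G) V"
    proof (rule PiE_I)
      fix x assume x: "x \<in> carrier G"
      show "s x \<in> V x"
      proof (cases "V x = A")
        case False
        then have "s x = t x" using s x by blast
        then show ?thesis using V(2) x by auto
      qed (use s x in auto)
    next
      fix x assume "x \<notin> carrier G"
      then show "s x = undefined" by (rule PiE_arb[OF s(1)])
    qed
    then show "s \<in> U" using V(3) by blast
  qed auto
qed

lemma openin_full_shift_local:
  assumes "finite Z" "Z \<subseteq> carrier G"
  shows "openin (full_shift G A) {s \<in> carrier G \<rightarrow>\<^sub>E A. \<forall>z\<in>Z. s z = t z}"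
proof (cases "\<forall>z\<in>Z. t z \<in> A")
  case True
  have "{s \<in> carrier G \<rightarrow>\<^sub>E A. \<forall>z\<in>Z. s z = t z} = Pi\<^sub>E (carrier G) (\<lambda>z. if z \<in> Z then {t z} else A)"
    using True assms by (auto simp: PiE_def Pi_def split: if_splits)
  moreover have "finite {i \<in> carrier G. (if i \<in> Z then {t i} else A) \<noteq> topspace (discrete_topology A)}"
    by (rule finite_subset[OF _ assms(1)]) auto
  ultimately show ?thesis
    unfolding full_shift_def using True
    by (auto simp: openin_PiE_gen)
next
  case False
  then obtain z where z: "z \<in> Z" "t z \<notin> A" by blast
  have "s \<notin> carrier G \<rightarrow>\<^sub>E A" if "\<forall>z\<in>Z. s z = t z" for s
  proof
    assume "s \<in> carrier G \<rightarrow>\<^sub>E A"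
    moreover have "z \<in> carrier G" using z assms(2) by blast
    ultimately have "s z \<in> A" by (rule PiE_mem)
    then show False using that z by simp
  qed
  then have "{s \<in> carrier G \<rightarrow>\<^sub>E A. \<forall>z\<in>Z. s z = t z} = {}" by blast
  then show ?thesis by (simp only: openin_empty)
qed

lemma closedin_full_shift_iff:
  "closedin (full_shift G A) S \<longleftrightarrow> S \<subseteq> carrier G \<rightarrow>\<^sub>E A \<and>
    (\<forall>t\<in>carrier G \<rightarrow>\<^sub>E A. (\<forall>Z. finite Z \<and> Z \<subseteq> carrier G \<longrightarrow> (\<exists>s\<in>S. \<forall>z\<in>Z. s z = t z)) \<longrightarrow> t \<in> S)"
    (is "_ \<longleftrightarrow> ?sub \<and> ?lim")
proof
  assume cl: "closedin (full_shift G A) S"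
  then have sub: ?sub using closedin_subset[OF cl] by (simp add: topspace_full_shift)
  moreover have ?lim
  proof (intro ballI impI, rule ccontr)
    fix t assume t: "t \<in> carrier G \<rightarrow>\<^sub>E A" "t \<notin> S"
      and ex: "\<forall>Z. finite Z \<and> Z \<subseteq> carrier G \<longrightarrow> (\<exists>s\<in>S. \<forall>z\<in>Z. s z = t z)"
    have "openin (full_shift G A) ((carrier G \<rightarrow>\<^sub>E A) - S)"
      using cl by (simp add: closedin_def topspace_full_shift)
    moreover have "t \<in> (carrier G \<rightarrow>\<^sub>E A) - S" using t by blast
    ultimately obtain Z where Z: "finite Z" "Z \<subseteq> carrier G"
      "\<And>s. s \<in> carrier G \<rightarrow>\<^sub>E A \<Longrightarrow> \<forall>z\<in>Z. s z = t z \<Longrightarrow> s \<in> (carrier G \<rightarrow>\<^sub>E A) - S"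
      by (rule openin_full_shift_cylinder) blast
    obtain s where "s \<in> S" "\<forall>z\<in>Z. s z = t z" using ex Z by blast
    then show False using Z(3) sub by blast
  qed
  ultimately show "?sub \<and> ?lim" by blast
next
  assume R: "?sub \<and> ?lim"
  have "openin (full_shift G A) ((carrier G \<rightarrow>\<^sub>E A) - S)"
  proof (subst openin_subopen, intro ballI)
    fix t assume t: "t \<in> (carrier G \<rightarrow>\<^sub>E A) - S"
    then obtain Z where Z: "finite Z" "Z \<subseteq> carrier G" "\<not> (\<exists>s\<in>S. \<forall>z\<in>Z. s z = t z)" using R by blast
    have "openin (full_shift G A) {s \<in> carrier G \<rightarrow>\<^sub>E A. \<forall>z\<in>Z. s z = t z}"
      using Z by (intro openin_full_shift_local)
    then show "\<exists>T. openin (full_shift G A) T \<and> t \<in> T \<and> T \<subseteq> (carrier G \<rightarrow>\<^sub>E A) - S"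
      using Z t by (intro exI conjI) auto
  qed
  then show "closedin (full_shift G A) S"
    using R by (simp add: closedin_def topspace_full_shift)
qed

text \<open>Each condition reads finitely many coordinates and so cuts out a closed subset of
  \<open>T\<close>; the finite intersection property applies. The alphabet is left general because
  boolean configurations will encode subsets of the group.\<close>

lemma full_shift_compactness:
  assumes fin: "finite A" and cl: "closedin (full_shift G A) T"
    and loc: "\<And>i. i \<in> R \<Longrightarrow> \<exists>Z. finite Z \<and> Z \<subseteq> carrier G \<and>
      (\<forall>s t. (\<forall>z\<in>Z. s z = t z) \<longrightarrow> \<Phi> i s \<longrightarrow> \<Phi> i t)"
    and ex: "\<And>J. finite J \<Longrightarrow> J \<subseteq> R \<Longrightarrow> \<exists>s\<in>T. \<forall>i\<in>J. \<Phi> i s"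
  shows "\<exists>s\<in>T. \<forall>i\<in>R. \<Phi> i s"
proof -
  let ?X = "full_shift G A"
  define C where "C i = {s \<in> T. \<Phi> i s}" for i
  have "compact_space ?X"
    unfolding full_shift_def compact_space_product_topology
    using fin by (simp add: compact_space_discrete_topology)
  moreover have "closedin ?X (C i)" if i: "i \<in> R" for i
  proof -
    obtain Z where Z: "finite Z" "Z \<subseteq> carrier G" "\<And>s t. (\<forall>z\<in>Z. s z = t z) \<Longrightarrow> \<Phi> i s \<Longrightarrow> \<Phi> i t"
      using loc[OF i] by blast
    have T: "T \<subseteq> carrier G \<rightarrow>\<^sub>E A" "\<And>t. t \<in> carrier G \<rightarrow>\<^sub>E A \<Longrightarrow>
      (\<And>Z. finite Z \<Longrightarrow> Z \<subseteq> carrier G \<Longrightarrow> \<exists>s\<in>T. \<forall>z\<in>Z. s z = t z) \<Longrightarrow> t \<in> T"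
      using cl unfolding closedin_full_shift_iff by blast+
    show ?thesis unfolding closedin_full_shift_iff
    proof (intro conjI ballI impI)
      fix t assume t: "t \<in> carrier G \<rightarrow>\<^sub>E A"
        and app: "\<forall>Z. finite Z \<and> Z \<subseteq> carrier G \<longrightarrow> (\<exists>s\<in>C i. \<forall>z\<in>Z. s z = t z)"
      have "t \<in> T"
      proof (rule T(2)[OF t])
        fix Z assume "finite Z" "Z \<subseteq> carrier G"
        then obtain s where "s \<in> C i" "\<forall>z\<in>Z. s z = t z" using app by blast
        then show "\<exists>s\<in>T. \<forall>z\<in>Z. s z = t z" unfolding C_def by blast
      qed
      moreover obtain s where "s \<in> C i" "\<forall>z\<in>Z. s z = t z" using app Z(1,2) by blast
      ultimately show "t \<in> C i" using Z(3)[of s t] by (simp add: C_def)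
    next
      show "C i \<subseteq> carrier G \<rightarrow>\<^sub>E A" using T(1) unfolding C_def by blast
    qed
  qed
  then have "\<forall>D\<in>insert T (C ` R). closedin ?X D" using cl by blast
  moreover have "\<Inter>\<F> \<noteq> {}" if F: "finite \<F>" "\<F> \<subseteq> insert T (C ` R)" for \<F>
  proof -
    have "finite (\<F> - {T})" "\<F> - {T} \<subseteq> C ` R" using F by auto
    then obtain J where J: "finite J" "J \<subseteq> R" "\<F> - {T} = C ` J" by (meson finite_subset_image)
    obtain s where "s \<in> T" "\<forall>i\<in>J. \<Phi> i s" using ex[OF J(1,2)] by blast
    then have "s \<in> D" if "D \<in> insert T (\<F> - {T})" for D using that unfolding J(3) C_def by blast
    then show ?thesis by blast
  qed
  ultimately have "\<Inter>(insert T (C ` R)) \<noteq> {}"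
    unfolding compact_space_fip by blast
  then show ?thesis unfolding C_def by blast
qed

lemma closedin_full_shift_limit:
  assumes "closedin (full_shift G A) S" "t \<in> carrier G \<rightarrow>\<^sub>E A"
    and "\<And>Z. finite Z \<Longrightarrow> Z \<subseteq> carrier G \<Longrightarrow> \<exists>s\<in>S. \<forall>z\<in>Z. s z = t z"
  shows "t \<in> S"
  using assms unfolding closedin_full_shift_iff by blast

lemma shifts_closed: "S \<in> shifts G A \<Longrightarrow> closedin (full_shift G A) S"
  by (simp add: shifts_def)

lemma shifts_ext: "S \<in> shifts G A \<Longrightarrow> s \<in> S \<Longrightarrow> s \<in> carrier G \<rightarrow>\<^sub>E A"
  using shifts_closed closedin_full_shift_iff by blast

lemma shifts_translate: "S \<in> shifts G A \<Longrightarrow> s \<in> S \<Longrightarrow> g \<in> carrier G \<Longrightarrow> translate G g s \<in> S"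
  by (simp add: shifts_def)

lemma agree_onD:
  assumes "agree_on W S S'" and "s' \<in> S'"
  shows "\<exists>s\<in>S. \<forall>x\<in>W. s x = s' x"
proof -
  have "restrict s' W \<in> (\<lambda>s. restrict s W) ` S" using assms by (simp add: agree_on_def)
  then obtain s where s: "s \<in> S" "restrict s' W = restrict s W" by blast
  have "s x = s' x" if "x \<in> W" for x using fun_cong[OF s(2), of x] that by simp
  then show ?thesis using s(1) by blast
qed

lemma agree_on_sym: "agree_on W S S' \<Longrightarrow> agree_on W S' S"
  by (simp add: agree_on_def)

lemma agree_on_trans: "agree_on W S S' \<Longrightarrow> agree_on W S' S'' \<Longrightarrow> agree_on W S S''"
  by (simp add: agree_on_def)

section \<open>Occurrences of patterns and gluing of many pieces\<close>

context group
begin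

text \<open>For \<open>g\<close> and \<open>P\<close> in the carrier this says that
  \<open>translate G (inv g) s\<close> agrees with \<open>p\<close> on \<open>P\<close>: acting by
  \<open>inv g\<close> brings the occurrence to the identity.\<close>

definition occ :: "('a \<Rightarrow> 'c) \<Rightarrow> ('a \<Rightarrow> 'c) \<Rightarrow> 'a set \<Rightarrow> 'a \<Rightarrow> bool"
  where "occ s p P g \<longleftrightarrow> (\<forall>x\<in>P. s (g \<otimes> x) = p x)"

text \<open>Strong irreducibility with its witness as a parameter, since later separation sets are
  computed from \<open>X\<close>.\<close>

definition gluing :: "'a set \<Rightarrow> ('a \<Rightarrow> 'c) set \<Rightarrow> bool"
  where "gluing X S \<longleftrightarrow> finite X \<and> X \<subseteq> carrier G \<and> \<one> \<in> X \<and>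
    (\<forall>E1 E2. E1 \<subseteq> carrier G \<longrightarrow> E2 \<subseteq> carrier G \<longrightarrow> (E1 <#> X) \<inter> (E2 <#> X) = {} \<longrightarrow>
        (\<forall>s1\<in>S. \<forall>s2\<in>S. \<exists>s\<in>S. restrict s E1 = restrict s1 E1 \<and> restrict s E2 = restrict s2 E2))"

lemma strongly_irreducible_iff: "strongly_irreducible G A S \<longleftrightarrow> S \<in> shifts G A \<and> (\<exists>X. gluing X S)"
  by (simp add: strongly_irreducible_def gluing_def)

lemma glue_two:
  assumes "gluing X S" "E1 \<subseteq> carrier G" "E2 \<subseteq> carrier G" "(E1 <#> X) \<inter> (E2 <#> X) = {}" "s1 \<in> S" "s2 \<in> S"
  obtains s where "s \<in> S" "\<And>x. x \<in> E1 \<Longrightarrow> s x = s1 x" "\<And>x. x \<in> E2 \<Longrightarrow> s x = s2 x"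
proof -
  obtain s where s: "s \<in> S" "restrict s E1 = restrict s1 E1" "restrict s E2 = restrict s2 E2"
    using assms unfolding gluing_def by blast
  show thesis by (rule that[OF s(1)]) (use s(2,3) in \<open>metis restrict_apply'\<close>)+
qed

lemma set_mult_iff: "g \<in> E <#> X \<longleftrightarrow> (\<exists>e\<in>E. \<exists>x\<in>X. g = e \<otimes> x)"
  by (auto simp: set_mult_def)

lemma set_multI: "e \<in> E \<Longrightarrow> x \<in> X \<Longrightarrow> e \<otimes> x \<in> E <#> X"
  by (auto simp: set_mult_def)

lemma finite_set_mult: "finite E \<Longrightarrow> finite X \<Longrightarrow> finite (E <#> X)"
  by (simp add: set_mult_def)

text \<open>Finitely many pieces are added one at a time with the same \<open>X\<close>, which keeps
  a new piece apart from the union of the old ones. Compactness passes to infinite families.\<close>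

lemma glue_family:
  assumes fin: "finite A" and S: "S \<in> shifts G A" and X: "gluing X S"
    and E: "\<And>i. i \<in> I \<Longrightarrow> E i \<subseteq> carrier G" and \<sigma>: "\<And>i. i \<in> I \<Longrightarrow> \<sigma> i \<in> S"
    and disj: "\<And>i j. i \<in> I \<Longrightarrow> j \<in> I \<Longrightarrow> i \<noteq> j \<Longrightarrow> (E i <#> X) \<inter> (E j <#> X) = {}"
  shows "\<exists>s\<in>S. \<forall>i\<in>I. \<forall>x\<in>E i. s x = \<sigma> i x"
proof -
  have fin_case: "\<exists>s\<in>S. \<forall>i\<in>J. \<forall>x\<in>E i. s x = \<sigma> i x" if "finite J" "J \<subseteq> I" for J
    using that
  proof (induction J)
    case empty
    then show ?case using S by (auto simp: shifts_def)
  next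
    case (insert j J)
    then obtain s where s: "s \<in> S" "\<forall>i\<in>J. \<forall>x\<in>E i. s x = \<sigma> i x" by blast
    have J: "j \<in> I" "J \<subseteq> I" using insert.prems by auto
    have d: "((\<Union>i\<in>J. E i) <#> X) \<inter> (E j <#> X) = {}"
    proof (rule ccontr)
      assume "\<not> ?thesis"
      then obtain g where g: "g \<in> (\<Union>i\<in>J. E i) <#> X" "g \<in> E j <#> X" by blast
      from g(1) obtain i where "i \<in> J" "g \<in> E i <#> X" unfolding set_mult_def by blast
      moreover from this have "i \<noteq> j" using insert.hyps by blast
      ultimately show False using disj[of i j] J g(2) by blast
    qed
    have c: "(\<Union>i\<in>J. E i) \<subseteq> carrier G" using E J(2) by (intro UN_least) blast
    show ?case
    proof (rule glue_two[OF X c E[OF J(1)] d s(1) \<sigma>[OF J(1)]])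
      fix s' assume s': "s' \<in> S" "\<And>x. x \<in> (\<Union>i\<in>J. E i) \<Longrightarrow> s' x = s x" "\<And>x. x \<in> E j \<Longrightarrow> s' x = \<sigma> j x"
      have "s' x = \<sigma> i x" if "i \<in> J" "x \<in> E i" for i x
        using s'(2)[of x] s(2) that by auto
      then show ?thesis using s'(1,3) by (intro bexI[of _ s']) auto
    qed
  qed
  \<comment> \<open>Conditions are indexed by points rather than by pieces: a piece may be infinite,
    while a condition may read only finitely many coordinates.\<close>
  have "\<exists>s\<in>S. \<forall>x\<in>(\<Union>i\<in>I. E i). (\<forall>i\<in>I. x \<in> E i \<longrightarrow> s x = \<sigma> i x)"
  proof (rule full_shift_compactness[OF fin shifts_closed[OF S]])
    fix x assume "x \<in> (\<Union>i\<in>I. E i)"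
    then show "\<exists>Z. finite Z \<and> Z \<subseteq> carrier G \<and> (\<forall>s t. (\<forall>z\<in>Z. s z = t z) \<longrightarrow>
        (\<forall>i\<in>I. x \<in> E i \<longrightarrow> s x = \<sigma> i x) \<longrightarrow> (\<forall>i\<in>I. x \<in> E i \<longrightarrow> t x = \<sigma> i x))"
      using E by (intro exI[of _ "{x}"]) auto
  next
    fix Z assume Z: "finite Z" "Z \<subseteq> (\<Union>i\<in>I. E i)"
    then have "\<forall>x\<in>Z. \<exists>i. i \<in> I \<and> x \<in> E i" by blast
    then obtain i where i: "\<And>x. x \<in> Z \<Longrightarrow> i x \<in> I \<and> x \<in> E (i x)" by metis
    have "finite (i ` Z)" "i ` Z \<subseteq> I" using Z i by auto
    from fin_case[OF this] obtain s where s: "s \<in> S" "\<forall>j\<in>i ` Z. \<forall>x\<in>E j. s x = \<sigma> j x" by blast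
    have "s x = \<sigma> j x" if "x \<in> Z" "j \<in> I" "x \<in> E j" for x j
    proof -
      have "x \<in> carrier G" using E[OF that(2)] that(3) by blast
      then have "x = x \<otimes> \<one>" by simp
      moreover have "\<one> \<in> X" using X by (simp add: gluing_def)
      ultimately have "x \<in> (E j <#> X)" "x \<in> (E (i x) <#> X)"
        using that(3) i[OF that(1)] unfolding set_mult_iff by blast+
      then have "j = i x" using disj[OF that(2)] i[OF that(1)] by blast
      then show ?thesis using s(2) that by blast
    qed
    then show "\<exists>s\<in>S. \<forall>x\<in>Z. \<forall>i\<in>I. x \<in> E i \<longrightarrow> s x = \<sigma> i x" using s by blast
  qed
  then show ?thesis by blast
qed

section \<open>Separated sets and maximal separated sets\<close>

definition separated :: "'a set \<Rightarrow> 'a set \<Rightarrow> bool"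
  where "separated Q M \<longleftrightarrow> M \<subseteq> carrier G \<and> (\<forall>m\<in>M. \<forall>m'\<in>M. inv m \<otimes> m' \<in> Q \<longrightarrow> m = m')"

text \<open>A net in the group: no two points are \<open>Q\<close>-close, and \<open>M Q\<close> is
  everything. Only quotients \<open>inv m \<otimes> m'\<close> enter, so left translates of nets are
  nets.\<close>

definition max_separated :: "'a set \<Rightarrow> 'a set \<Rightarrow> bool"
  where "max_separated Q M \<longleftrightarrow> separated Q M \<and> (\<forall>g\<in>carrier G. \<exists>m\<in>M. inv m \<otimes> g \<in> Q)"

lemma max_separated_carrier: "max_separated Q M \<Longrightarrow> m \<in> M \<Longrightarrow> m \<in> carrier G"
  by (auto simp: max_separated_def separated_def)

text \<open>For a maximal set from Zorn's lemma, an uncovered \<open>g\<close> could be added: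
  closure of \<open>Q\<close> under inverses handles both orders of the quotient, and
  \<open>\<one> \<in> Q\<close> shows that \<open>g\<close> was not in the set already.\<close>

lemma max_separated_extend:
  assumes one: "\<one> \<in> Q" and Q_inv: "\<And>q. q \<in> Q \<Longrightarrow> inv q \<in> Q" and M0: "separated Q M0"
  obtains M where "max_separated Q M" "M0 \<subseteq> M"
proof -
  let ?\<A> = "{M. separated Q M \<and> M0 \<subseteq> M}"
  have "\<exists>M\<in>?\<A>. \<forall>N\<in>?\<A>. M \<subseteq> N \<longrightarrow> N = M"
  proof (rule subset_Zorn_nonempty)
    show "?\<A> \<noteq> {}" using M0 by blast
    fix \<C> assume \<C>: "\<C> \<noteq> {}" "subset.chain ?\<A> \<C>"
    have "m = m'" if m: "m \<in> \<Union>\<C>" "m' \<in> \<Union>\<C>" "inv m \<otimes> m' \<in> Q" for m m'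
    proof -
      obtain D D' where D: "D \<in> \<C>" "m \<in> D" "D' \<in> \<C>" "m' \<in> D'" using m by blast
      have "D \<subseteq> D' \<or> D' \<subseteq> D" using \<C>(2) D by (auto simp: subset_chain_def)
      then obtain D'' where "D'' \<in> \<C>" "m \<in> D''" "m' \<in> D''" using D by blast
      then show ?thesis using \<C>(2) m(3) by (auto simp: subset_chain_def separated_def)
    qed
    moreover have \<C>_sub: "separated Q D" "M0 \<subseteq> D" if "D \<in> \<C>" for D
      using \<C>(2) that by (auto simp: subset_chain_def)
    have "\<Union>\<C> \<subseteq> carrier G" using \<C>_sub(1) by (intro Union_least) (simp add: separated_def)
    moreover have "M0 \<subseteq> \<Union>\<C>" using \<C>(1) \<C>_sub(2) by blast
    ultimately show "\<Union>\<C> \<in> ?\<A>" by (simp add: separated_def)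
  qed
  then obtain M where M': "M \<in> ?\<A>" "\<forall>N\<in>?\<A>. M \<subseteq> N \<longrightarrow> N = M" by (elim bexE)
  then have M: "separated Q M" "M0 \<subseteq> M" by simp_all
  have M_max: "N = M" if "separated Q N" "M \<subseteq> N" for N
    using M'(2) that M(2) by simp
  have "\<exists>m\<in>M. inv m \<otimes> g \<in> Q" if g: "g \<in> carrier G" for g
  proof (rule ccontr)
    assume no: "\<not> ?thesis"
    have MC: "m \<in> carrier G" if "m \<in> M" for m using M(1) that by (auto simp: separated_def)
    have no': "inv g \<otimes> m \<notin> Q" if "m \<in> M" for m
    proof
      assume "inv g \<otimes> m \<in> Q"
      then have "inv (inv g \<otimes> m) \<in> Q" by (rule Q_inv)
      then have "inv m \<otimes> g \<in> Q" using MC[OF that] g by (simp add: inv_mult_group)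
      then show False using no that by blast
    qed
    have "separated Q (insert g M)"
      using M(1) no no' g by (auto simp: separated_def)
    then have "insert g M = M" by (rule M_max) blast
    then have "g \<in> M" by blast
    then show False using no one g by auto
  qed
  then show thesis using that[of M] M by (simp add: max_separated_def)
qed

end

section \<open>Planting a pattern\<close>

text \<open>\<open>p\<close> is a whole configuration so that its translates can be glued, but only
  its values on \<open>P\<close> are planted. Two windows at \<open>c\<close> and \<open>c'\<close>,
  thickened by \<open>X\<close>, meet only if \<open>inv c \<otimes> c'\<close> lies in
  \<open>K\<close>. Then \<open>B_sep\<close> separates windows around the same \<open>m\<close>,
  and \<open>BKB\<close> those around different ones.\<close>

locale planting = group +
  fixes A :: "'c set" and S :: "('a \<Rightarrow> 'c) set" and p :: "'a \<Rightarrow> 'c"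
    and X P K B Q :: "'a set" and j :: nat
  assumes fin_A: "finite A" and shift: "S \<in> shifts G A" and X: "gluing X S" and p: "p \<in> S"
    and P: "finite P" "P \<subseteq> carrier G" and B: "finite B" "B \<subseteq> carrier G" "j \<le> card B"
    and Q: "finite Q" "Q \<subseteq> carrier G" "\<one> \<in> Q" and Q_inv: "\<And>q. q \<in> Q \<Longrightarrow> inv q \<in> Q"
    and windows_in_K: "\<And>x y x' y'. \<lbrakk>x \<in> P; y \<in> X; x' \<in> P; y' \<in> X\<rbrakk> \<Longrightarrow> x \<otimes> y \<otimes> inv (x' \<otimes> y') \<in> K"
    and B_sep: "\<And>b b'. \<lbrakk>b \<in> B; b' \<in> B; inv b \<otimes> b' \<in> K\<rbrakk> \<Longrightarrow> b = b'"
    and BKB: "\<And>b k b'. \<lbrakk>b \<in> B; k \<in> K; b' \<in> B\<rbrakk> \<Longrightarrow> b \<otimes> k \<otimes> inv b' \<in> Q"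
begin

definition hits :: "('a \<Rightarrow> 'c) \<Rightarrow> 'a \<Rightarrow> 'a set"
  where "hits s m = {b \<in> B. occ s p P (m \<otimes> b)}"

text \<open>Around each point \<open>m\<close> of a maximal \<open>Q\<close>-separated set, the pattern \<open>p\<close> on \<open>P\<close> is required at
  \<open>j\<close> of the places \<open>m \<otimes> b\<close>. By \<open>BKB\<close> the windows at all these places can be filled
  independently of each other.\<close>

definition planted :: "('a \<Rightarrow> 'c) set"
  where "planted = {s \<in> S. \<exists>M. max_separated Q M \<and> (\<forall>m\<in>M. j \<le> card (hits s m))}"

definition window :: "'a \<Rightarrow> 'a set"
  where "window c = (\<lambda>x. c \<otimes> x) ` P"

lemma XC: "y \<in> X \<Longrightarrow> y \<in> carrier G" and PC: "x \<in> P \<Longrightarrow> x \<in> carrier G" and BC: "b \<in> B \<Longrightarrow> b \<in> carrier G"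
  and QC: "q \<in> Q \<Longrightarrow> q \<in> carrier G" and X_fin: "finite X" and X_one: "\<one> \<in> X"
  using X P B Q by (auto simp: gluing_def)

lemma windows_disjoint:
  assumes M: "separated Q M" and m: "m \<in> M" "m' \<in> M" and b: "b \<in> B" "b' \<in> B"
    and "x \<in> P" "x' \<in> P" "y \<in> X" "y' \<in> X" and eq: "m \<otimes> b \<otimes> x \<otimes> y = m' \<otimes> b' \<otimes> x' \<otimes> y'"
  shows "m = m' \<and> b = b'"
proof -
  have mC: "m \<in> carrier G" "m' \<in> carrier G" using m M by (auto simp: separated_def)
  have k: "x \<otimes> y \<otimes> inv (x' \<otimes> y') \<in> K" using assms by (intro windows_in_K)
  have C: "m \<in> carrier G" "m' \<in> carrier G" "b \<in> carrier G" "b' \<in> carrier G" "x \<in> carrier G"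
    "x' \<in> carrier G" "y \<in> carrier G" "y' \<in> carrier G" using mC assms PC XC BC by auto
  have "inv m \<otimes> m' = b \<otimes> x \<otimes> y \<otimes> inv (m \<otimes> b \<otimes> x \<otimes> y) \<otimes> m'"
    using C by (simp add: word_simps)
  also have "\<dots> = b \<otimes> (x \<otimes> y \<otimes> inv (x' \<otimes> y')) \<otimes> inv b'"
    unfolding eq using C by (simp add: word_simps)
  finally have "inv m \<otimes> m' \<in> Q" using BKB k b by simp
  then have mm: "m = m'" using m M by (auto simp: separated_def)
  have "inv b \<otimes> b' = x \<otimes> y \<otimes> inv (m \<otimes> b \<otimes> x \<otimes> y) \<otimes> m \<otimes> b'"
    using C by (simp add: word_simps)
  also have "\<dots> = x \<otimes> y \<otimes> inv (x' \<otimes> y')"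
    unfolding eq using C by (simp add: word_simps mm)
  finally have "b = b'" using B_sep b k by simp
  with mm show ?thesis ..
qed

section \<open>Configurations with planted windows\<close>

lemma max_separated_exists: "\<exists>M. max_separated Q M \<and> M0 \<subseteq> M" if "separated Q M0"
  using max_separated_extend[OF Q(3) Q_inv that] by blast

text \<open>The source of members of \<open>planted\<close> with prescribed values. The values of
  \<open>\<sigma>\<close> on \<open>E\<close> are kept, and \<open>p\<close> is glued in wherever
  the thickened window misses that of \<open>E\<close>. The quota counts these places and those
  where \<open>\<sigma>\<close> already shows \<open>p\<close> inside \<open>E\<close>; other
  windows touching the prescribed region are given up.\<close>

lemma planted_exists:
  assumes \<sigma>: "\<sigma> \<in> S" and E: "E \<subseteq> carrier G" and M: "max_separated Q M"
    and many: "\<And>m. m \<in> M \<Longrightarrow> j \<le> card {b \<in> B. (occ \<sigma> p P (m \<otimes> b) \<and> window (m \<otimes> b) \<subseteq> E) \<or>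
      (window (m \<otimes> b) <#> X) \<inter> (E <#> X) = {}}"
  shows "\<exists>s\<in>planted. \<forall>x\<in>E. s x = \<sigma> x"
proof -
  have MC: "m \<in> carrier G" if "m \<in> M" for m using M(1) that by (rule max_separated_carrier)
  define C where "C = {m \<otimes> b |m b. m \<in> M \<and> b \<in> B \<and> (window (m \<otimes> b) <#> X) \<inter> (E <#> X) = {}}"
  have CC: "c \<in> carrier G" if "c \<in> C" for c using that MC BC by (auto simp: C_def)
  have wC: "window c \<subseteq> carrier G" if "c \<in> C" for c using CC[OF that] PC by (auto simp: window_def)
  define E' where "E' i = (case i of None \<Rightarrow> E | Some c \<Rightarrow> window c)" for i
  define \<sigma>' where "\<sigma>' i = (case i of None \<Rightarrow> \<sigma> | Some c \<Rightarrow> translate G c p)" for i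
  have disj: "(window c <#> X) \<inter> (window c' <#> X) = {}" if c: "c \<in> C" "c' \<in> C" "c \<noteq> c'" for c c'
  proof (rule ccontr)
    assume "\<not> ?thesis"
    then obtain x y x' y' where xy: "x \<in> P" "y \<in> X" "x' \<in> P" "y' \<in> X" "c \<otimes> x \<otimes> y = c' \<otimes> x' \<otimes> y'"
      unfolding window_def set_mult_def by blast
    obtain m b where mb: "m \<in> M" "b \<in> B" "c = m \<otimes> b" using c(1) unfolding C_def by blast
    obtain m' b' where mb': "m' \<in> M" "b' \<in> B" "c' = m' \<otimes> b'" using c(2) unfolding C_def by blast
    have "m = m' \<and> b = b'"
      by (rule windows_disjoint[of M m m' b b' x x' y y']) (use M mb mb' xy in \<open>simp_all add: max_separated_def\<close>)
    then show False using mb mb' c(3) by simp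
  qed
  have disj0: "(window c <#> X) \<inter> (E <#> X) = {}" if "c \<in> C" for c
    using that unfolding C_def by blast
  have "\<exists>s\<in>S. \<forall>i\<in>insert None (Some ` C). \<forall>x\<in>E' i. s x = \<sigma>' i x"
  proof (rule glue_family[OF fin_A shift X])
    show "E' i \<subseteq> carrier G" if "i \<in> insert None (Some ` C)" for i
      using that E wC by (elim insertE imageE) (simp_all add: E'_def)
    show "\<sigma>' i \<in> S" if "i \<in> insert None (Some ` C)" for i
      using that \<sigma> shifts_translate[OF shift p CC] by (elim insertE imageE) (simp_all add: \<sigma>'_def)
    show "(E' i <#> X) \<inter> (E' k <#> X) = {}"
      if "i \<in> insert None (Some ` C)" "k \<in> insert None (Some ` C)" "i \<noteq> k" for i k
      using that disj disj0 by (elim insertE imageE) (simp_all add: E'_def Int_commute)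
  qed
  then obtain s where s: "s \<in> S" and s_eq: "\<forall>i\<in>insert None (Some ` C). \<forall>x\<in>E' i. s x = \<sigma>' i x" by (elim bexE)
  have sE: "s x = \<sigma> x" if "x \<in> E" for x using s_eq that by (simp add: E'_def \<sigma>'_def)
  have sC: "occ s p P c" if c: "c \<in> C" for c
    unfolding occ_def
  proof
    fix x assume x: "x \<in> P"
    have "s (c \<otimes> x) = translate G c p (c \<otimes> x)"
      using s_eq c x by (simp add: E'_def \<sigma>'_def window_def)
    also have "\<dots> = p x" using CC[OF c] PC[OF x] by (simp add: translate_def word_simps)
    finally show "s (c \<otimes> x) = p x" .
  qed
  have "j \<le> card (hits s m)" if m: "m \<in> M" for m
  proof -
    have "{b \<in> B. (occ \<sigma> p P (m \<otimes> b) \<and> window (m \<otimes> b) \<subseteq> E) \<or>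
      (window (m \<otimes> b) <#> X) \<inter> (E <#> X) = {}} \<subseteq> hits s m"
    proof (clarify)
      fix b assume b: "b \<in> B"
        "(occ \<sigma> p P (m \<otimes> b) \<and> window (m \<otimes> b) \<subseteq> E) \<or> (window (m \<otimes> b) <#> X) \<inter> (E <#> X) = {}"
      from b(2) have "occ s p P (m \<otimes> b)"
      proof
        assume "occ \<sigma> p P (m \<otimes> b) \<and> window (m \<otimes> b) \<subseteq> E"
        then show ?thesis using sE unfolding occ_def window_def by auto
      next
        assume "(window (m \<otimes> b) <#> X) \<inter> (E <#> X) = {}"
        then have "m \<otimes> b \<in> C" using m b(1) unfolding C_def by blast
        then show ?thesis by (rule sC)
      qed
      then show "b \<in> hits s m" using b(1) by (simp add: hits_def)
    qed
    then have "card {b \<in> B. (occ \<sigma> p P (m \<otimes> b) \<and> window (m \<otimes> b) \<subseteq> E) \<or>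
      (window (m \<otimes> b) <#> X) \<inter> (E <#> X) = {}} \<le> card (hits s m)"
      using B(1) by (intro card_mono) (simp_all add: hits_def)
    then show ?thesis using many[OF m] by simp
  qed
  then have "s \<in> planted" using s M unfolding planted_def by blast
  then show ?thesis using sE by blast
qed

section \<open>The planted configurations form a strongly irreducible shift\<close>

lemma planted_nonempty: "planted \<noteq> {}"
proof -
  obtain M where M: "max_separated Q M"
    using max_separated_exists[of "{}"] by (auto simp: separated_def)
  have "{b \<in> B. (occ p p P (m \<otimes> b) \<and> window (m \<otimes> b) \<subseteq> {}) \<or>
      (window (m \<otimes> b) <#> X) \<inter> ({} <#> X) = {}} = B" for m
    by (auto simp: set_mult_def)
  then have "\<exists>s\<in>planted. \<forall>x\<in>{}. s x = p x"
    using B(3) by (intro planted_exists[OF p _ M]) auto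
  then show ?thesis by blast
qed

lemma planted_translate:
  assumes s: "s \<in> planted" and g: "g \<in> carrier G"
  shows "translate G g s \<in> planted"
proof -
  obtain M where M: "max_separated Q M" "\<And>m. m \<in> M \<Longrightarrow> j \<le> card (hits s m)" and sS: "s \<in> S"
    using s unfolding planted_def by blast
  have MC: "m \<in> carrier G" if "m \<in> M" for m using M(1) that by (rule max_separated_carrier)
  have [simp]: "inv (g \<otimes> m) \<otimes> (g \<otimes> m') = inv m \<otimes> m'" if "m \<in> carrier G" "m' \<in> carrier G" for m m'
    using that g by (simp add: word_simps)
  have "max_separated Q ((\<lambda>m. g \<otimes> m) ` M)"
    unfolding max_separated_def separated_def
  proof (intro conjI ballI impI)
    fix n n' assume "n \<in> (\<lambda>m. g \<otimes> m) ` M" "n' \<in> (\<lambda>m. g \<otimes> m) ` M" "inv n \<otimes> n' \<in> Q"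
    then obtain m m' where m: "m \<in> M" "m' \<in> M" "n = g \<otimes> m" "n' = g \<otimes> m'" "inv (g \<otimes> m) \<otimes> (g \<otimes> m') \<in> Q"
      by blast
    then have "inv m \<otimes> m' \<in> Q" using MC by simp
    then have "m = m'" using M(1) m(1,2) unfolding max_separated_def separated_def by blast
    then show "n = n'" using m by simp
  next
    fix h assume h: "h \<in> carrier G"
    then have "inv g \<otimes> h \<in> carrier G" using g by simp
    then obtain m where m: "m \<in> M" "inv m \<otimes> (inv g \<otimes> h) \<in> Q"
      using M(1) unfolding max_separated_def by blast
    then have "inv (g \<otimes> m) \<otimes> h \<in> Q" using g h MC by (simp add: word_simps)
    then show "\<exists>n\<in>(\<lambda>m. g \<otimes> m) ` M. inv n \<otimes> h \<in> Q" using m by blast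
  qed (use MC g in auto)
  moreover have "hits (translate G g s) (g \<otimes> m) = hits s m" if "m \<in> M" for m
    using MC[OF that] g BC PC unfolding hits_def occ_def
    by (intro Collect_cong conj_cong refl ball_cong) (simp add: translate_def word_simps)
  ultimately show ?thesis
    using shifts_translate[OF shift sS g] M(2) unfolding planted_def by auto
qed

text \<open>The set \<open>M\<close> varies with the approximating configurations, so a limit of
  these sets is needed. \<open>M\<close> is encoded by its indicator \<open>\<mu>\<close>, and
  compactness of the boolean configurations supplies the limit.\<close>

lemma planted_closed: "closedin (full_shift G A) planted"
  unfolding closedin_full_shift_iff
proof (intro conjI ballI impI)
  show "planted \<subseteq> carrier G \<rightarrow>\<^sub>E A" using shifts_ext[OF shift] by (auto simp: planted_def)
  fix t assume t: "t \<in> carrier G \<rightarrow>\<^sub>E A"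
    and app: "\<forall>Z. finite Z \<and> Z \<subseteq> carrier G \<longrightarrow> (\<exists>s\<in>planted. \<forall>z\<in>Z. s z = t z)"
  have "\<exists>s\<in>S. \<forall>z\<in>Z. s z = t z" if "finite Z" "Z \<subseteq> carrier G" for Z
    using app that unfolding planted_def by blast
  then have tS: "t \<in> S" by (rule closedin_full_shift_limit[OF shifts_closed[OF shift] t])
  \<comment> \<open>The properties of \<open>M\<close> localised at \<open>g\<close>. The quota is
    that of the limit \<open>t\<close>, so \<open>\<Phi> g\<close> reads only the values of
    \<open>\<mu>\<close> at \<open>g\<close> and on \<open>g Q\<close>.\<close>
  define \<Phi> where "\<Phi> g \<mu> \<longleftrightarrow> (\<forall>q\<in>Q. \<mu> g \<and> \<mu> (g \<otimes> q) \<longrightarrow> g = g \<otimes> q) \<and> (\<exists>q\<in>Q. \<mu> (g \<otimes> inv q)) \<and>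
    (\<mu> g \<longrightarrow> j \<le> card (hits t g))" for g and \<mu> :: "'a \<Rightarrow> bool"
  have "\<exists>\<mu>\<in>carrier G \<rightarrow>\<^sub>E UNIV. \<forall>g\<in>carrier G. \<Phi> g \<mu>"
  proof (rule full_shift_compactness[where A = "UNIV :: bool set"])
    show "closedin (full_shift G (UNIV :: bool set)) (carrier G \<rightarrow>\<^sub>E UNIV)"
      by (metis closedin_topspace topspace_full_shift)
    fix g assume g: "g \<in> carrier G"
    let ?Z = "insert g ((\<lambda>q. g \<otimes> q) ` Q)"
    have "finite ?Z" "?Z \<subseteq> carrier G" using Q(1,2) g by auto
    moreover have "\<Phi> g \<nu>" if "\<forall>z\<in>?Z. \<mu> z = \<nu> z" "\<Phi> g \<mu>" for \<mu> \<nu>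
    proof -
      have "\<mu> g = \<nu> g" "\<And>q. q \<in> Q \<Longrightarrow> \<mu> (g \<otimes> q) = \<nu> (g \<otimes> q)"
        "\<And>q. q \<in> Q \<Longrightarrow> \<mu> (g \<otimes> inv q) = \<nu> (g \<otimes> inv q)" using that(1) Q_inv by auto
      then show ?thesis using that(2) unfolding \<Phi>_def by auto
    qed
    ultimately show "\<exists>Z. finite Z \<and> Z \<subseteq> carrier G \<and> (\<forall>\<mu> \<nu>. (\<forall>z\<in>Z. \<mu> z = \<nu> z) \<longrightarrow> \<Phi> g \<mu> \<longrightarrow> \<Phi> g \<nu>)"
      by (intro exI[of _ ?Z]) simp
  next
    fix J assume J: "finite J" "J \<subseteq> carrier G"
    \<comment> \<open>On these coordinates \<open>s\<close> agrees with \<open>t\<close>, so both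
      have the same hits at every \<open>g\<close> in \<open>J\<close>.\<close>
    let ?Z = "(\<lambda>(g, b, x). g \<otimes> b \<otimes> x) ` (J \<times> B \<times> P)"
    have "finite ?Z" "?Z \<subseteq> carrier G" using J B P BC PC by auto
    then obtain s where s: "s \<in> planted" "\<forall>z\<in>?Z. s z = t z" using app by blast
    obtain M where M: "max_separated Q M" "\<And>m. m \<in> M \<Longrightarrow> j \<le> card (hits s m)"
      using s(1) unfolding planted_def by blast
    have MC: "m \<in> carrier G" if "m \<in> M" for m using M(1) that by (rule max_separated_carrier)
    let ?\<mu> = "\<lambda>g\<in>carrier G. g \<in> M"
    have "\<Phi> g ?\<mu>" if g: "g \<in> J" for g
      unfolding \<Phi>_def
    proof (intro conjI ballI impI)
      have gC: "g \<in> carrier G" using g J by blast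
      {
        fix q assume q: "q \<in> Q" "?\<mu> g \<and> ?\<mu> (g \<otimes> q)"
        then have "g \<in> M" "g \<otimes> q \<in> M" "inv g \<otimes> (g \<otimes> q) \<in> Q"
          using gC QC by (auto simp: word_simps)
        then show "g = g \<otimes> q" using M(1) unfolding max_separated_def separated_def by blast
      next
        obtain m where m: "m \<in> M" "inv m \<otimes> g \<in> Q" using M(1) gC unfolding max_separated_def by blast
        moreover have "g \<otimes> inv (inv m \<otimes> g) = m" using MC[OF m(1)] gC by (simp add: word_simps)
        ultimately show "\<exists>q\<in>Q. ?\<mu> (g \<otimes> inv q)" using MC by (intro bexI[of _ "inv m \<otimes> g"]) auto
      next
        assume "?\<mu> g"
        then have "g \<in> M" using gC by simp
        moreover have "hits t g = hits s g"
          using s(2) g unfolding hits_def occ_def by (auto simp: image_iff)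
        ultimately show "j \<le> card (hits t g)" using M(2) by simp
      }
    qed
    then show "\<exists>\<mu>\<in>carrier G \<rightarrow>\<^sub>E UNIV. \<forall>g\<in>J. \<Phi> g \<mu>" by (intro bexI[of _ ?\<mu>]) auto
  qed simp
  then obtain \<mu> where \<mu>: "\<And>g. g \<in> carrier G \<Longrightarrow> \<Phi> g \<mu>" by blast
  define M where "M = {g \<in> carrier G. \<mu> g}"
  have "max_separated Q M"
    unfolding max_separated_def separated_def
  proof (intro conjI ballI impI)
    fix m m' assume m: "m \<in> M" "m' \<in> M" "inv m \<otimes> m' \<in> Q"
    have C: "m \<in> carrier G" "m' \<in> carrier G" using m by (auto simp: M_def)
    have "m' = m \<otimes> (inv m \<otimes> m')" using C by (simp add: word_simps)
    then show "m = m'" using \<mu>[OF C(1)] m unfolding \<Phi>_def M_def by auto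
  next
    fix g assume g: "g \<in> carrier G"
    then obtain q where q: "q \<in> Q" "\<mu> (g \<otimes> inv q)" using \<mu> unfolding \<Phi>_def by blast
    have "inv (g \<otimes> inv q) \<otimes> g = q" using g QC[OF q(1)] by (simp add: word_simps)
    then show "\<exists>m\<in>M. inv m \<otimes> g \<in> Q" using q g QC by (intro bexI[of _ "g \<otimes> inv q"]) (auto simp: M_def)
  qed (auto simp: M_def)
  moreover have "j \<le> card (hits t m)" if "m \<in> M" for m
    using that \<mu> unfolding M_def \<Phi>_def by blast
  ultimately show "t \<in> planted" using tS unfolding planted_def by blast
qed

lemma planted_shift: "planted \<in> shifts G A"
  using planted_closed planted_translate planted_nonempty by (simp add: shifts_def)

text \<open>The obstacle is that \<open>s1\<close> and \<open>s2\<close> meet their quotas around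
  unrelated sets \<open>M1\<close> and \<open>M2\<close>. The points of \<open>M1\<close> near
  \<open>E1\<close> and of \<open>M2\<close> near \<open>E2\<close> are combined and extended to a
  maximal separated set. Close to \<open>E1\<close> that set has only points of \<open>M1\<close>,
  so the hits of \<open>s1\<close> can be copied, and likewise for \<open>E2\<close>; away from both
  all windows are free.\<close>

lemma planted_gluing: "\<exists>Y. gluing Y planted"
proof -
  \<comment> \<open>For \<open>m\<close> and \<open>E\<close> in the carrier, \<open>m\<close> lies
    in \<open>E <#> Z\<close> exactly when some thickened window at \<open>m \<otimes> b\<close>
    meets \<open>E <#> X\<close>. In \<open>Y\<close>, the part with \<open>Q <#> Q\<close> keeps
    the selected points of \<open>M1\<close> and \<open>M2\<close> apart, and the last part the
    windows around them.\<close>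
  define Z where "Z = (\<lambda>(y, y', x, b). y \<otimes> inv y' \<otimes> inv x \<otimes> inv b) ` (X \<times> X \<times> P \<times> B)"
  define Y where "Y = X \<union> (Z <#> Q <#> Q) \<union> (Z <#> B <#> P <#> X)"
  have Z: "finite Z" "Z \<subseteq> carrier G" using X_fin P B XC PC BC by (auto simp: Z_def)
  have XsubC: "X \<subseteq> carrier G" using XC by blast
  have Y: "finite Y" "Y \<subseteq> carrier G" "\<one> \<in> Y"
    using Z X_fin X_one XsubC P B Q by (auto simp: Y_def intro!: finite_set_mult dest!: set_mult_closed[THEN subsetD, rotated 2])
  have XY: "y \<in> Y" if "y \<in> X" for y using that by (simp add: Y_def)
  have ZQQ: "z \<otimes> q \<otimes> q' \<in> Y" if "z \<in> Z" "q \<in> Q" "q' \<in> Q" for z q q'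
    using that by (simp add: Y_def set_multI)
  have ZBPX: "z \<otimes> b \<otimes> x \<otimes> y \<in> Y" if "z \<in> Z" "b \<in> B" "x \<in> P" "y \<in> X" for z b x y
    using that by (simp add: Y_def set_multI)
  have ZC: "z \<in> carrier G" if "z \<in> Z" for z using Z that by blast
  have "\<exists>s\<in>planted. restrict s E1 = restrict s1 E1 \<and> restrict s E2 = restrict s2 E2"
    if E: "E1 \<subseteq> carrier G" "E2 \<subseteq> carrier G" and disj: "(E1 <#> Y) \<inter> (E2 <#> Y) = {}"
      and s12: "s1 \<in> planted" "s2 \<in> planted" for E1 E2 s1 s2
  proof -
    obtain M1 where M1: "max_separated Q M1" "\<And>m. m \<in> M1 \<Longrightarrow> j \<le> card (hits s1 m)" and s1: "s1 \<in> S"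
      using s12(1) unfolding planted_def by blast
    obtain M2 where M2: "max_separated Q M2" "\<And>m. m \<in> M2 \<Longrightarrow> j \<le> card (hits s2 m)" and s2: "s2 \<in> S"
      using s12(2) unfolding planted_def by blast
    have sep: "separated Q M1" "separated Q M2" using M1 M2 by (simp_all add: max_separated_def)
    have MC1: "m \<in> carrier G" if "m \<in> M1" for m using that sep by (auto simp: separated_def)
    have MC2: "m \<in> carrier G" if "m \<in> M2" for m using that sep by (auto simp: separated_def)
    have EC: "e \<in> E1 \<Longrightarrow> e \<in> carrier G" "e \<in> E2 \<Longrightarrow> e \<in> carrier G" for e using E by blast+
    have far: "e \<otimes> y \<noteq> e' \<otimes> y'" if "e \<in> E1" "e' \<in> E2" "y \<in> Y" "y' \<in> Y" for e e' y y'
    proof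
      assume "e \<otimes> y = e' \<otimes> y'"
      then have "e \<otimes> y \<in> (E1 <#> Y) \<inter> (E2 <#> Y)" using that set_multI[of e E1 y Y] set_multI[of e' E2 y' Y] by simp
      then show False using disj by blast
    qed
    \<comment> \<open>The additional \<open>Q\<close> is for a point \<open>m\<close> of the final
      set in \<open>E1 <#> Z\<close>: the point of \<open>M1\<close> covering \<open>m\<close> then
      belongs to \<open>N1\<close>, hence to the final set, and by separatedness it equals
      \<open>m\<close>.\<close>
    define N1 where "N1 = {m \<in> M1. m \<in> E1 <#> Z <#> Q}"
    define N2 where "N2 = {m \<in> M2. m \<in> E2 <#> Z <#> Q}"
    have no_conflict: "inv m \<otimes> m' \<notin> Q" if m: "m \<in> N1" "m' \<in> N2" for m m'
    proof
      assume q: "inv m \<otimes> m' \<in> Q"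
      obtain e z q1 where m1: "e \<in> E1" "z \<in> Z" "q1 \<in> Q" "m = e \<otimes> z \<otimes> q1"
        using m(1) by (auto simp: N1_def set_mult_iff)
      obtain e' z' q2 where m2: "e' \<in> E2" "z' \<in> Z" "q2 \<in> Q" "m' = e' \<otimes> z' \<otimes> q2"
        using m(2) by (auto simp: N2_def set_mult_iff)
      have C: "e \<in> carrier G" "z \<in> carrier G" "q1 \<in> carrier G" "e' \<in> carrier G" "z' \<in> carrier G" "q2 \<in> carrier G"
        "m \<in> carrier G" "m' \<in> carrier G"
        using m1 m2 EC ZC QC m MC1 MC2 by (auto simp: N1_def N2_def)
      have "e \<otimes> (z \<otimes> q1 \<otimes> (inv m \<otimes> m')) = (e \<otimes> z \<otimes> q1) \<otimes> (inv m \<otimes> m')"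
        using C by (simp add: m_assoc)
      also have "\<dots> = m'" unfolding m1(4)[symmetric] using C by (simp add: word_simps)
      also have "\<dots> = e' \<otimes> (z' \<otimes> q2 \<otimes> \<one>)" using C(4-6) by (simp add: m2(4) m_assoc)
      finally show False using far[OF m1(1) m2(1) ZQQ[OF m1(2,3) q] ZQQ[OF m2(2,3) Q(3)]] by simp
    qed
    have NC: "m \<in> carrier G" if "m \<in> N1 \<or> m \<in> N2" for m using that MC1 MC2 by (auto simp: N1_def N2_def)
    have no_conflict': "inv m' \<otimes> m \<notin> Q" if m: "m \<in> N1" "m' \<in> N2" for m m'
    proof
      assume "inv m' \<otimes> m \<in> Q"
      then have "inv (inv m' \<otimes> m) \<in> Q" by (rule Q_inv)
      then have "inv m \<otimes> m' \<in> Q" using NC m by (simp add: inv_mult_group)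
      then show False using no_conflict m by blast
    qed
    have "separated Q (N1 \<union> N2)"
      unfolding separated_def
    proof (intro conjI ballI impI)
      show "N1 \<union> N2 \<subseteq> carrier G" using NC by blast
      fix m m' assume m: "m \<in> N1 \<union> N2" "m' \<in> N1 \<union> N2" "inv m \<otimes> m' \<in> Q"
      then consider "m \<in> N1" "m' \<in> N1" | "m \<in> N2" "m' \<in> N2" using no_conflict no_conflict' by blast
      then show "m = m'"
      proof cases
        case 1
        then show ?thesis using sep(1) m(3) by (simp add: separated_def N1_def)
      next
        case 2
        then show ?thesis using sep(2) m(3) by (simp add: separated_def N2_def)
      qed
    qed
    then obtain M where M: "max_separated Q M" "N1 \<union> N2 \<subseteq> M" using max_separated_exists by blast
    have MC: "m \<in> carrier G" if "m \<in> M" for m using M(1) that by (rule max_separated_carrier)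
    have near: "m \<in> Mi" if m: "m \<in> M" "m \<in> Ei <#> Z" and Mi: "max_separated Q Mi"
      "{m \<in> Mi. m \<in> Ei <#> Z <#> Q} \<subseteq> M" for m Mi Ei
    proof -
      have mC: "m \<in> carrier G" using MC m by blast
      then obtain m1 where m1: "m1 \<in> Mi" "inv m1 \<otimes> m \<in> Q" using Mi(1) unfolding max_separated_def by blast
      have m1C: "m1 \<in> carrier G" using m1 Mi(1) by (auto simp: max_separated_def separated_def)
      have "m1 = m \<otimes> inv (inv m1 \<otimes> m)" using mC m1C by (simp add: word_simps)
      then have "m1 \<in> Ei <#> Z <#> Q" using set_multI[OF m(2) Q_inv[OF m1(2)]] by simp
      then have "m1 \<in> M" using m1(1) Mi(2) by blast
      then have "m1 = m" using m(1) m1(2) M(1) unfolding max_separated_def separated_def by blast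
      then show ?thesis using m1 by simp
    qed
    have near1: "m \<in> M1" if "m \<in> M" "m \<in> E1 <#> Z" for m
      by (rule near[OF that M1(1)]) (use M(2) in \<open>simp add: N1_def\<close>)
    have near2: "m \<in> M2" if "m \<in> M" "m \<in> E2 <#> Z" for m
      by (rule near[OF that M2(1)]) (use M(2) in \<open>simp add: N2_def\<close>)
    have sub_N: "m \<in> E <#> Z <#> Q" if "m \<in> E <#> Z" "m \<in> carrier G" for m E
    proof -
      have "m = m \<otimes> \<one>" using that by simp
      then show ?thesis using set_multI[OF that(1) Q(3)] by simp
    qed
    \<comment> \<open>Complete windows around the nearby points of \<open>M1\<close> are added to
      \<open>E1\<close>, so that no hit of \<open>s1\<close> around them is cut by the boundary of
      the prescribed region.\<close>
    define R1 where "R1 = E1 \<union> {m \<otimes> b \<otimes> x |m b x. m \<in> M1 \<and> m \<in> E1 <#> Z \<and> b \<in> B \<and> x \<in> P}"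
    define R2 where "R2 = E2 \<union> {m \<otimes> b \<otimes> x |m b x. m \<in> M2 \<and> m \<in> E2 <#> Z \<and> b \<in> B \<and> x \<in> P}"
    have R: "R1 \<subseteq> carrier G" "R2 \<subseteq> carrier G"
      using E MC1 MC2 BC PC unfolding R1_def R2_def by auto
    have RX: "g \<in> Ei <#> Y" if g: "g \<in> (Ei \<union> {m \<otimes> b \<otimes> x |m b x. m \<in> Mi \<and> m \<in> Ei <#> Z \<and> b \<in> B \<and> x \<in> P}) <#> X"
      and Ei: "Ei \<subseteq> carrier G" for g Ei Mi
    proof -
      obtain r y where r: "r \<in> Ei \<union> {m \<otimes> b \<otimes> x |m b x. m \<in> Mi \<and> m \<in> Ei <#> Z \<and> b \<in> B \<and> x \<in> P}" "y \<in> X" "g = r \<otimes> y"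
        using g unfolding set_mult_iff by blast
      from r(1) show ?thesis
      proof
        assume "r \<in> Ei"
        then show ?thesis using r(2,3) XY by (simp add: set_multI)
      next
        assume "r \<in> {m \<otimes> b \<otimes> x |m b x. m \<in> Mi \<and> m \<in> Ei <#> Z \<and> b \<in> B \<and> x \<in> P}"
        then obtain m b x where m: "r = m \<otimes> b \<otimes> x" "m \<in> Ei <#> Z" "b \<in> B" "x \<in> P" by blast
        then obtain e z where e: "e \<in> Ei" "z \<in> Z" "m = e \<otimes> z" unfolding set_mult_def by blast
        have "e \<in> carrier G" using e Ei by blast
        then have "g = e \<otimes> (z \<otimes> b \<otimes> x \<otimes> y)" using r m e ZC BC PC XC by (simp add: m_assoc)
        then show ?thesis using set_multI[OF e(1) ZBPX[OF e(2) m(3,4) r(2)]] by simp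
      qed
    qed
    have "(R1 <#> X) \<inter> (R2 <#> X) = {}"
      using disj RX[OF _ E(1), of _ M1] RX[OF _ E(2), of _ M2] unfolding R1_def R2_def by blast
    then obtain \<sigma> where \<sigma>: "\<sigma> \<in> S" "\<And>x. x \<in> R1 \<Longrightarrow> \<sigma> x = s1 x" "\<And>x. x \<in> R2 \<Longrightarrow> \<sigma> x = s2 x"
      by (rule glue_two[OF X R _ s1 s2]) blast
    have hit: "hits si m \<subseteq> {b \<in> B. (occ \<sigma> p P (m \<otimes> b) \<and> window (m \<otimes> b) \<subseteq> R1 \<union> R2) \<or> D b}"
      if "\<And>b x. b \<in> B \<Longrightarrow> x \<in> P \<Longrightarrow> m \<otimes> b \<otimes> x \<in> R1 \<union> R2 \<and> \<sigma> (m \<otimes> b \<otimes> x) = si (m \<otimes> b \<otimes> x)" for si m D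
      using that unfolding hits_def occ_def window_def by auto
    have "\<exists>s\<in>planted. \<forall>x\<in>R1 \<union> R2. s x = \<sigma> x"
    proof (rule planted_exists[OF \<sigma>(1) _ M(1)])
      show "R1 \<union> R2 \<subseteq> carrier G" using R by blast
      fix m assume m: "m \<in> M"
      let ?D = "\<lambda>b. (window (m \<otimes> b) <#> X) \<inter> ((R1 \<union> R2) <#> X) = {}"
      let ?H = "{b \<in> B. (occ \<sigma> p P (m \<otimes> b) \<and> window (m \<otimes> b) \<subseteq> R1 \<union> R2) \<or> ?D b}"
      have finH: "finite ?H" using B(1) by simp
      consider "m \<in> E1 <#> Z" | "m \<in> E2 <#> Z" | "m \<notin> E1 <#> Z" "m \<notin> E2 <#> Z" by blast
      then show "j \<le> card ?H"
      proof cases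
        case 1
        then have "m \<in> M1" using near1 m by blast
        have "m \<otimes> b \<otimes> x \<in> R1" if "b \<in> B" "x \<in> P" for b x
          using that 1 \<open>m \<in> M1\<close> unfolding R1_def by blast
        then have "hits s1 m \<subseteq> ?H" using \<sigma>(2) by (intro hit) blast
        then have "card (hits s1 m) \<le> card ?H" by (rule card_mono[OF finH])
        then show ?thesis using M1(2)[OF \<open>m \<in> M1\<close>] by simp
      next
        case 2
        then have "m \<in> M2" using near2 m by blast
        have "m \<otimes> b \<otimes> x \<in> R2" if "b \<in> B" "x \<in> P" for b x
          using that 2 \<open>m \<in> M2\<close> unfolding R2_def by blast
        then have "hits s2 m \<subseteq> ?H" using \<sigma>(3) by (intro hit) blast
        then have "card (hits s2 m) \<le> card ?H" by (rule card_mono[OF finH])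
        then show ?thesis using M2(2)[OF \<open>m \<in> M2\<close>] by simp
      next
        case 3
        have far_E: False if e: "e \<in> Ei" "e \<in> carrier G" "m \<notin> Ei <#> Z" "b \<in> B" "x \<in> P" "y \<in> X" "y' \<in> X"
          "m \<otimes> b \<otimes> x \<otimes> y = e \<otimes> y'" for e Ei b x y y'
        proof -
          have "m = m \<otimes> b \<otimes> x \<otimes> y \<otimes> inv y \<otimes> inv x \<otimes> inv b" using e(1-7) MC[OF m] BC PC XC by (simp add: word_simps)
          also have "\<dots> = e \<otimes> (y' \<otimes> inv y \<otimes> inv x \<otimes> inv b)"
            unfolding e(8) using e(1-7) BC PC XC by (simp add: m_assoc)
          finally have "m = e \<otimes> (y' \<otimes> inv y \<otimes> inv x \<otimes> inv b)" .
          moreover have "y' \<otimes> inv y \<otimes> inv x \<otimes> inv b \<in> Z"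
            unfolding Z_def by (rule image_eqI[of _ _ "(y', y, x, b)"]) (use e in auto)
          ultimately show False using e(3) set_multI[OF e(1)] by metis
        qed
        have "?D b" if b: "b \<in> B" for b
        proof (rule ccontr)
          assume "\<not> ?D b"
          then obtain u where u: "u \<in> window (m \<otimes> b) <#> X" "u \<in> (R1 \<union> R2) <#> X" by blast
          obtain x y where xy1: "x \<in> P" "y \<in> X" "u = m \<otimes> b \<otimes> x \<otimes> y"
            using u(1) unfolding window_def set_mult_iff by blast
          obtain r y' where "r \<in> R1 \<union> R2" "y' \<in> X" "u = r \<otimes> y'"
            using u(2) unfolding set_mult_iff by blast
          note xy = xy1(1,2) this(1,2) xy1(3)[unfolded this(3), symmetric]
          from xy(3) consider "r \<in> E1" | "r \<in> E2"
            | m' b' x' where "r = m' \<otimes> b' \<otimes> x'" "m' \<in> M1" "m' \<in> E1 <#> Z" "b' \<in> B" "x' \<in> P"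
            | m' b' x' where "r = m' \<otimes> b' \<otimes> x'" "m' \<in> M2" "m' \<in> E2 <#> Z" "b' \<in> B" "x' \<in> P"
            unfolding R1_def R2_def by blast
          then show False
          proof cases
            case 1
            then show False using far_E[OF 1 EC(1)[OF 1] 3(1) b xy(1,2,4,5)] by simp
          next
            case 2
            then show False using far_E[OF 2 EC(2)[OF 2] 3(2) b xy(1,2,4,5)] by simp
          next
            case w: 3
            have "m' \<in> M" using w(2,3) sub_N[OF w(3) MC1[OF w(2)]] M(2) unfolding N1_def by blast
            have "m = m' \<and> b = b'"
              by (rule windows_disjoint[of M m m' b b' x x' y y'])
                (use M(1) m \<open>m' \<in> M\<close> w b xy in \<open>simp_all add: max_separated_def\<close>)
            then show False using w(3) 3(1) by simp
          next
            case w: 4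
            have "m' \<in> M" using w(2,3) sub_N[OF w(3) MC2[OF w(2)]] M(2) unfolding N2_def by blast
            have "m = m' \<and> b = b'"
              by (rule windows_disjoint[of M m m' b b' x x' y y'])
                (use M(1) m \<open>m' \<in> M\<close> w b xy in \<open>simp_all add: max_separated_def\<close>)
            then show False using w(3) 3(2) by simp
          qed
        qed
        then have "?H = B" by blast
        then show ?thesis using B(3) by simp
      qed
    qed
    then obtain s where s: "s \<in> planted" "\<forall>x\<in>R1 \<union> R2. s x = \<sigma> x" by (elim bexE)
    have "s x = s1 x" if "x \<in> E1" for x using s(2) \<sigma>(2) that by (simp add: R1_def)
    moreover have "s x = s2 x" if "x \<in> E2" for x using s(2) \<sigma>(3) that by (simp add: R2_def)
    ultimately have "restrict s E1 = restrict s1 E1" "restrict s E2 = restrict s2 E2"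
      by (auto intro: restrict_ext)
    then show ?thesis using s(1) by blast
  qed
  then have "gluing Y planted" unfolding gluing_def using Y by blast
  then show ?thesis ..
qed

lemma planted_strongly_irreducible: "strongly_irreducible G A planted"
  using planted_shift planted_gluing by (simp add: strongly_irreducible_iff)

lemma planted_subset: "planted \<subseteq> S"
  by (auto simp: planted_def)

end

section \<open>Joint recurrence\<close>

context group
begin

section \<open>Forcing and collecting patterns\<close>

lemma agree_onI:
  assumes "S' \<subseteq> S" and "\<And>\<sigma>. \<sigma> \<in> S \<Longrightarrow> \<exists>s\<in>S'. \<forall>x\<in>W. s x = \<sigma> x"
  shows "agree_on W S S'"
proof -
  have "restrict \<sigma> W \<in> (\<lambda>s. restrict s W) ` S'" if \<sigma>: "\<sigma> \<in> S" for \<sigma>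
  proof -
    obtain s where s: "s \<in> S'" "\<forall>x\<in>W. s x = \<sigma> x" using assms(2)[OF \<sigma>] by blast
    have "restrict \<sigma> W = restrict s W" using s(2) by (intro restrict_ext) simp
    then show ?thesis using s(1) by blast
  qed
  then show ?thesis using assms(1) unfolding agree_on_def by blast
qed

text \<open>Planting with \<open>B = {\<one>}\<close> and quota 1 puts \<open>p\<close> into every
  configuration at a bounded distance. To keep all patterns on \<open>W\<close>, a set
  \<open>M\<close> is needed that avoids the set \<open>Z\<close> of places where a window
  interferes with \<open>W\<close>. One point \<open>h\<close> outside \<open>Z\<close> achieves
  this: \<open>Q\<close> contains all \<open>inv h \<otimes> z\<close> with
  \<open>z \<in> Z\<close>, so no separated set containing \<open>h\<close> meets
  \<open>Z\<close>.\<close>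

lemma embed_pattern:
  assumes inf: "infinite (carrier G)" and A: "finite A" and S: "S \<in> shifts G A" and X: "gluing X S"
    and p: "p \<in> S" and P: "finite P" "P \<subseteq> carrier G" and W: "finite W" "W \<subseteq> carrier G"
  obtains S' Q where "strongly_irreducible G A S'" "S' \<subseteq> S" "agree_on W S S'"
    "finite Q" "Q \<subseteq> carrier G" "\<forall>s\<in>S'. \<exists>w\<in>Q. occ s p P w"
proof -
  have X': "finite X" "X \<subseteq> carrier G" using X by (auto simp: gluing_def)
  have XC: "y \<in> carrier G" if "y \<in> X" for y using that X' by blast
  have PC: "x \<in> carrier G" if "x \<in> P" for x using that P by blast
  have WC: "x \<in> carrier G" if "x \<in> W" for x using that W by blast
  define K where "K = (\<lambda>(x, y, x', y'). x \<otimes> y \<otimes> inv (x' \<otimes> y')) ` (P \<times> X \<times> P \<times> X)"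
  define Z where "Z = (\<lambda>(w, y', y, x). w \<otimes> y' \<otimes> inv y \<otimes> inv x) ` (W \<times> X \<times> X \<times> P)"
  have K: "finite K" "K \<subseteq> carrier G" using P X' XC PC by (auto simp: K_def)
  have Z: "finite Z" "Z \<subseteq> carrier G" using P X' W XC PC WC by (auto simp: Z_def)
  obtain h where h: "h \<in> carrier G" "h \<notin> Z"
    using infinite_imp_nonempty[OF Diff_infinite_finite[OF Z(1) inf]] by blast
  define Q0 where "Q0 = insert \<one> (K \<union> (\<lambda>z. inv h \<otimes> z) ` Z)"
  define Q where "Q = Q0 \<union> m_inv G ` Q0"
  have Q0: "finite Q0" "Q0 \<subseteq> carrier G" using K Z h by (auto simp: Q0_def)
  have Q: "finite Q" "Q \<subseteq> carrier G" "\<one> \<in> Q" using Q0 by (auto simp: Q_def Q0_def)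
  have Q_inv: "inv q \<in> Q" if "q \<in> Q" for q
    using that Q0(2) by (auto simp: Q_def)
  have KQ: "k \<in> Q" if "k \<in> K" for k using that by (simp add: Q_def Q0_def)
  have KC: "k \<in> carrier G" if "k \<in> K" for k using that K by blast
  interpret planting G A S p X P K "{\<one>}" Q 1
  proof unfold_locales
    show "x \<otimes> y \<otimes> inv (x' \<otimes> y') \<in> K" if "x \<in> P" "y \<in> X" "x' \<in> P" "y' \<in> X" for x y x' y'
      unfolding K_def by (rule image_eqI[of _ _ "(x, y, x', y')"]) (use that in auto)
    show "b \<otimes> k \<otimes> inv b' \<in> Q" if "b \<in> {\<one>}" "k \<in> K" "b' \<in> {\<one>}" for b k b'
      using that KQ KC by auto
  qed (use A S X p P Q Q_inv in auto)
  have sep: "separated Q {h}" using h by (simp add: separated_def)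
  obtain M where M: "max_separated Q M" "{h} \<subseteq> M" using max_separated_exists[OF sep] by blast
  have MC: "m \<in> carrier G" if "m \<in> M" for m using M(1) that by (rule max_separated_carrier)
  have MZ: "m \<notin> Z" if m: "m \<in> M" for m
  proof
    assume "m \<in> Z"
    then have "inv h \<otimes> m \<in> Q" by (simp add: Q_def Q0_def)
    then have "h = m" using M m unfolding max_separated_def separated_def by blast
    then show False using h(2) \<open>m \<in> Z\<close> by simp
  qed
  show thesis
  proof (rule that[OF planted_strongly_irreducible planted_subset _ Q(1,2)])
    show "agree_on W S planted"
    proof (rule agree_onI[OF planted_subset], rule planted_exists[OF _ W(2) M(1)])
      fix \<sigma> m assume "\<sigma> \<in> S" and m: "m \<in> M"
      have "(window (m \<otimes> \<one>) <#> X) \<inter> (W <#> X) = {}"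
      proof (rule ccontr)
        assume "\<not> ?thesis"
        then obtain u where u: "u \<in> window (m \<otimes> \<one>) <#> X" "u \<in> W <#> X" by blast
        obtain x y where xy: "x \<in> P" "y \<in> X" "u = m \<otimes> \<one> \<otimes> x \<otimes> y"
          using u(1) unfolding window_def set_mult_iff by blast
        obtain w y' where wy: "w \<in> W" "y' \<in> X" "u = w \<otimes> y'"
          using u(2) unfolding set_mult_iff by blast
        have "m = u \<otimes> inv y \<otimes> inv x" using xy MC[OF m] PC XC by (simp add: word_simps)
        then have "m = w \<otimes> y' \<otimes> inv y \<otimes> inv x" using wy(3) by simp
        moreover have "w \<otimes> y' \<otimes> inv y \<otimes> inv x \<in> Z"
          unfolding Z_def by (rule image_eqI[of _ _ "(w, y', y, x)"]) (use xy wy in auto)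
        ultimately show False using MZ[OF m] by simp
      qed
      then have "{b \<in> {\<one>}. (occ \<sigma> p P (m \<otimes> b) \<and> window (m \<otimes> b) \<subseteq> W) \<or>
        (window (m \<otimes> b) <#> X) \<inter> (W <#> X) = {}} = {\<one>}" by auto
      then show "1 \<le> card {b \<in> {\<one>}. (occ \<sigma> p P (m \<otimes> b) \<and> window (m \<otimes> b) \<subseteq> W) \<or>
        (window (m \<otimes> b) <#> X) \<inter> (W <#> X) = {}}" by simp
    qed
    show "\<forall>s\<in>planted. \<exists>w\<in>Q. occ s p P w"
    proof
    fix s assume "s \<in> planted"
      then obtain N where N: "max_separated Q N" "\<And>m. m \<in> N \<Longrightarrow> 1 \<le> card (hits s m)"
        unfolding planted_def by blast
      obtain m where m: "m \<in> N" "inv m \<otimes> \<one> \<in> Q" using N(1) unfolding max_separated_def by blast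
      have mC: "m \<in> carrier G" using m(1) N(1) by (auto simp: max_separated_def separated_def)
      have "hits s m \<noteq> {}" using N(2)[OF m(1)] by force
      then have "occ s p P m" using mC by (auto simp: hits_def)
      moreover have "m \<in> Q" using Q_inv[OF m(2)] mC by simp
      ultimately show "\<exists>w\<in>Q. occ s p P w" by blast
    qed
  qed
qed

text \<open>There are finitely many patterns on \<open>W\<close>, and a maximal separated set in an
  infinite group is infinite, since finitely many translates of the finite set \<open>K\<close>
  cannot cover the group. Each pattern is glued in at its own point of that set.\<close>

lemma rich_pattern:
  assumes inf: "infinite (carrier G)" and A: "finite A" and S: "S \<in> shifts G A" and X: "gluing X S"
    and W: "finite W" "W \<subseteq> carrier G"
  obtains p H where "p \<in> S" "finite H" "H \<subseteq> carrier G" "\<forall>z\<in>S. \<exists>h\<in>H. occ p z W h"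
proof -
  have X': "finite X" "X \<subseteq> carrier G" using X by (auto simp: gluing_def)
  have XC: "y \<in> carrier G" if "y \<in> X" for y using that X' by blast
  have WC: "x \<in> carrier G" if "x \<in> W" for x using that W by blast
  let ?R = "(\<lambda>s. restrict s W) ` S"
  have "?R \<subseteq> W \<rightarrow>\<^sub>E A"
  proof (clarify)
    fix s assume "s \<in> S"
    then have "s \<in> carrier G \<rightarrow>\<^sub>E A" by (rule shifts_ext[OF S])
    then show "restrict s W \<in> W \<rightarrow>\<^sub>E A" using W(2) by (auto simp: PiE_def Pi_def)
  qed
  then have finR: "finite ?R" by (rule finite_subset) (use W A in \<open>simp add: finite_PiE\<close>)
  define K where "K = insert \<one> ((\<lambda>(x, y, x', y'). x \<otimes> y \<otimes> inv (x' \<otimes> y')) ` (W \<times> X \<times> W \<times> X))"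
  have K: "finite K" "K \<subseteq> carrier G" "\<one> \<in> K" using W X' XC WC by (auto simp: K_def)
  have KI: "x \<otimes> y \<otimes> inv (x' \<otimes> y') \<in> K" if "x \<in> W" "y \<in> X" "x' \<in> W" "y' \<in> X" for x y x' y'
    unfolding K_def by (rule insertI2, rule image_eqI[of _ _ "(x, y, x', y')"]) (use that in auto)
  have K_inv: "inv k \<in> K" if "k \<in> K" for k
  proof (cases "k = \<one>")
    case False
    then obtain x y x' y' where k: "x \<in> W" "y \<in> X" "x' \<in> W" "y' \<in> X" "k = x \<otimes> y \<otimes> inv (x' \<otimes> y')"
      using \<open>k \<in> K\<close> unfolding K_def by auto
    then have "inv k = x' \<otimes> y' \<otimes> inv (x \<otimes> y)" using XC WC by (simp add: word_simps)
    then show ?thesis using KI[OF k(3,4,1,2)] by simp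
  qed (use K in simp)
  obtain M where M: "max_separated K M"
    using max_separated_extend[of K "{}"] K(3) K_inv by (auto simp: separated_def)
  have MC: "m \<in> carrier G" if "m \<in> M" for m using M(1) that by (rule max_separated_carrier)
  have "infinite M"
  proof
    assume "finite M"
    then have "finite (M <#> K)" using K(1) by (rule finite_set_mult)
    moreover have "carrier G \<subseteq> M <#> K"
    proof
      fix g assume g: "g \<in> carrier G"
      then obtain m where m: "m \<in> M" "inv m \<otimes> g \<in> K" using M unfolding max_separated_def by blast
      have "g = m \<otimes> (inv m \<otimes> g)" using MC[OF m(1)] g by (simp add: word_simps)
      then show "g \<in> M <#> K" using set_multI[OF m] by simp
    qed
    ultimately show False using inf by (blast intro: finite_subset[rotated])
  qed
  then obtain H where H: "H \<subseteq> M" "finite H" "card H = card ?R"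
    using infinite_arbitrarily_large by blast
  obtain f where f: "bij_betw f ?R H" using finite_same_card_bij[OF finR H(2) H(3)[symmetric]] by blast
  have fM: "f r \<in> M" if "r \<in> ?R" for r using that f H(1) by (auto simp: bij_betw_def)
  have fC: "f r \<in> carrier G" if "r \<in> ?R" for r using MC[OF fM[OF that]] .
  define \<tau> where "\<tau> r = inv_into S (\<lambda>s. restrict s W) r" for r
  have \<tau>: "\<tau> r \<in> S" "restrict (\<tau> r) W = r" if "r \<in> ?R" for r
    using inv_into_into[OF that] f_inv_into_f[OF that] by (simp_all add: \<tau>_def)
  have "\<exists>s\<in>S. \<forall>r\<in>?R. \<forall>x\<in>(\<lambda>x. f r \<otimes> x) ` W. s x = translate G (f r) (\<tau> r) x"
  proof (rule glue_family[OF A S X])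
    show "(\<lambda>x. f r \<otimes> x) ` W \<subseteq> carrier G" if "r \<in> ?R" for r using fC[OF that] WC by auto
    show "translate G (f r) (\<tau> r) \<in> S" if "r \<in> ?R" for r
      using shifts_translate[OF S \<tau>(1)[OF that] fC[OF that]] .
    fix r r' assume r: "r \<in> ?R" "r' \<in> ?R" "r \<noteq> r'"
    show "((\<lambda>x. f r \<otimes> x) ` W <#> X) \<inter> ((\<lambda>x. f r' \<otimes> x) ` W <#> X) = {}"
    proof (rule ccontr)
      assume "\<not> ?thesis"
      then obtain u where u: "u \<in> (\<lambda>x. f r \<otimes> x) ` W <#> X" "u \<in> (\<lambda>x. f r' \<otimes> x) ` W <#> X" by blast
      obtain x y where xy: "x \<in> W" "y \<in> X" "u = f r \<otimes> x \<otimes> y" using u(1) unfolding set_mult_iff by blast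
      obtain x' y' where xy': "x' \<in> W" "y' \<in> X" "u = f r' \<otimes> x' \<otimes> y'" using u(2) unfolding set_mult_iff by blast
      have C: "f r \<in> carrier G" "f r' \<in> carrier G" "x \<in> carrier G" "y \<in> carrier G" "x' \<in> carrier G" "y' \<in> carrier G"
        using fC r xy xy' XC WC by auto
      have "inv (f r) \<otimes> f r' = inv (f r) \<otimes> (f r' \<otimes> x' \<otimes> y') \<otimes> inv (x' \<otimes> y')" using C by (simp add: word_simps)
      also have "\<dots> = inv (f r) \<otimes> (f r \<otimes> x \<otimes> y) \<otimes> inv (x' \<otimes> y')" using xy(3) xy'(3) by simp
      also have "\<dots> = x \<otimes> y \<otimes> inv (x' \<otimes> y')" using C by (simp add: word_simps)
      finally have "inv (f r) \<otimes> f r' \<in> K" using KI xy xy' by simp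
      then have "f r = f r'" using M fM r(1,2) unfolding max_separated_def separated_def by blast
      then show False using f r unfolding bij_betw_def inj_on_def by blast
    qed
  qed
  then obtain p where p: "p \<in> S" and p_eq: "\<forall>r\<in>?R. \<forall>x\<in>(\<lambda>x. f r \<otimes> x) ` W. p x = translate G (f r) (\<tau> r) x"
    by (elim bexE)
  show thesis
  proof (rule that[OF p H(2)])
    show "H \<subseteq> carrier G" using H(1) MC by blast
    show "\<forall>z\<in>S. \<exists>h\<in>H. occ p z W h"
    proof
    fix z assume "z \<in> S"
      then have r: "restrict z W \<in> ?R" by blast
      let ?h = "f (restrict z W)"
      have "p (?h \<otimes> x) = z x" if x: "x \<in> W" for x
      proof -
        have "p (?h \<otimes> x) = translate G ?h (\<tau> (restrict z W)) (?h \<otimes> x)" using p_eq r x by blast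
        also have "\<dots> = \<tau> (restrict z W) x" using fC[OF r] WC[OF x] by (simp add: translate_def word_simps)
        also have "\<dots> = restrict (\<tau> (restrict z W)) W x" using x by simp
        also have "\<dots> = z x" using \<tau>(2)[OF r] x by simp
        finally show ?thesis .
      qed
      then have "occ p z W ?h" by (simp add: occ_def)
      moreover have "?h \<in> H" using f r by (auto simp: bij_betw_def)
      ultimately show "\<exists>h\<in>H. occ p z W h" by blast
    qed
  qed
qed

text \<open>By compactness this property for all finite \<open>W\<close> amounts to minimality and proximality.\<close>

definition jointly_recurrent :: "'a set \<Rightarrow> ('a \<Rightarrow> 'c) set \<Rightarrow> bool"
  where "jointly_recurrent W S \<longleftrightarrow> (\<exists>Y. finite Y \<and> Y \<subseteq> carrier G \<and>
    (\<forall>s\<in>S. \<forall>t\<in>S. \<forall>z\<in>S. \<exists>g\<in>Y. occ s z W g \<and> occ t z W g))"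

text \<open>In \<open>planted\<close> each configuration has \<open>p\<close> somewhere on each translate of \<open>F\<close>, and some
  configuration \<open>s0\<close> has \<open>p\<close> on all of \<open>F\<close>. If \<open>s0\<close> restricted to \<open>F <#> P\<close> occurs in \<open>s\<close> at
  \<open>w\<close>, then \<open>s\<close> and any \<open>t\<close> have \<open>p\<close> at a common place \<open>w \<otimes> f\<close>.\<close>

lemma jointly_recurrent_refinement:
  assumes icc: "ICC G" and nt: "carrier G \<noteq> {\<one>}" and A: "finite A" and SI: "strongly_irreducible G A S"
    and W: "finite W" "W \<subseteq> carrier G"
  obtains S' where "strongly_irreducible G A S'" "S' \<subseteq> S" "agree_on W S S'" "jointly_recurrent W S'"
proof -
  have inf: "infinite (carrier G)" using icc nt by (rule ICC_infinite)
  obtain X where S: "S \<in> shifts G A" and X: "gluing X S"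
    using SI unfolding strongly_irreducible_iff by blast
  have X': "finite X" "X \<subseteq> carrier G" using X by (auto simp: gluing_def)
  have XC: "y \<in> carrier G" if "y \<in> X" for y using that X' by blast
  have WC: "x \<in> carrier G" if "x \<in> W" for x using that W by blast
  obtain p H where p: "p \<in> S" and H: "finite H" "H \<subseteq> carrier G"
    and pH: "\<forall>z\<in>S. \<exists>h\<in>H. occ p z W h" by (rule rich_pattern[OF inf A S X W])
  define P where "P = H <#> W"
  have P: "finite P" "P \<subseteq> carrier G"
    using H W by (simp_all add: P_def finite_set_mult set_mult_closed)
  have PC: "x \<in> carrier G" if "x \<in> P" for x using that P by blast
  \<comment> \<open>The places at which a window of \<open>p\<close> interferes with
    \<open>W\<close>. The quotients of \<open>D\<close> go into \<open>K\<close>, so for each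
    \<open>m\<close> at most one \<open>m \<otimes> b\<close> lies in \<open>D\<close>: prescribing
    values on \<open>W\<close> costs each \<open>m\<close> at most one place.\<close>
  define D where "D = (\<lambda>(w, y', y, x). w \<otimes> y' \<otimes> inv y \<otimes> inv x) ` (W \<times> X \<times> X \<times> P)"
  have D: "finite D" "D \<subseteq> carrier G" using P X' W XC PC WC by (auto simp: D_def)
  have DC: "u \<in> carrier G" if "u \<in> D" for u using that D by blast
  define K0 where "K0 = insert \<one> ((\<lambda>(x, y, x', y'). x \<otimes> y \<otimes> inv (x' \<otimes> y')) ` (P \<times> X \<times> P \<times> X) \<union>
    (\<lambda>(u, v). inv u \<otimes> v) ` (D \<times> D))"
  define K where "K = K0 \<union> m_inv G ` K0"
  have K0: "finite K0" "K0 \<subseteq> carrier G" using P X' XC PC D DC by (auto simp: K0_def)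
  have K0C: "k \<in> carrier G" if "k \<in> K0" for k using that K0(2) by blast
  have "\<one> \<in> K0" by (simp add: K0_def)
  then have K: "finite K" "K \<subseteq> carrier G" "\<one> \<in> K" using K0(1) K0C by (auto simp: K_def)
  have K_inv: "inv k \<in> K" if "k \<in> K" for k using that K0C by (auto simp: K_def)
  have KP: "x \<otimes> y \<otimes> inv (x' \<otimes> y') \<in> K" if "x \<in> P" "y \<in> X" "x' \<in> P" "y' \<in> X" for x y x' y'
    unfolding K_def K0_def
    by (rule UnI1, rule insertI2, rule UnI1, rule image_eqI[of _ _ "(x, y, x', y')"]) (use that in auto)
  have KD: "inv u \<otimes> v \<in> K" if "u \<in> D" "v \<in> D" for u v
    unfolding K_def K0_def
    by (rule UnI1, rule insertI2, rule UnI2, rule image_eqI[of _ _ "(u, v)"]) (use that in auto)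
  have KC: "k \<in> carrier G" if "k \<in> K" for k using that K by blast
  show thesis
  proof (rule hitting_family_exists[OF icc nt K K_inv], goal_cases)
    case (2 B F)
    note B = 2(1,2) and card_B = 2(3) and F = 2(4,5) and B_sep = 2(6) and F_sep = 2(7)
      and F_hit = 2(8) and F_few = 2(9)
    have BC: "b \<in> carrier G" if "b \<in> B" for b using that B by blast
    have FC: "f \<in> carrier G" if "f \<in> F" for f using that F by blast
    define Q where "Q = (\<lambda>(e, k, c). e \<otimes> k \<otimes> inv c) ` (B \<times> K \<times> B)"
    have QI: "e \<otimes> k \<otimes> inv c \<in> Q" if "e \<in> B" "k \<in> K" "c \<in> B" for e k c
      unfolding Q_def by (rule image_eqI[of _ _ "(e, k, c)"]) (use that in auto)
    have QE: "\<exists>e\<in>B. \<exists>k\<in>K. \<exists>c\<in>B. q = e \<otimes> k \<otimes> inv c" if "q \<in> Q" for q using that unfolding Q_def by auto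
    have Q_fin: "finite Q" "Q \<subseteq> carrier G" using B K BC KC by (auto simp: Q_def)
    have Q_one: "\<one> \<in> Q"
    proof -
      obtain b where b: "b \<in> B" using card_B by fastforce
      then have "b \<otimes> \<one> \<otimes> inv b = \<one>" using BC by simp
      then show ?thesis using QI[OF b K(3) b] by simp
    qed
    have Q_inv: "inv q \<in> Q" if q: "q \<in> Q" for q
    proof -
      obtain e k c where w: "e \<in> B" "k \<in> K" "c \<in> B" "q = e \<otimes> k \<otimes> inv c" using QE[OF q] by blast
      then have "inv q = c \<otimes> inv k \<otimes> inv e" using BC KC by (simp add: word_simps)
      then show ?thesis using QI[OF w(3) K_inv[OF w(2)] w(1)] by simp
    qed
    interpret planting G A S p X P K B Q 7
      by unfold_locales (use A S X p P B card_B Q_fin Q_one Q_inv KP B_sep QI in auto)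
    \<comment> \<open>The quota 7 is met when at most 4 of the 11 places are lost.\<close>
    have few: "7 \<le> card {b \<in> B. R b}" if "card {b \<in> B. \<not> R b} \<le> 4" for R
    proof -
      have "card B = card ({b \<in> B. R b} \<union> {b \<in> B. \<not> R b})" by (rule arg_cong[of _ _ card]) blast
      also have "\<dots> \<le> card {b \<in> B. R b} + card {b \<in> B. \<not> R b}" by (rule card_Un_le)
      finally show ?thesis using that card_B by simp
    qed
    have meet: "\<exists>x\<in>P. \<exists>y\<in>X. \<exists>e\<in>E. \<exists>y'\<in>X. c = e \<otimes> y' \<otimes> inv y \<otimes> inv x"
      if ne: "(window c <#> X) \<inter> (E <#> X) \<noteq> {}" and c: "c \<in> carrier G" for c E
    proof -
      obtain u where u: "u \<in> window c <#> X" "u \<in> E <#> X" using ne by blast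
      obtain x y where xy: "x \<in> P" "y \<in> X" "u = c \<otimes> x \<otimes> y" using u(1) unfolding window_def set_mult_iff by blast
      obtain e y' where e: "e \<in> E" "y' \<in> X" "u = e \<otimes> y'" using u(2) unfolding set_mult_iff by blast
      have "c = u \<otimes> inv y \<otimes> inv x" using c xy PC XC by (simp add: word_simps)
      then have "c = e \<otimes> y' \<otimes> inv y \<otimes> inv x" using e(3) by simp
      then show ?thesis using xy(1,2) e(1,2) by blast
    qed
    have agree1: "agree_on W S planted"
    proof (rule agree_onI[OF planted_subset])
      fix \<sigma> assume \<sigma>: "\<sigma> \<in> S"
      obtain M where M: "max_separated Q M"
        using max_separated_exists[of "{}"] by (auto simp: separated_def)
      have MC: "m \<in> carrier G" if "m \<in> M" for m using M that by (rule max_separated_carrier)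
      show "\<exists>s\<in>planted. \<forall>x\<in>W. s x = \<sigma> x"
      proof (rule planted_exists[OF \<sigma> W(2) M], rule few)
        fix m assume m: "m \<in> M"
        let ?L = "{b \<in> B. \<not> ((occ \<sigma> p P (m \<otimes> b) \<and> window (m \<otimes> b) \<subseteq> W) \<or> (window (m \<otimes> b) <#> X) \<inter> (W <#> X) = {})}"
        have mD: "m \<otimes> b \<in> D" if "b \<in> ?L" for b
        proof -
          have "(window (m \<otimes> b) <#> X) \<inter> (W <#> X) \<noteq> {}" "m \<otimes> b \<in> carrier G"
            using that MC[OF m] BC by auto
          from meet[OF this] obtain x y w y' where xy: "x \<in> P" "y \<in> X" "w \<in> W" "y' \<in> X"
            "m \<otimes> b = w \<otimes> y' \<otimes> inv y \<otimes> inv x" by (elim bexE) (rule that)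
          show ?thesis unfolding D_def by (rule image_eqI[of _ _ "(w, y', y, x)"]) (use xy in auto)
        qed
        have "b = b'" if b: "b \<in> ?L" "b' \<in> ?L" for b b'
        proof (rule B_sep)
          have C: "b \<in> carrier G" "b' \<in> carrier G" "m \<in> carrier G" using b BC MC[OF m] by auto
          have "inv (m \<otimes> b) \<otimes> (m \<otimes> b') = inv b \<otimes> b'" using C by (simp add: word_simps)
          then show "inv b \<otimes> b' \<in> K" using KD[OF mD[OF b(1)] mD[OF b(2)]] by simp
        qed (use b in auto)
        moreover have "finite ?L" using B(1) by simp
        ultimately have "card ?L \<le> Suc 0" by (subst card_le_Suc0_iff_eq) blast+
        then show "card ?L \<le> 4" by simp
      qed
    qed
    have "\<exists>s\<in>S. \<forall>f\<in>F. \<forall>x\<in>window f. s x = translate G f p x"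
    proof (rule glue_family[OF A S X])
      show "window f \<subseteq> carrier G" if "f \<in> F" for f using FC[OF that] PC by (auto simp: window_def)
      show "translate G f p \<in> S" if "f \<in> F" for f by (rule shifts_translate[OF S p FC[OF that]])
      fix f f' assume f: "f \<in> F" "f' \<in> F" "f \<noteq> f'"
      show "(window f <#> X) \<inter> (window f' <#> X) = {}"
      proof (rule ccontr)
        assume "(window f <#> X) \<inter> (window f' <#> X) \<noteq> {}"
        from meet[OF this FC[OF f(1)]] obtain x y u y' where xy: "x \<in> P" "y \<in> X" "u \<in> window f'" "y' \<in> X"
          "f = u \<otimes> y' \<otimes> inv y \<otimes> inv x" by (elim bexE) (rule that)
        then obtain x' where x': "x' \<in> P" "u = f' \<otimes> x'" by (auto simp: window_def)
        have "inv f' \<otimes> f = inv f' \<otimes> (f' \<otimes> x' \<otimes> y' \<otimes> inv y \<otimes> inv x)" using xy(5) x'(2) by simp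
        also have "\<dots> = x' \<otimes> y' \<otimes> inv (x \<otimes> y)" using f FC PC XC xy x'(1) by (simp add: word_simps)
        also have "\<dots> \<in> K" by (rule KP) (use xy x' in auto)
        finally have "f' = f" by (rule F_sep[OF f(2,1)])
        then show False using f(3) by simp
      qed
    qed
    then obtain \<sigma> where \<sigma>: "\<sigma> \<in> S" and \<sigma>_eq: "\<forall>f\<in>F. \<forall>x\<in>window f. \<sigma> x = translate G f p x" by (elim bexE)
    have occ\<sigma>: "occ \<sigma> p P f" if f: "f \<in> F" for f
      unfolding occ_def
    proof
      fix x assume x: "x \<in> P"
      have "\<sigma> (f \<otimes> x) = translate G f p (f \<otimes> x)" using \<sigma>_eq f x by (simp add: window_def)
      also have "\<dots> = p x" using FC[OF f] PC[OF x] by (simp add: translate_def word_simps)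
      finally show "\<sigma> (f \<otimes> x) = p x" .
    qed
    let ?E = "\<Union>f\<in>F. window f"
    have EC: "?E \<subseteq> carrier G" using FC PC by (auto simp: window_def)
    obtain M where M: "max_separated Q M"
      using max_separated_exists[of "{}"] by (auto simp: separated_def)
    have MC: "m \<in> carrier G" if "m \<in> M" for m using M that by (rule max_separated_carrier)
    \<comment> \<open>Places \<open>m \<otimes> b\<close> in \<open>F\<close> already carry
      \<open>p\<close>; only those close to \<open>F\<close> without belonging to it are lost, and
      \<open>F_few\<close> bounds their number by 4.\<close>
    have "\<exists>s\<in>planted. \<forall>x\<in>?E. s x = \<sigma> x"
    proof (rule planted_exists[OF \<sigma> EC M], rule few)
      fix m assume m: "m \<in> M"
      let ?L = "{b \<in> B. \<not> ((occ \<sigma> p P (m \<otimes> b) \<and> window (m \<otimes> b) \<subseteq> ?E) \<or> (window (m \<otimes> b) <#> X) \<inter> (?E <#> X) = {})}"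
      have "?L \<subseteq> {b \<in> B. m \<otimes> b \<notin> F \<and> (\<exists>f\<in>F. \<exists>k\<in>K. m \<otimes> b = f \<otimes> k)}"
      proof (rule subsetI)
        fix b assume b: "b \<in> ?L"
        have bB: "b \<in> B" using b by simp
        have notF: "m \<otimes> b \<notin> F"
        proof
          assume f: "m \<otimes> b \<in> F"
          then have "occ \<sigma> p P (m \<otimes> b)" by (rule occ\<sigma>)
          moreover have "window (m \<otimes> b) \<subseteq> ?E" using f by (rule UN_upper)
          ultimately show False using b by simp
        qed
        have "(window (m \<otimes> b) <#> X) \<inter> (?E <#> X) \<noteq> {}" "m \<otimes> b \<in> carrier G"
          using b bB MC[OF m] BC by auto
        from meet[OF this] obtain x y u y' where xy: "x \<in> P" "y \<in> X" "u \<in> ?E" "y' \<in> X"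
          "m \<otimes> b = u \<otimes> y' \<otimes> inv y \<otimes> inv x" by (elim bexE) (rule that)
        from xy(3) obtain f x' where f: "f \<in> F" "x' \<in> P" "u = f \<otimes> x'" by (auto simp: window_def)
        have "m \<otimes> b = f \<otimes> (x' \<otimes> y' \<otimes> inv (x \<otimes> y))"
          unfolding xy(5) f(3) using xy(1,2,4) f(1,2) FC PC XC by (simp add: word_simps)
        moreover have "x' \<otimes> y' \<otimes> inv (x \<otimes> y) \<in> K" by (rule KP) (use xy f in auto)
        ultimately show "b \<in> {b \<in> B. m \<otimes> b \<notin> F \<and> (\<exists>f\<in>F. \<exists>k\<in>K. m \<otimes> b = f \<otimes> k)}"
          using bB notF f(1) by blast
      qed
      then have "card ?L \<le> card {b \<in> B. m \<otimes> b \<notin> F \<and> (\<exists>f\<in>F. \<exists>k\<in>K. m \<otimes> b = f \<otimes> k)}"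
        using B(1) by (intro card_mono) auto
      then show "card ?L \<le> 4" using F_few[OF MC[OF m]] by simp
    qed
    then obtain s0 where s0: "s0 \<in> planted" and s0_eq: "\<forall>x\<in>?E. s0 x = \<sigma> x" by (elim bexE)
    have occ0: "occ s0 p P f" if f: "f \<in> F" for f
      using occ\<sigma>[OF f] s0_eq f by (auto simp: occ_def window_def)
    \<comment> \<open>The displacement \<open>q = inv m \<otimes> g\<close> lies in
      \<open>Q\<close>. Among at least seven letters \<open>b\<close> with \<open>p\<close> at
      \<open>m \<otimes> b\<close>, one has \<open>inv q \<otimes> b \<in> F\<close>, and
      \<open>g \<otimes> (inv q \<otimes> b) = m \<otimes> b\<close>.\<close>
    have hitF: "\<exists>f\<in>F. occ t p P (g \<otimes> f)" if t: "t \<in> planted" and g: "g \<in> carrier G" for t g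
    proof -
      obtain N where N: "max_separated Q N" "\<And>m. m \<in> N \<Longrightarrow> 7 \<le> card (hits t m)"
        using t unfolding planted_def by blast
      obtain m where m: "m \<in> N" "inv m \<otimes> g \<in> Q" using N(1) g unfolding max_separated_def by blast
      have mC: "m \<in> carrier G" using m(1) N(1) by (auto simp: max_separated_def separated_def)
      obtain e k c where w: "e \<in> B" "k \<in> K" "c \<in> B" "inv m \<otimes> g = e \<otimes> k \<otimes> inv c" using QE[OF m(2)] by blast
      have "\<exists>b\<in>hits t m. inv (e \<otimes> k \<otimes> inv c) \<otimes> b \<in> F"
        by (rule F_hit[OF w(1-3) _ N(2)[OF m(1)]]) (simp add: hits_def)
      then obtain b where b: "b \<in> hits t m" "inv (inv m \<otimes> g) \<otimes> b \<in> F" using w(4) by auto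
      have bB: "b \<in> B" "occ t p P (m \<otimes> b)" using b(1) by (simp_all add: hits_def)
      have "g \<otimes> (inv (inv m \<otimes> g) \<otimes> b) = m \<otimes> b" using g mC BC[OF bB(1)] by (simp add: word_simps)
      then show ?thesis using b(2) bB(2) by (intro bexI[of _ "inv (inv m \<otimes> g) \<otimes> b"]) simp_all
    qed
    obtain X1 where X1: "gluing X1 planted" using planted_gluing by blast
    have FP: "finite (F <#> P)" "F <#> P \<subseteq> carrier G"
      using F P by (simp_all add: finite_set_mult set_mult_closed)
    \<comment> \<open>A second planting inside the first makes \<open>s0\<close> on
      \<open>F <#> P\<close> recur, while \<open>hitF\<close> is inherited by the smaller
      shift.\<close>
    obtain S' Q' where S': "strongly_irreducible G A S'" "S' \<subseteq> planted" "agree_on W planted S'"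
      and Q': "finite Q'" "Q' \<subseteq> carrier G" "\<forall>s\<in>S'. \<exists>w\<in>Q'. occ s s0 (F <#> P) w"
      by (rule embed_pattern[OF inf A planted_shift X1 s0 FP W])
    have agree2: "agree_on W S S'" using agree1 S'(3) by (simp add: agree_on_def)
    have "jointly_recurrent W S'"
      unfolding jointly_recurrent_def
    proof (intro exI conjI ballI)
      show "finite (Q' <#> F <#> H)" "Q' <#> F <#> H \<subseteq> carrier G"
        using Q' F H by (simp_all add: finite_set_mult set_mult_closed)
      fix s t z assume s: "s \<in> S'" and t: "t \<in> S'" and z: "z \<in> S'"
      obtain w where w: "w \<in> Q'" "occ s s0 (F <#> P) w" using Q'(3) s by blast
      have wC: "w \<in> carrier G" using w Q' by blast
      have "t \<in> planted" using t S'(2) by blast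
      then obtain f where f: "f \<in> F" "occ t p P (w \<otimes> f)" using hitF wC by blast
      have "z \<in> S" using z S'(2) planted_subset by blast
      then obtain h where h: "h \<in> H" "occ p z W h" using pH by blast
      have C: "f \<in> carrier G" "h \<in> carrier G" using f h FC H by auto
      have "s (w \<otimes> f \<otimes> h \<otimes> x) = z x \<and> t (w \<otimes> f \<otimes> h \<otimes> x) = z x" if x: "x \<in> W" for x
      proof -
        have hx: "h \<otimes> x \<in> P" using h x by (simp add: P_def set_multI)
        have eq: "w \<otimes> f \<otimes> h \<otimes> x = w \<otimes> (f \<otimes> (h \<otimes> x))" "w \<otimes> f \<otimes> h \<otimes> x = w \<otimes> f \<otimes> (h \<otimes> x)"
          using wC C WC[OF x] by (simp_all add: m_assoc)
        have "s (w \<otimes> (f \<otimes> (h \<otimes> x))) = s0 (f \<otimes> (h \<otimes> x))"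
          using w(2) set_multI[OF f(1) hx] by (simp add: occ_def)
        also have "\<dots> = p (h \<otimes> x)" using occ0[OF f(1)] hx by (simp add: occ_def)
        finally have "s (w \<otimes> (f \<otimes> (h \<otimes> x))) = p (h \<otimes> x)" .
        moreover have "t (w \<otimes> f \<otimes> (h \<otimes> x)) = p (h \<otimes> x)" using f(2) hx by (simp add: occ_def)
        moreover have "p (h \<otimes> x) = z x" using h(2) x by (simp add: occ_def)
        ultimately show ?thesis using eq by metis
      qed
      then have "occ s z W (w \<otimes> f \<otimes> h) \<and> occ t z W (w \<otimes> f \<otimes> h)" by (simp add: occ_def)
      moreover have "w \<otimes> f \<otimes> h \<in> Q' <#> F <#> H" using w f h by (simp add: set_multI)
      ultimately show "\<exists>g\<in>Q' <#> F <#> H. occ s z W g \<and> occ t z W g" by blast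
    qed
    then show thesis using that[OF S'(1) _ agree2] S'(2) planted_subset by blast
  qed
qed

section \<open>Open conditions on shifts\<close>

lemma jointly_recurrentE:
  assumes "jointly_recurrent W S"
  obtains Y where "finite Y" "Y \<subseteq> carrier G"
    "\<And>s t z. s \<in> S \<Longrightarrow> t \<in> S \<Longrightarrow> z \<in> S \<Longrightarrow> \<exists>g\<in>Y. occ s z W g \<and> occ t z W g"
proof -
  from assms obtain Y where Y: "finite Y" "Y \<subseteq> carrier G"
    and rec: "\<forall>s\<in>S. \<forall>t\<in>S. \<forall>z\<in>S. \<exists>g\<in>Y. occ s z W g \<and> occ t z W g"
    unfolding jointly_recurrent_def by (elim exE conjE) (rule that)
  show thesis
    by (rule that[OF Y]) (rule bspec[OF bspec[OF bspec[OF rec]]])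
qed

lemma jointly_recurrentI:
  assumes "finite Y" "Y \<subseteq> carrier G"
    "\<And>s t z. s \<in> S \<Longrightarrow> t \<in> S \<Longrightarrow> z \<in> S \<Longrightarrow> \<exists>g\<in>Y. occ s z W g \<and> occ t z W g"
  shows "jointly_recurrent W S"
  unfolding jointly_recurrent_def using assms by (intro exI[of _ Y] conjI ballI) simp_all

lemma jointly_recurrentD:
  assumes "jointly_recurrent W S" "s \<in> S" "t \<in> S" "z \<in> S"
  shows "\<exists>g\<in>carrier G. occ s z W g \<and> occ t z W g"
proof (rule jointly_recurrentE[OF assms(1)])
  fix Y assume Y: "Y \<subseteq> carrier G"
    "\<And>s t z. s \<in> S \<Longrightarrow> t \<in> S \<Longrightarrow> z \<in> S \<Longrightarrow> \<exists>g\<in>Y. occ s z W g \<and> occ t z W g"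
  show ?thesis using Y(2)[OF assms(2-4)] Y(1) by blast
qed

lemma occ_mono: "occ s z W g \<Longrightarrow> W' \<subseteq> W \<Longrightarrow> occ s z W' g"
  by (auto simp: occ_def)

lemma jointly_recurrent_mono:
  assumes "jointly_recurrent W S" "W' \<subseteq> W" "S' \<subseteq> S"
  shows "jointly_recurrent W' S'"
proof (rule jointly_recurrentE[OF assms(1)])
  fix Y assume Y: "finite Y" "Y \<subseteq> carrier G"
    "\<And>s t z. s \<in> S \<Longrightarrow> t \<in> S \<Longrightarrow> z \<in> S \<Longrightarrow> \<exists>g\<in>Y. occ s z W g \<and> occ t z W g"
  show ?thesis
  proof (rule jointly_recurrentI[OF Y(1,2)])
    fix s t z assume "s \<in> S'" "t \<in> S'" "z \<in> S'"
    then have "\<exists>g\<in>Y. occ s z W g \<and> occ t z W g" using assms(3) by (intro Y(3)) auto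
    then show "\<exists>g\<in>Y. occ s z W' g \<and> occ t z W' g" using occ_mono[OF _ assms(2)] by blast
  qed
qed

text \<open>For \<open>h\<close> in the carrier, \<open>s (inv g \<otimes> h)\<close> is the value
  of \<open>translate G g s\<close> at \<open>h\<close>. In this form two coordinates witness the
  condition, which makes it open.\<close>

definition moved_by :: "'a \<Rightarrow> ('a \<Rightarrow> 'c) set \<Rightarrow> bool"
  where "moved_by g S \<longleftrightarrow> (\<exists>s\<in>S. \<exists>h\<in>carrier G. s (inv g \<otimes> h) \<noteq> s h)"

text \<open>The same \<open>Y\<close> serves all shifts agreeing with \<open>S\<close> on
  \<open>(Y <#> W) \<union> W\<close>: recurrence reads \<open>s\<close> and \<open>t\<close> on
  \<open>Y <#> W\<close> and \<open>z\<close> on \<open>W\<close>.\<close>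

lemma openin_jointly_recurrent:
  assumes W: "finite W" "W \<subseteq> carrier G"
  shows "openin (shift_space G A) {S \<in> shifts G A. jointly_recurrent W S}"
  unfolding openin_shift_space_iff
proof (intro conjI ballI)
  fix S assume "S \<in> {S \<in> shifts G A. jointly_recurrent W S}"
  then have JR: "jointly_recurrent W S" by simp
  show "\<exists>X. finite X \<and> X \<subseteq> carrier G \<and>
      {T \<in> shifts G A. agree_on X S T} \<subseteq> {S \<in> shifts G A. jointly_recurrent W S}"
  proof (rule jointly_recurrentE[OF JR])
  fix Y assume Y: "finite Y" "Y \<subseteq> carrier G"
      "\<And>s t z. s \<in> S \<Longrightarrow> t \<in> S \<Longrightarrow> z \<in> S \<Longrightarrow> \<exists>g\<in>Y. occ s z W g \<and> occ t z W g"
    let ?Z = "(Y <#> W) \<union> W"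
    have "jointly_recurrent W S'" if ag: "agree_on ?Z S S'" for S'
    proof (rule jointly_recurrentI[OF Y(1,2)])
      fix s' t' z' assume S': "s' \<in> S'" "t' \<in> S'" "z' \<in> S'"
      obtain s where s: "s \<in> S" "\<forall>x\<in>?Z. s x = s' x" using agree_onD[OF ag S'(1)] by (elim bexE) (rule that)
      obtain t where t: "t \<in> S" "\<forall>x\<in>?Z. t x = t' x" using agree_onD[OF ag S'(2)] by (elim bexE) (rule that)
      obtain z where z: "z \<in> S" "\<forall>x\<in>?Z. z x = z' x" using agree_onD[OF ag S'(3)] by (elim bexE) (rule that)
      obtain g where g: "g \<in> Y" "occ s z W g" "occ t z W g" using Y(3)[OF s(1) t(1) z(1)] by blast
      have "s' (g \<otimes> x) = z' x \<and> t' (g \<otimes> x) = z' x" if x: "x \<in> W" for x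
      proof -
        have Z: "g \<otimes> x \<in> ?Z" "x \<in> ?Z" using set_multI[OF g(1) x] x by simp_all
        have "s (g \<otimes> x) = z x" "t (g \<otimes> x) = z x" using g x by (simp_all add: occ_def)
        then show ?thesis using bspec[OF s(2) Z(1)] bspec[OF t(2) Z(1)] bspec[OF z(2) Z(2)] by simp
      qed
      then show "\<exists>g\<in>Y. occ s' z' W g \<and> occ t' z' W g" using g(1) unfolding occ_def by blast
    qed
    moreover have "finite ?Z" "?Z \<subseteq> carrier G"
      using Y W by (simp_all add: finite_set_mult set_mult_closed)
    ultimately show "\<exists>X. finite X \<and> X \<subseteq> carrier G \<and>
        {T \<in> shifts G A. agree_on X S T} \<subseteq> {S \<in> shifts G A. jointly_recurrent W S}"
      by (intro exI[of _ ?Z] conjI Collect_mono impI) (simp_all del: Un_subset_iff)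
  qed
qed auto

lemma openin_moved_by:
  assumes g: "g \<in> carrier G"
  shows "openin (shift_space G A) {S \<in> shifts G A. moved_by g S}"
  unfolding openin_shift_space_iff
proof (intro conjI ballI)
  fix S assume "S \<in> {S \<in> shifts G A. moved_by g S}"
  then obtain s h where s: "s \<in> S" "h \<in> carrier G" "s (inv g \<otimes> h) \<noteq> s h"
    unfolding moved_by_def by blast
  let ?Z = "{h, inv g \<otimes> h}"
  have "moved_by g S'" if ag: "agree_on ?Z S S'" for S'
  proof -
    obtain s' where "s' \<in> S'" "\<forall>x\<in>?Z. s' x = s x" using agree_onD[OF agree_on_sym[OF ag] s(1)] by blast
    then show ?thesis using s(2,3) unfolding moved_by_def by (intro bexI[of _ s'] bexI[of _ h]) auto
  qed
  moreover have "finite ?Z" "?Z \<subseteq> carrier G" using g s(2) by auto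
  ultimately show "\<exists>X. finite X \<and> X \<subseteq> carrier G \<and>
      {T \<in> shifts G A. agree_on X S T} \<subseteq> {S \<in> shifts G A. moved_by g S}"
    by (intro exI[of _ ?Z]) auto
qed auto

text \<open>Different values are to be put at \<open>h\<close> and \<open>inv g \<otimes> h\<close>,
  which gluing allows once the thickenings of these points are disjoint. They meet only if
  \<open>inv h \<otimes> inv g \<otimes> h\<close> is one of the finitely many quotients
  \<open>y \<otimes> inv y'\<close> from \<open>X\<close>, and ICC lets \<open>h\<close> avoid
  these.\<close>

lemma strongly_irreducible_moved_by:
  assumes icc: "ICC G" and SI: "strongly_irreducible G A S" and ab: "a \<in> S" "b \<in> S" "a x \<noteq> b x"
    and x: "x \<in> carrier G" and g: "g \<in> carrier G" "g \<noteq> \<one>"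
  shows "moved_by g S"
proof -
  obtain X where S: "S \<in> shifts G A" and X: "gluing X S"
    using SI unfolding strongly_irreducible_iff by blast
  have X': "finite X" "X \<subseteq> carrier G" using X by (auto simp: gluing_def)
  have XC: "y \<in> carrier G" if "y \<in> X" for y using that X' by blast
  define P where "P = (\<lambda>(y, y'). (inv g, y \<otimes> inv y')) ` (X \<times> X)"
  have P: "finite P" "P \<subseteq> (carrier G - {\<one>}) \<times> carrier G" using X' XC g by (auto simp: P_def)
  obtain k where k: "k \<in> carrier G" "\<forall>(a, b)\<in>P. k \<otimes> a \<otimes> inv k \<noteq> b"
    using avoid_conjugations[OF icc P] by (elim bexE)
  define h where "h = inv k"
  have hC: "h \<in> carrier G" using k by (simp add: h_def)
  let ?a = "translate G (h \<otimes> inv x) a" and ?b = "translate G (inv g \<otimes> h \<otimes> inv x) b"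
  have disj: "({h} <#> X) \<inter> ({inv g \<otimes> h} <#> X) = {}"
  proof (rule ccontr)
    assume "\<not> ?thesis"
    then obtain y y' where y: "y \<in> X" "y' \<in> X" "h \<otimes> y = inv g \<otimes> h \<otimes> y'" by (auto simp: set_mult_def)
    have C: "y \<in> carrier G" "y' \<in> carrier G" using y XC by auto
    have "k \<otimes> inv g \<otimes> inv k = k \<otimes> (inv g \<otimes> h \<otimes> y') \<otimes> inv y'" using C k g by (simp add: h_def word_simps)
    also have "\<dots> = y \<otimes> inv y'" unfolding y(3)[symmetric] using C k by (simp add: h_def word_simps)
    finally have "k \<otimes> inv g \<otimes> inv k = y \<otimes> inv y'" .
    moreover have "(inv g, y \<otimes> inv y') \<in> P"
      unfolding P_def by (rule image_eqI[of _ _ "(y, y')"]) (use y in auto)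
    ultimately show False using k(2) by blast
  qed
  have sub: "{h} \<subseteq> carrier G" "{inv g \<otimes> h} \<subseteq> carrier G" using hC g by auto
  have tr: "?a \<in> S" "?b \<in> S" using shifts_translate[OF S] ab hC x g by auto
  show ?thesis
  proof (rule glue_two[OF X sub disj tr])
    fix s assume s: "s \<in> S" "\<And>y. y \<in> {h} \<Longrightarrow> s y = ?a y" "\<And>y. y \<in> {inv g \<otimes> h} \<Longrightarrow> s y = ?b y"
    have "s h = a x" using s(2)[of h] hC x by (simp add: translate_def word_simps)
    moreover have "s (inv g \<otimes> h) = b x" using s(3)[of "inv g \<otimes> h"] hC x g by (simp add: translate_def word_simps)
    ultimately show ?thesis using s(1) hC ab(3) unfolding moved_by_def by (intro bexI[of _ s] bexI[of _ h]) auto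
  qed
qed

section \<open>Faithfulness, minimality and proximality\<close>

lemma faithful_if_moved:
  assumes S: "S \<in> shifts G A" and "\<And>g. g \<in> carrier G - {\<one>} \<Longrightarrow> moved_by g S"
  shows "faithful_action G S (shift_action G S)"
  unfolding faithful_shift_action_iff[OF is_group S]
proof
  fix g assume g: "g \<in> carrier G - {\<one>}"
  then obtain s h where s: "s \<in> S" "h \<in> carrier G" "s (inv g \<otimes> h) \<noteq> s h"
    using assms(2) unfolding moved_by_def by blast
  then have "translate G g s h \<noteq> s h" by (simp add: translate_def)
  then show "\<exists>s\<in>S. translate G g s \<noteq> s" using s(1) by metis
qed

lemma topspace_shift: "S \<in> shifts G A \<Longrightarrow> topspace (subtopology (full_shift G A) S) = S"
  using shifts_ext by (fastforce simp: topspace_full_shift)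

text \<open>Joint recurrence is applied with both configurations equal to \<open>y\<close>: if the
  pattern of \<open>t\<close> on \<open>Z\<close> occurs in \<open>y\<close> at \<open>g\<close>,
  then \<open>translate G (inv g) y\<close> agrees with \<open>t\<close> on
  \<open>Z\<close>.\<close>

lemma minimal_if_jointly_recurrent:
  assumes S: "S \<in> shifts G A" and JR: "\<And>W. finite W \<Longrightarrow> W \<subseteq> carrier G \<Longrightarrow> jointly_recurrent W S"
  shows "minimal_action G (subtopology (full_shift G A) S) (shift_action G S)"
  unfolding minimal_action_def topspace_shift[OF S]
proof
  fix y assume y: "y \<in> S"
  let ?T = "subtopology (full_shift G A) S"
  show "?T closure_of orbit G (shift_action G S) y = S"
  proof
    show "?T closure_of orbit G (shift_action G S) y \<subseteq> S"
      using closure_of_subset_topspace[of ?T] topspace_shift[OF S] by simp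
    show "S \<subseteq> ?T closure_of orbit G (shift_action G S) y"
    proof
      fix t assume t: "t \<in> S"
      have "\<exists>u\<in>orbit G (shift_action G S) y. u \<in> U" if U: "openin ?T U" "t \<in> U" for U
      proof -
        obtain V where V: "openin (full_shift G A) V" "U = V \<inter> S" using U(1) unfolding openin_subtopology by blast
        have "t \<in> V" using U V by blast
        show ?thesis
        proof (rule openin_full_shift_cylinder[OF V(1) \<open>t \<in> V\<close>])
          fix Z assume Z: "finite Z" "Z \<subseteq> carrier G" "\<And>s. s \<in> carrier G \<rightarrow>\<^sub>E A \<Longrightarrow> \<forall>z\<in>Z. s z = t z \<Longrightarrow> s \<in> V"
          obtain g where g: "g \<in> carrier G" "occ y t Z g"
            using jointly_recurrentD[OF JR[OF Z(1,2)] y y t] by blast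
          let ?u = "translate G (inv g) y"
          have u: "?u \<in> S" using shifts_translate[OF S y] g by simp
          moreover have "\<forall>z\<in>Z. ?u z = t z" using g Z(2) by (auto simp: translate_def occ_def)
          ultimately have "?u \<in> U" using Z(3) shifts_ext[OF S u] V(2) by blast
          moreover have "?u = shift_action G S (inv g) y" using y by (simp add: shift_action_def)
          then have "?u \<in> orbit G (shift_action G S) y" using g unfolding orbit_def by blast
          ultimately show ?thesis by blast
        qed
      qed
      then show "t \<in> ?T closure_of orbit G (shift_action G S) y"
        using t unfolding in_closure_of topspace_shift[OF S] by blast
    qed
  qed
qed

text \<open>With \<open>z = x\<close>, joint recurrence gives a common place \<open>g n\<close> of
  the pattern of \<open>x\<close> on \<open>E n\<close> in \<open>x\<close> and \<open>y\<close>.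
  Acting by \<open>inv (g n)\<close> moves both towards \<open>x\<close>; since the sets
  \<open>E n\<close> exhaust the group, a sequence is enough and its image filter represents the
  net.\<close>

lemma proximal_if_jointly_recurrent:
  fixes E :: "nat \<Rightarrow> 'a set"
  assumes S: "S \<in> shifts G A" and JR: "\<And>W. finite W \<Longrightarrow> W \<subseteq> carrier G \<Longrightarrow> jointly_recurrent W S"
    and E: "\<And>n. finite (E n)" "\<And>n. E n \<subseteq> carrier G"
    and exh: "\<And>Z. finite Z \<Longrightarrow> Z \<subseteq> carrier G \<Longrightarrow> \<exists>n. \<forall>m\<ge>n. Z \<subseteq> E m"
  shows "proximal_action G (subtopology (full_shift G A) S) (shift_action G S)"
  unfolding proximal_action_def topspace_shift[OF S]
proof (intro ballI)
  fix x y assume x: "x \<in> S" and y: "y \<in> S"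
  have "\<exists>g\<in>carrier G. occ x x (E n) g \<and> occ y x (E n) g" for n
    by (rule jointly_recurrentD[OF JR[OF E(1)[of n] E(2)[of n]] x y x])
  then obtain g where g: "\<And>n. g n \<in> carrier G" "\<And>n. occ x x (E n) (g n)" "\<And>n. occ y x (E n) (g n)" by metis
  define F where "F = filtermap (\<lambda>n. inv (g n)) sequentially"
  have "F \<noteq> bot" by (simp add: F_def filtermap_bot_iff)
  moreover have "\<forall>\<^sub>F h in F. h \<in> carrier G" using g(1) by (simp add: F_def eventually_filtermap)
  moreover have "limitin (subtopology (full_shift G A) S) (\<lambda>h. shift_action G S h u) x F"
    if u: "u \<in> S" "\<And>n. occ u x (E n) (g n)" for u
    unfolding limitin_subtopology
  proof (intro conjI x)
    have inS: "shift_action G S (inv (g n)) u \<in> S" for n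
      using shifts_translate[OF S u(1)] g(1) u(1) by (simp add: shift_action_def)
    then show "\<forall>\<^sub>F h in F. shift_action G S h u \<in> S" by (simp add: F_def eventually_filtermap)
    show "limitin (full_shift G A) (\<lambda>h. shift_action G S h u) x F"
      unfolding limitin_def
    proof (intro conjI allI impI)
      show "x \<in> topspace (full_shift G A)" using shifts_ext[OF S x] by (simp add: topspace_full_shift)
      fix U assume U: "openin (full_shift G A) U \<and> x \<in> U"
      show "\<forall>\<^sub>F h in F. shift_action G S h u \<in> U"
      proof (rule openin_full_shift_cylinder[OF conjunct1[OF U] conjunct2[OF U]])
        fix Z assume Z: "finite Z" "Z \<subseteq> carrier G" "\<And>s. s \<in> carrier G \<rightarrow>\<^sub>E A \<Longrightarrow> \<forall>z\<in>Z. s z = x z \<Longrightarrow> s \<in> U"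
        obtain n where n: "\<forall>m\<ge>n. Z \<subseteq> E m" using exh[OF Z(1,2)] by blast
        have "shift_action G S (inv (g m)) u \<in> U" if "m \<ge> n" for m
        proof (rule Z(3)[OF shifts_ext[OF S inS]], rule ballI)
          fix z assume z: "z \<in> Z"
          then have "z \<in> E m" "z \<in> carrier G" using n that Z(2) by blast+
          then show "shift_action G S (inv (g m)) u z = x z"
            using u(2)[of m] u(1) g(1)[of m] by (simp add: shift_action_def translate_def occ_def)
        qed
        then show ?thesis by (auto simp: F_def eventually_filtermap eventually_sequentially)
      qed
    qed
  qed
  ultimately show "\<exists>F z. F \<noteq> bot \<and> (\<forall>\<^sub>F g in F. g \<in> carrier G) \<and>
      limitin (subtopology (full_shift G A) S) (\<lambda>g. shift_action G S g x) z F \<and>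
      limitin (subtopology (full_shift G A) S) (\<lambda>g. shift_action G S g y) z F"
    using x y g(2,3) by blast
qed

text \<open>As the sets \<open>Y\<close> increase, a pattern of \<open>S n\<close> on
  \<open>Y n\<close> occurs in every later shift; compactness finds it in the intersection
  too.\<close>

lemma shift_chain_limit:
  assumes A: "finite A" and S: "\<And>n. S n \<in> shifts G A" and dec: "\<And>n. S (Suc n) \<subseteq> S n"
    and Y: "\<And>n. finite (Y n)" "\<And>n. Y n \<subseteq> carrier G" "\<And>n. Y n \<subseteq> Y (Suc n)"
    and agree: "\<And>n. agree_on (Y n) (S n) (S (Suc n))"
  shows "(\<Inter>n. S n) \<in> shifts G A" and "agree_on (Y n) (S n) (\<Inter>n. S n)"
proof -
  have S_mono: "S m \<subseteq> S n" if "n \<le> m" for n m using lift_Suc_antimono_le[of S, OF dec that] .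
  have Y_mono: "Y n \<subseteq> Y m" if "n \<le> m" for n m using lift_Suc_mono_le[of Y, OF Y(3) that] .
  have agree_le: "agree_on (Y n) (S n) (S (n + k))" for n k
  proof (induction k)
    case (Suc k)
    have "agree_on (Y n) (S (n + k)) (S (Suc (n + k)))"
      using agree_on_mono[OF agree Y_mono[of n "n + k"]] by simp
    then show ?case using agree_on_trans[OF Suc] by simp
  qed (simp add: agree_on_def)
  have lim: "\<exists>s\<in>(\<Inter>n. S n). \<forall>x\<in>Y n. s x = \<sigma> x" if \<sigma>: "\<sigma> \<in> S n" for \<sigma> n
  proof -
    define C where "C k = {s \<in> S (n + k). \<forall>x\<in>Y n. s x = \<sigma> x}" for k
    have "(\<Inter>k. C k) \<noteq> {}"
    proof (rule compact_space_imp_nest)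
      show "compact_space (full_shift G A)"
        unfolding full_shift_def compact_space_product_topology
        using A by (simp add: compact_space_discrete_topology)
      show "closedin (full_shift G A) (C k)" for k
        unfolding closedin_full_shift_iff
      proof (intro conjI ballI impI)
        show "C k \<subseteq> carrier G \<rightarrow>\<^sub>E A" using shifts_ext[OF S] by (auto simp: C_def)
        fix t assume t: "t \<in> carrier G \<rightarrow>\<^sub>E A"
          and app: "\<forall>Z. finite Z \<and> Z \<subseteq> carrier G \<longrightarrow> (\<exists>s\<in>C k. \<forall>z\<in>Z. s z = t z)"
        have "\<exists>s\<in>S (n + k). \<forall>z\<in>Z. s z = t z" if "finite Z" "Z \<subseteq> carrier G" for Z
          using app that unfolding C_def by blast
        then have "t \<in> S (n + k)" by (rule closedin_full_shift_limit[OF shifts_closed[OF S] t])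
        moreover have "\<exists>s\<in>C k. \<forall>z\<in>Y n. s z = t z" using app[rule_format, of "Y n"] Y(1,2) by simp
        then obtain s where "s \<in> C k" "\<forall>z\<in>Y n. s z = t z" by (elim bexE)
        ultimately show "t \<in> C k" by (simp add: C_def)
      qed
      show "C k \<noteq> {}" for k
        using agree_onD[OF agree_on_sym[OF agree_le[of n k]] \<sigma>] by (auto simp: C_def)
      show "decseq C"
      proof (rule decseq_SucI)
        show "C (Suc k) \<subseteq> C k" for k using dec[of "n + k"] by (auto simp: C_def)
      qed
    qed
    then obtain s where s: "\<And>k. s \<in> C k" by blast
    have "s \<in> S m" for m
    proof -
      have "s \<in> S (n + m)" using s[of m] by (simp add: C_def)
      then show ?thesis using S_mono[of m "n + m"] by auto
    qed
    moreover have "\<forall>x\<in>Y n. s x = \<sigma> x" using s[of 0] by (simp add: C_def)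
    ultimately show ?thesis by blast
  qed
  have sub: "(\<Inter>n. S n) \<subseteq> S n" for n by blast
  show "agree_on (Y n) (S n) (\<Inter>n. S n)" by (rule agree_onI[OF sub lim])
  show "(\<Inter>n. S n) \<in> shifts G A"
    unfolding shifts_def
  proof (intro CollectI conjI ballI)
    show "closedin (full_shift G A) (\<Inter>n. S n)" using shifts_closed[OF S] by (intro closedin_Inter) auto
    show "translate G g s \<in> (\<Inter>n. S n)" if "g \<in> carrier G" "s \<in> (\<Inter>n. S n)" for g s
      using that shifts_translate[OF S] by blast
    obtain \<sigma> where "\<sigma> \<in> S 0" using S[of 0] by (auto simp: shifts_def)
    then show "(\<Inter>n. S n) \<noteq> {}" using lim by blast
  qed
qed

text \<open>The chain of shifts is built together with growing finite sets on which all later shifts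
  agree. These absorb every \<open>E n\<close>, so the intersection is a limit of the chain, and the
  coordinates witnessing \<open>moved_by\<close>, so that these witnesses persist. They also contain
  \<open>x\<close>: two values at \<open>x\<close> survive at each stage, as
  \<open>strongly_irreducible_moved_by\<close> requires.\<close>

lemma generic_shift_dense:
  fixes E :: "nat \<Rightarrow> 'a set"
  assumes icc: "ICC G" and nt: "carrier G \<noteq> {\<one>}" and A: "finite A" and SI: "strongly_irreducible G A S0"
    and ab: "a \<in> S0" "b \<in> S0" "a x \<noteq> b x" and x: "x \<in> carrier G" and X: "finite X" "X \<subseteq> carrier G" "x \<in> X"
    and E: "\<And>n. finite (E n)" "\<And>n. E n \<subseteq> carrier G"
    and exh: "\<And>Z. finite Z \<Longrightarrow> Z \<subseteq> carrier G \<Longrightarrow> \<exists>n. \<forall>m\<ge>n. Z \<subseteq> E m"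
  obtains T where "T \<in> shifts G A" "agree_on X S0 T"
    "T \<in> shift_space G A closure_of {S. strongly_irreducible G A S}"
    "\<And>n. jointly_recurrent (E n) T" "\<And>g. g \<in> carrier G - {\<one>} \<Longrightarrow> moved_by g T"
proof -
  define P where "P p \<longleftrightarrow> strongly_irreducible G A (fst p) \<and> finite (snd p) \<and> snd p \<subseteq> carrier G \<and> x \<in> snd p \<and>
    (\<exists>a\<in>fst p. \<exists>b\<in>fst p. a x \<noteq> b x)" for p :: "('a \<Rightarrow> 'c) set \<times> 'a set"
  define R where "R n p q \<longleftrightarrow> fst q \<subseteq> fst p \<and> agree_on (snd p) (fst p) (fst q) \<and> snd p \<subseteq> snd q \<and> E n \<subseteq> snd q \<and>
    jointly_recurrent (E n) (fst q) \<and> (\<forall>g\<in>E n - {\<one>}. \<exists>s\<in>fst q. \<exists>h\<in>snd q. inv g \<otimes> h \<in> snd q \<and> s (inv g \<otimes> h) \<noteq> s h)"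
    for n and p q :: "('a \<Rightarrow> 'c) set \<times> 'a set"
  have step: "\<exists>q. P q \<and> R n p q" if p: "P p" for p n
  proof -
    obtain S Y where SY: "p = (S, Y)" by (cases p)
    have S: "strongly_irreducible G A S" and Y: "finite Y" "Y \<subseteq> carrier G" "x \<in> Y" and ab': "\<exists>a\<in>S. \<exists>b\<in>S. a x \<noteq> b x"
      using p by (auto simp: P_def SY)
    from ab' obtain a b where ab: "a \<in> S" "b \<in> S" "a x \<noteq> b x" by blast
    have W: "finite (Y \<union> E n)" "Y \<union> E n \<subseteq> carrier G" using Y E by auto
    show ?thesis
    proof (rule jointly_recurrent_refinement[OF icc nt A S W])
      fix S' assume S': "strongly_irreducible G A S'" "S' \<subseteq> S" "agree_on (Y \<union> E n) S S'" "jointly_recurrent (Y \<union> E n) S'"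
      have ag: "agree_on Y S S'" using agree_on_mono[OF S'(3)] by simp
      obtain a' where a': "a' \<in> S'" "\<forall>x\<in>Y. a' x = a x" using agree_onD[OF agree_on_sym[OF ag] ab(1)] by (elim bexE)
      obtain b' where b': "b' \<in> S'" "\<forall>x\<in>Y. b' x = b x" using agree_onD[OF agree_on_sym[OF ag] ab(2)] by (elim bexE)
      have ab': "a' x \<noteq> b' x" using a' b' ab(3) Y(3) by simp
      have "\<exists>s\<in>S'. \<exists>h\<in>carrier G. s (inv g \<otimes> h) \<noteq> s h" if "g \<in> E n - {\<one>}" for g
        using strongly_irreducible_moved_by[OF icc S'(1) a'(1) b'(1) ab' x, of g] that E(2)[of n]
        unfolding moved_by_def by blast
      then obtain h where h: "\<And>g. g \<in> E n - {\<one>} \<Longrightarrow> h g \<in> carrier G \<and> (\<exists>s\<in>S'. s (inv g \<otimes> h g) \<noteq> s (h g))"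
        by metis
      let ?Y = "Y \<union> E n \<union> h ` (E n - {\<one>}) \<union> (\<lambda>g. inv g \<otimes> h g) ` (E n - {\<one>})"
      have EC: "g \<in> carrier G" if "g \<in> E n" for g using that E(2)[of n] by blast
      have "finite ?Y" using W E(1)[of n] by simp
      moreover have "?Y \<subseteq> carrier G" using Y(2) EC h by auto
      ultimately have "P (S', ?Y)"
        using S'(1) Y(3) a'(1) b'(1) ab' by (auto simp: P_def)
      moreover have "\<exists>s\<in>S'. \<exists>k\<in>?Y. inv g \<otimes> k \<in> ?Y \<and> s (inv g \<otimes> k) \<noteq> s k" if g: "g \<in> E n - {\<one>}" for g
      proof -
        obtain s where "s \<in> S'" "s (inv g \<otimes> h g) \<noteq> s (h g)" using h[OF g] by blast
        then show ?thesis using g by (intro bexI[of _ s] bexI[of _ "h g"]) auto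
      qed
      then have "R n p (S', ?Y)"
        using S'(2) ag jointly_recurrent_mono[OF S'(4), of "E n" S'] by (auto simp: R_def SY)
      ultimately show ?thesis by blast
    qed
  qed
  have "P (S0, X)" using SI X ab by (auto simp: P_def)
  then obtain f where f0: "f 0 = (S0, X)" and f: "\<And>n. P (f n)" "\<And>n. R n (f n) (f (Suc n))"
    using dependent_nat_choice[of "\<lambda>n p. P p \<and> (n = 0 \<longrightarrow> p = (S0, X))" R] step by (metis nat.distinct(1))
  define S where "S n = fst (f n)" for n
  define Y where "Y n = snd (f n)" for n
  have S: "strongly_irreducible G A (S n)" for n using f(1)[of n] by (simp add: P_def S_def)
  then have Ss: "S n \<in> shifts G A" for n by (simp add: strongly_irreducible_def)
  have Y: "finite (Y n)" "Y n \<subseteq> carrier G" "x \<in> Y n" for n using f(1)[of n] by (simp_all add: P_def Y_def)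
  have step': "S (Suc n) \<subseteq> S n" "agree_on (Y n) (S n) (S (Suc n))" "Y n \<subseteq> Y (Suc n)" "E n \<subseteq> Y (Suc n)"
    "jointly_recurrent (E n) (S (Suc n))"
    "\<forall>g\<in>E n - {\<one>}. \<exists>s\<in>S (Suc n). \<exists>h\<in>Y (Suc n). inv g \<otimes> h \<in> Y (Suc n) \<and> s (inv g \<otimes> h) \<noteq> s h" for n
    using f(2)[of n] by (simp_all add: R_def S_def Y_def)
  note lim = shift_chain_limit[of A S Y, OF A Ss step'(1) Y(1,2) step'(3,2)]
  let ?T = "\<Inter>n. S n"
  show thesis
  proof (rule that[OF lim(1)])
    show "agree_on X S0 ?T" using lim(2)[of 0] f0 by (simp add: S_def Y_def)
    show "?T \<in> shift_space G A closure_of {S. strongly_irreducible G A S}"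
      unfolding in_closure_of topspace_shift_space
    proof (intro conjI lim(1) allI impI)
      fix U assume U: "?T \<in> U \<and> openin (shift_space G A) U"
      then obtain Z where Z: "finite Z" "Z \<subseteq> carrier G" "{T' \<in> shifts G A. agree_on Z ?T T'} \<subseteq> U"
        unfolding openin_shift_space_iff by blast
      obtain n where "Z \<subseteq> E n" using exh[OF Z(1,2)] by blast
      then have "Z \<subseteq> Y (Suc n)" using step'(4) by blast
      then have "agree_on Z ?T (S (Suc n))" using agree_on_mono[OF agree_on_sym[OF lim(2)]] by blast
      then have "S (Suc n) \<in> U" using Z(3) Ss by blast
      then show "\<exists>T'. T' \<in> {S. strongly_irreducible G A S} \<and> T' \<in> U" using S by blast
    qed
    show "jointly_recurrent (E n) ?T" for n
      by (rule jointly_recurrent_mono[OF step'(5)]) auto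
    fix g assume g: "g \<in> carrier G - {\<one>}"
    then obtain n where n: "g \<in> E n" using exh[of "{g}"] by auto
    then obtain s h where s: "s \<in> S (Suc n)" "h \<in> Y (Suc n)" "inv g \<otimes> h \<in> Y (Suc n)" "s (inv g \<otimes> h) \<noteq> s h"
      using step'(6)[of n] g by blast
    obtain s' where s': "s' \<in> ?T" "\<forall>x\<in>Y (Suc n). s' x = s x"
      using agree_onD[OF agree_on_sym[OF lim(2)] s(1)] by (elim bexE)
    have "s' (inv g \<otimes> h) \<noteq> s' h" using s' s by simp
    moreover have "h \<in> carrier G" using s(2) Y(2) by blast
    ultimately show "moved_by g ?T" using s'(1) unfolding moved_by_def by blast
  qed
qed

end

text \<open>The trivial group is vacuously ICC, but over it every two-element set of configurations
  is a strongly irreducible shift, isolated in the space of shifts and not minimal; hence the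
  nontriviality assumption.\<close>

theorem proposition2p12:
  fixes G :: "('g, 'm) monoid_scheme" and A :: "'a set"
  assumes "group G" and "countable (carrier G)" and "ICC G" and "carrier G \<noteq> {\<one>\<^bsub>G\<^esub>}"
    and "finite A" and "card A \<ge> 2"
  shows "\<exists>D. gdelta_in (si_closure_space G A) D \<and>
    si_closure_space G A closure_of D = topspace (si_closure_space G A) \<and>
    (\<forall>S\<in>D. faithful_action G S (shift_action G S) \<and>
      minimal_action G (subtopology (full_shift G A) S) (shift_action G S) \<and>
      proximal_action G (subtopology (full_shift G A) S) (shift_action G S))"
proof -
  interpret group G by fact
  \<comment> \<open>Initial segments of an enumeration. Countability makes them exhaust the group
    and leaves countably many open conditions.\<close>
  define E where "E n = from_nat_into (carrier G) ` {..<n}" for n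
  have E: "finite (E n)" "E n \<subseteq> carrier G" for n
    using from_nat_into[of "carrier G"] by (auto simp: E_def)
  have exh: "\<exists>n. \<forall>m\<ge>n. Z \<subseteq> E m" if Z: "finite Z" "Z \<subseteq> carrier G" for Z
  proof -
    let ?N = "to_nat_on (carrier G) ` Z"
    obtain n where n: "\<forall>k\<in>?N. k < n" using finite_nat_set_iff_bounded[of ?N] Z(1) by auto
    have "Z \<subseteq> E m" if "m \<ge> n" for m
    proof
      fix z assume z: "z \<in> Z"
      then have "from_nat_into (carrier G) (to_nat_on (carrier G) z) = z"
        using assms(2) Z(2) by (intro from_nat_into_to_nat_on) auto
      moreover have "to_nat_on (carrier G) z < m" using n z that by force
      ultimately show "z \<in> E m" unfolding E_def by force
    qed
    then show ?thesis by blast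
  qed
  define T where "T = shift_space G A closure_of {S. strongly_irreducible G A S} - {{s} |s. True}"
  let ?Om = "si_closure_space G A"
  have Om: "?Om = subtopology (shift_space G A) T" by (simp add: si_closure_space_def T_def)
  have Tsub: "T \<subseteq> shifts G A"
    using closure_of_subset_topspace[of "shift_space G A"] by (auto simp: T_def topspace_shift_space)
  have top: "topspace ?Om = T" using Tsub by (auto simp: Om topspace_shift_space)
  define \<U> where "\<U> = range (\<lambda>n. {S \<in> T. jointly_recurrent (E n) S}) \<union>
    (\<lambda>g. {S \<in> T. moved_by g S}) ` (carrier G - {\<one>\<^bsub>G\<^esub>})"
  define D where "D = \<Inter>\<U>"
  have D: "S \<in> D \<longleftrightarrow> S \<in> T \<and> (\<forall>n. jointly_recurrent (E n) S) \<and> (\<forall>g\<in>carrier G - {\<one>\<^bsub>G\<^esub>}. moved_by g S)" for S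
    unfolding D_def \<U>_def Inter_Un_distrib by auto
  have openT: "openin ?Om {S \<in> T. Q S}" if "openin (shift_space G A) {S \<in> shifts G A. Q S}" for Q
    unfolding Om openin_subtopology using that Tsub
    by (intro exI[of _ "{S \<in> shifts G A. Q S}"]) auto
  have "gdelta_in ?Om U" if "U \<in> \<U>" for U
    using that openT[OF openin_jointly_recurrent[OF E]] openT[OF openin_moved_by]
    by (intro open_imp_gdelta_in) (auto simp: \<U>_def)
  moreover have "countable \<U>" using assms(2) by (simp add: \<U>_def)
  moreover have "\<U> \<noteq> {}" by (simp add: \<U>_def)
  ultimately have gd: "gdelta_in ?Om D" unfolding D_def by (intro gdelta_in_Inter)
  have "T \<subseteq> ?Om closure_of D"
  proof
    fix S assume S: "S \<in> T"
    have "\<exists>S'. S' \<in> D \<and> S' \<in> U" if U: "S \<in> U" "openin ?Om U" for U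
    proof -
      obtain V where V: "openin (shift_space G A) V" "U = V \<inter> T"
        using U(2) unfolding Om openin_subtopology by (elim exE conjE) (rule that)
      have "S \<in> V" using U(1) V(2) by blast
      with conjunct2[OF V(1)[unfolded openin_shift_space_iff]]
      have "\<exists>X. finite X \<and> X \<subseteq> carrier G \<and> {S' \<in> shifts G A. agree_on X S S'} \<subseteq> V" by (rule bspec)
      then obtain X where X: "finite X" "X \<subseteq> carrier G" "{S' \<in> shifts G A. agree_on X S S'} \<subseteq> V"
        by (elim exE conjE) (rule that)
      have Ss: "S \<in> shifts G A" using S Tsub by blast
      then have "S \<noteq> {}" by (simp add: shifts_def)
      then obtain a where a: "a \<in> S" by blast
      \<comment> \<open>Removal of the singletons enters here: two configurations of
        \<open>S\<close> differ at some \<open>x\<close>, and adding \<open>x\<close> to the window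
        keeps both the strongly irreducible approximation and the final shift from being
        singletons.\<close>
      have "S \<noteq> {a}" using S by (auto simp: T_def)
      then obtain b where b: "b \<in> S" "b \<noteq> a" using a by blast
      have "\<exists>x\<in>carrier G. a x \<noteq> b x"
      proof (rule ccontr)
        assume "\<not> ?thesis"
        then have "a = b" using PiE_ext[OF shifts_ext[OF Ss a] shifts_ext[OF Ss b(1)]] by blast
        then show False using b(2) by simp
      qed
      then obtain x where x: "x \<in> carrier G" "a x \<noteq> b x" by blast
      let ?X = "insert x X"
      have X': "finite ?X" "?X \<subseteq> carrier G" "x \<in> ?X" using X x by auto
      let ?N = "{S' \<in> shifts G A. agree_on ?X S S'}"
      have "openin (shift_space G A) ?N"
        unfolding shift_space_def using X' Ss by (intro topology_generated_by_Basis) blast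
      then have N: "S \<in> ?N \<and> openin (shift_space G A) ?N" using Ss by (simp add: agree_on_def)
      have "S \<in> shift_space G A closure_of {S. strongly_irreducible G A S}" using S by (simp add: T_def)
      then have cl: "\<forall>U. S \<in> U \<and> openin (shift_space G A) U \<longrightarrow>
          (\<exists>S'. S' \<in> {S. strongly_irreducible G A S} \<and> S' \<in> U)"
        unfolding in_closure_of by (rule conjunct2)
      have "\<exists>S'. S' \<in> {S. strongly_irreducible G A S} \<and> S' \<in> ?N" by (rule mp[OF spec[OF cl] N])
      then obtain S0 where S0: "strongly_irreducible G A S0" "agree_on ?X S S0" by auto
      obtain a' where a': "a' \<in> S0" "\<forall>y\<in>?X. a' y = a y" using agree_onD[OF agree_on_sym[OF S0(2)] a] by (elim bexE)
      obtain b' where b': "b' \<in> S0" "\<forall>y\<in>?X. b' y = b y" using agree_onD[OF agree_on_sym[OF S0(2)] b(1)] by (elim bexE)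
      have ab': "a' x \<noteq> b' x" using a' b' x(2) by simp
      show ?thesis
      proof (rule generic_shift_dense[OF assms(3,4,5) S0(1) a'(1) b'(1) ab' x(1) X' E exh])
        fix S' assume S': "S' \<in> shifts G A" "agree_on ?X S0 S'"
          "S' \<in> shift_space G A closure_of {S. strongly_irreducible G A S}"
          "\<And>n. jointly_recurrent (E n) S'" "\<And>g. g \<in> carrier G - {\<one>\<^bsub>G\<^esub>} \<Longrightarrow> moved_by g S'"
        have ag: "agree_on ?X S S'" by (rule agree_on_trans[OF S0(2) S'(2)])
        have "S' \<noteq> {s}" for s
        proof
          assume "S' = {s}"
          moreover have "\<exists>u\<in>S'. \<forall>y\<in>?X. u y = a y"
            by (rule agree_onD[OF agree_on_sym[OF ag] a])
          moreover have "\<exists>u\<in>S'. \<forall>y\<in>?X. u y = b y"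
            by (rule agree_onD[OF agree_on_sym[OF ag] b(1)])
          ultimately show False using x(2) by simp
        qed
        then have "S' \<in> T" using S'(3) by (auto simp: T_def)
        moreover have "agree_on X S S'" by (rule agree_on_mono[OF ag]) blast
        then have "S' \<in> V" using X(3) S'(1) by blast
        ultimately have "S' \<in> D" "S' \<in> U" using S'(4,5) V(2) by (auto simp: D)
        then show ?thesis by blast
      qed
    qed
    then show "S \<in> ?Om closure_of D" unfolding in_closure_of top using S by blast
  qed
  then have dense: "?Om closure_of D = topspace ?Om"
    using closure_of_subset_topspace[of ?Om D] top by blast
  have "faithful_action G S (shift_action G S) \<and>
      minimal_action G (subtopology (full_shift G A) S) (shift_action G S) \<and>
      proximal_action G (subtopology (full_shift G A) S) (shift_action G S)" if S: "S \<in> D" for S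
  proof (intro conjI)
    have Ss: "S \<in> shifts G A" using S Tsub by (auto simp: D)
    have JR: "jointly_recurrent W S" if W: "finite W" "W \<subseteq> carrier G" for W
    proof -
      obtain n where "W \<subseteq> E n" using exh[OF W] by blast
      then show ?thesis using jointly_recurrent_mono[of "E n" S W S] S by (simp add: D)
    qed
    show "faithful_action G S (shift_action G S)"
      by (rule faithful_if_moved[OF Ss]) (use S in \<open>simp add: D\<close>)
    show "minimal_action G (subtopology (full_shift G A) S) (shift_action G S)"
      by (rule minimal_if_jointly_recurrent[OF Ss JR])
    show "proximal_action G (subtopology (full_shift G A) S) (shift_action G S)"
      by (rule proximal_if_jointly_recurrent[OF Ss JR E exh])
  qed
  then show ?thesis using gd dense by blast
qed

end
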